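(* Let $X$ be a real random variable with probability law $\mu$ on $\mathbb{R}$ whose moment generating function is finite in a neighborhood of zero, i.e. there is $t_0>0$ with $\mathbb{E}e^{tX}<\infty$ for all $t\in(-t_0,t_0)$. Let $q(x)=\delta x^2+\beta x+\gamma$ with real coefficients, and let $g_1,g_2\in L^2(\mathbb{R},\mu)$. (a) Suppose $X$ has a density $f$ such that $\int_{-\infty}^x(\mathbb{E}X-t)f(t)\,dt=q(x)f(x)$ for all $x\in\mathbb{R}$, and let $(r,s)=\{x:f(x)>0\}$. If $g_1,g_2$ are infinitely differentiable on $(r,s)$ and, for $i=1,2$, $\mathbb{E}[q^k(X)|g_i^{(k)}(X)|]<\infty$ for $k=0,1,2,\ldots$, then $$\operatorname{Cov}[g_1(X),g_2(X)]=\sum_{k=1}^\infty\frac{\mathbb{E}\bigl[q^k(X)g_1^{(k)}(X)\bigr]\cdot\mathbb{E}\bigl[q^k(X)g_2^{(k)}(X)\bigr]}{k!\,\mathbb{E}[q^k(X)]\prod_{j=k-1}^{2k-2}(1-j\delta)}.$$ (b) Suppose $X$ is non-negative integer-valued with probability function $p$ such that $\sum_{j=0}^x(\mathbb{E}X-j)p(j)=q(x)p(x)$ for all $x=0,1,2,\ldots$. If, for $i=1,2$, $\mathbb{E}\bigl[q^{[k]}(X)|\Delta^k[g_i(X)]|\bigr]<\infty$ for $k=0,1,2,\ldots$, then $$\operatorname{Cov}[g_1(X),g_2(X)]=\sum_{k=1}^\infty\frac{\mathbb{E}\bigl[q^{[k]}(X)\Delta^k[g_1(X)]\bigr]\cdot\mathbb{E}\bigl[q^{[k]}(X)\Delta^k[g_2(X)]\bigr]}{k!\,\mathbb{E}[q^{[k]}(X)]\prod_{j=k-1}^{2k-2}(1-j\delta)},$$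 where each term with $\mathbb{E}[q^{[k]}(X)]=0$ is treated as zero.
   Context: $q$ has degree at most 2 ($\delta,\beta$ may be zero); $q^k(x)=(q(x))^k$; $q^{[k]}(x)=q(x)q(x+1)\cdots q(x+k-1)$, $q^{[0]}\equiv1$. $\Delta[g(x)]=g(x+1)-g(x)$, $\Delta^k=\Delta\circ\Delta^{k-1}$, $\Delta^0=\mathrm{id}$. In (a), the identity defining $q$ implies that (after possibly redefining $f$ at finite endpoints) $\{f>0\}$ is an open interval $(r,s)$, $-\infty\le r<s\le\infty$, with $q>0$ on it. In (b), the support $J=\{x\in\mathbb{Z}:p(x)>0\}$ is automatically a finite or infinite integer interval; if $x\in J$ but $x+k\notin J$ then $q^{[k]}(x)=0$, and $q^{[k]}(x)\Delta^k[g(x)]$ is read as $0$. *)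

theory Defs
  imports "HOL-Probability.Probability"
begin

definition covariance :: "'a measure \<Rightarrow> ('a \<Rightarrow> real) \<Rightarrow> ('a \<Rightarrow> real) \<Rightarrow> real" where
  "covariance M U V =
     (\<integral>\<omega>. (U \<omega> - (\<integral>\<omega>'. U \<omega>' \<partial>M)) * (V \<omega> - (\<integral>\<omega>'. V \<omega>' \<partial>M)) \<partial>M)"

definition square_integrable :: "real measure \<Rightarrow> (real \<Rightarrow> real) \<Rightarrow> bool" where
  "square_integrable \<mu> g \<longleftrightarrow> g \<in> borel_measurable \<mu> \<and> integrable \<mu> (\<lambda>x. (g x)\<^sup>2)"

text \<open>For an open set \<open>I\<close>, differentiability of every iterate \<open>(deriv ^^ k) g\<close> on \<open>I\<close> only
  involves the values of \<open>g\<close> on \<open>I\<close>.\<close>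

definition infinitely_differentiable_on :: "(real \<Rightarrow> real) \<Rightarrow> real set \<Rightarrow> bool" where
  "infinitely_differentiable_on g I \<longleftrightarrow> (\<forall>k. (deriv ^^ k) g differentiable_on I)"

text \<open>Derivative of order \<open>k\<close> on the open set \<open>I\<close>, set to \<open>0\<close> outside \<open>I\<close>, where \<open>g\<close> need not be
  differentiable and \<open>deriv\<close> takes arbitrary values. It is only composed with random variables
  that lie in \<open>I\<close> almost surely, so the value outside \<open>I\<close> does not affect expectations.\<close>

definition nth_deriv_on :: "real set \<Rightarrow> nat \<Rightarrow> (real \<Rightarrow> real) \<Rightarrow> real \<Rightarrow> real" where
  "nth_deriv_on I k g x = (if x \<in> I then (deriv ^^ k) g x else 0)"

definition fwd_diff :: "(real \<Rightarrow> real) \<Rightarrow> real \<Rightarrow> real" where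
  "fwd_diff g = (\<lambda>x. g (x + 1) - g x)"

definition rising_prod :: "(real \<Rightarrow> real) \<Rightarrow> nat \<Rightarrow> real \<Rightarrow> real" where
  "rising_prod q k x = (\<Prod>i<k. q (x + real i))"

end

theory Submission
  imports Defs
begin

text \<open>
  Let \<open>D\<close> be the derivative, resp. the forward difference, and \<open>w\<^sub>k\<close> be \<open>q\<^sup>k\<close>, resp. the
  rising product of \<open>q\<close>. The Pearson identity says that \<open>D\<close>, as an operator from the space weighted by
  \<open>w\<^sub>k\<close> to the one weighted by \<open>w\<^sub>k\<^sub>+\<^sub>1\<close>, has an adjoint \<open>B\<^sub>k\<close> that maps polynomials to polynomials and raises
  degrees by at most one. Hence the polynomials \<open>P\<^sub>k = B\<^sub>0 \<dots> B\<^sub>k\<^sub>-\<^sub>1 1\<close> satisfy the Rodrigues identity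
  \<open>E (P\<^sub>k g) = E (w\<^sub>k D\<^sup>k g)\<close>. Applied to polynomials \<open>g\<close>, it shows that they are orthogonal and that
  \<open>E (P\<^sub>k\<^sup>2) = k! c\<^sub>k E w\<^sub>k\<close>, where \<open>c\<^sub>k\<close>, the product of the \<open>1 - j \<delta>\<close>, is the leading coefficient.
  Exponential moments make the polynomials dense in mean square, so the series is Parseval's identity.

  In the continuous case the boundary terms need care, because only \<open>q\<^sup>k g\<^sup>(\<^sup>k\<^sup>)\<close>, without polynomial factors, is
  assumed to be integrable. The existence of all moments forces \<open>\<delta> \<le> 0\<close>. If \<open>\<delta> < 0\<close>, the support is
  bounded; if \<open>\<delta> = 0\<close>, integration by parts gains one power of \<open>x\<close> at a time.
\<close>

section \<open>Square-integrable functions\<close>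

text \<open>Each use of an adjoint leaves a polynomial factor behind, so the relation must hold for
  \<open>w k\<close> times the k-th derivative of g against every polynomial. This is the obstacle
  in the continuous case. It shapes the integration by parts, whose integrability assumption
  concerns \<open>h' * W\<close> alone and which delivers integrability of \<open>h * v\<close> and
  the vanishing of both boundary terms. Density rests on Fourier uniqueness: a function orthogonal
  to all powers has a transform that vanishes near 0 by expanding the exponential, and everywhere by
  translation, since multiplying by a character preserves the argument. Laws on finitely many points
  are the degenerate case. There mean-square space is finite dimensional, so high \<open>P k\<close>
  are null and their terms are 0/0, which HOL evaluates to 0. Completeness then uses polynomials
  that vanish almost everywhere in place of the missing \<open>P k\<close>.\<close>

lemma borel_measurable_poly[measurable]: "poly p \<in> borel_measurable borel" for p :: "real poly"
  by (simp add: borel_measurable_continuous_onI continuous_at_imp_continuous_on)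

lemma abs_mult_le_sum_squares: "\<bar>a * b\<bar> \<le> a\<^sup>2 + b\<^sup>2" for a b :: real
proof -
  have "2 * (\<bar>a\<bar> * \<bar>b\<bar>) \<le> a\<^sup>2 + b\<^sup>2"
    using sum_squares_bound[of "\<bar>a\<bar>" "\<bar>b\<bar>"] by (simp add: mult.assoc)
  moreover have "0 \<le> \<bar>a\<bar> * \<bar>b\<bar>" by simp
  ultimately show ?thesis unfolding abs_mult by linarith
qed

lemma square_integrable_mult:
  assumes "square_integrable N g" "square_integrable N h"
  shows "integrable N (\<lambda>x. g x * h x)"
proof (rule Bochner_Integration.integrable_bound)
  show "integrable N (\<lambda>x. (g x)\<^sup>2 + (h x)\<^sup>2)"
    using assms by (auto simp: square_integrable_def)
  show "(\<lambda>x. g x * h x) \<in> borel_measurable N"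
    using assms by (auto simp: square_integrable_def)
  show "AE x in N. norm (g x * h x) \<le> norm ((g x)\<^sup>2 + (h x)\<^sup>2)"
    using abs_mult_le_sum_squares by (auto intro!: AE_I2)
qed

lemma square_integrable_add:
  assumes "square_integrable N g" "square_integrable N h"
  shows "square_integrable N (\<lambda>x. g x + h x)"
  using assms square_integrable_mult[OF assms]
  by (auto simp: square_integrable_def power2_sum mult.assoc)

lemma square_integrable_cmult:
  assumes "square_integrable N g"
  shows "square_integrable N (\<lambda>x. c * g x)"
  using assms by (auto simp: square_integrable_def power_mult_distrib)

lemma square_integrable_diff:
  assumes "square_integrable N g" "square_integrable N h"
  shows "square_integrable N (\<lambda>x. g x - h x)"
  using square_integrable_add[OF assms(1) square_integrable_cmult[OF assms(2), of "-1"]] by simp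

lemma square_integrable_sum:
  assumes "\<And>i. i \<in> A \<Longrightarrow> square_integrable N (g i)"
  shows "square_integrable N (\<lambda>x. \<Sum>i\<in>A. g i x)"
  using assms
proof (induction A rule: infinite_finite_induct)
  case (insert a A)
  then show ?case by (simp add: square_integrable_add)
qed (auto simp: square_integrable_def)

lemma square_integrable_Cauchy_Schwarz:
  assumes "square_integrable N g" "square_integrable N h"
  shows "(\<integral>x. g x * h x \<partial>N)\<^sup>2 \<le> (\<integral>x. (g x)\<^sup>2 \<partial>N) * (\<integral>x. (h x)\<^sup>2 \<partial>N)"
proof -
  let ?a = "\<integral>x. (g x)\<^sup>2 \<partial>N" and ?b = "\<integral>x. g x * h x \<partial>N" and ?c = "\<integral>x. (h x)\<^sup>2 \<partial>N"
  note [simp] = square_integrable_mult[OF assms]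
  have ig: "integrable N (\<lambda>x. (g x)\<^sup>2)" "integrable N (\<lambda>x. (h x)\<^sup>2)"
    using assms by (auto simp: square_integrable_def)
  have nn: "0 \<le> s\<^sup>2 * ?a - 2 * s * t * ?b + t\<^sup>2 * ?c" for s t
  proof -
    have "0 \<le> (\<integral>x. (s * g x - t * h x)\<^sup>2 \<partial>N)" by simp
    also have "\<dots> = (\<integral>x. s\<^sup>2 * (g x)\<^sup>2 - 2 * s * t * (g x * h x) + t\<^sup>2 * (h x)\<^sup>2 \<partial>N)"
      by (simp add: power2_diff power_mult_distrib algebra_simps)
    also have "\<dots> = s\<^sup>2 * ?a - 2 * s * t * ?b + t\<^sup>2 * ?c"
      using ig by simp
    finally show ?thesis .
  qed
  have a: "?a \<ge> 0" and c: "?c \<ge> 0" by auto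
  show ?thesis
  proof (cases "?c = 0")
    case True
    have "?b = 0"
    proof (rule ccontr)
      assume "?b \<noteq> 0"
      \<comment> \<open>With \<open>?c = 0\<close> the form at \<open>s = 1\<close> is
        \<open>?a - 2 * t * ?b\<close>; this \<open>t\<close> makes it equal to -1.\<close>
      then show False using nn[of 1 "(?a + 1) / (2 * ?b)"] True by simp
    qed
    with True show ?thesis by simp
  next
    case False
    have "0 \<le> ?c * (?a * ?c - ?b\<^sup>2)" using nn[of ?c ?b]
      by (simp add: power2_eq_square algebra_simps)
    then show ?thesis using False c by (simp add: zero_le_mult_iff)
  qed
qed

text \<open>A subsequence with summable increments converges almost everywhere,
  and Fatou's lemma turns this into mean square convergence.\<close>

lemma square_integrable_Cauchy_convergent:
  assumes "prob_space N" and S: "\<And>n. square_integrable N (S n)"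
    and C: "\<And>e. e > 0 \<Longrightarrow> \<exists>n0. \<forall>m\<ge>n0. \<forall>n\<ge>n0. (\<integral>x. (S n x - S m x)\<^sup>2 \<partial>N) \<le> e"
  obtains u where "square_integrable N u" "(\<lambda>n. \<integral>x. (u x - S n x)\<^sup>2 \<partial>N) \<longlonglongrightarrow> 0"
proof -
  interpret prob_space N by fact
  have [measurable]: "\<And>n. S n \<in> borel_measurable N" using S by (simp add: square_integrable_def)
  have sq: "integrable N (\<lambda>x. (S n x - S m x)\<^sup>2)" for m n
    using square_integrable_diff[OF S[of n] S[of m]] by (simp add: square_integrable_def)
  \<comment> \<open>A second moment of at most \<open>(1/4)^i\<close> bounds the first absolute
    moment of an increment by \<open>(1/2)^i\<close>, which is summable.\<close>
  have "\<exists>n0. \<forall>m\<ge>n0. \<forall>n\<ge>n0. (\<integral>x. (S n x - S m x)\<^sup>2 \<partial>N) \<le> (1/4)^i" for i :: nat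
    by (rule C) simp
  then obtain n0 where n0: "\<And>i m n. m \<ge> n0 i \<Longrightarrow> n \<ge> n0 i \<Longrightarrow> (\<integral>x. (S n x - S m x)\<^sup>2 \<partial>N) \<le> (1/4)^i"
    by metis
  \<comment> \<open>Adding up the thresholds makes \<open>r\<close> monotone, and the summand
    \<open>i\<close> makes it tend to infinity.\<close>
  define r where "r i = (\<Sum>j\<le>i. n0 j) + i" for i
  have r0: "r i \<ge> n0 i" for i unfolding r_def
    by (simp add: trans_le_add1 member_le_sum)
  have r1: "r i \<le> r j" if "i \<le> j" for i j unfolding r_def
    by (intro add_mono sum_mono2) (use that in auto)
  have r2: "r i \<ge> i" for i unfolding r_def by simp
  have dl: "(\<integral>x. (S (r (Suc i)) x - S (r i) x)\<^sup>2 \<partial>N) \<le> (1/4)^i" for i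
    by (rule n0) (use r0 r1[of i "Suc i"] in \<open>auto intro: order_trans\<close>)
  let ?d = "\<lambda>i x. S (r (Suc i)) x - S (r i) x"
  have d1: "integrable N (\<lambda>x. \<bar>?d i x\<bar>)" and d2: "(\<integral>x. \<bar>?d i x\<bar> \<partial>N) \<le> (1/2)^i" for i
  proof -
    show i1: "integrable N (\<lambda>x. \<bar>?d i x\<bar>)"
    proof (rule Bochner_Integration.integrable_bound)
      show "integrable N (\<lambda>x. 1 + (?d i x)\<^sup>2)" using sq by auto
      have "\<bar>a\<bar> \<le> 1 + a\<^sup>2" for a :: real
        using sum_squares_bound[of 1 "\<bar>a\<bar>"] by simp
      then show "AE x in N. norm \<bar>?d i x\<bar> \<le> norm (1 + (?d i x)\<^sup>2)" by (auto intro!: AE_I2)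
    qed simp
    have "(\<integral>x. \<bar>?d i x\<bar> \<partial>N)\<^sup>2 \<le> (\<integral>x. \<bar>?d i x\<bar>\<^sup>2 \<partial>N)"
    proof -
      let ?m = "\<integral>x. \<bar>?d i x\<bar> \<partial>N"
      have "0 \<le> (\<integral>x. (\<bar>?d i x\<bar> - ?m)\<^sup>2 \<partial>N)" by simp
      also have "\<dots> = (\<integral>x. (?d i x)\<^sup>2 - 2 * ?m * \<bar>?d i x\<bar> + ?m\<^sup>2 \<partial>N)"
        by (simp add: power2_diff algebra_simps)
      also have "\<dots> = (\<integral>x. (?d i x)\<^sup>2 \<partial>N) - 2 * ?m * ?m + ?m\<^sup>2"
        using sq i1 by (simp add: prob_space)
      finally show ?thesis by (simp add: power2_eq_square)
    qed
    also have "\<dots> \<le> ((1/2)^i)\<^sup>2" using dl[of i]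
      by (simp add: power_mult_distrib flip: power_mult) (simp add: power_mult mult.commute power2_eq_square flip: power_mult_distrib)
    finally show "(\<integral>x. \<bar>?d i x\<bar> \<partial>N) \<le> (1/2)^i"
      by (rule power2_le_imp_le) simp
  qed
  have "(\<integral>\<^sup>+x. (\<Sum>i. ennreal \<bar>?d i x\<bar>) \<partial>N) = (\<Sum>i. (\<integral>\<^sup>+x. ennreal \<bar>?d i x\<bar> \<partial>N))"
    by (rule nn_integral_suminf) simp
  also have "\<dots> = (\<Sum>i. ennreal (\<integral>x. \<bar>?d i x\<bar> \<partial>N))"
    using d1 by (subst nn_integral_eq_integral) auto
  also have "\<dots> \<le> (\<Sum>i. ennreal ((1/2)^i))"
    by (intro suminf_le ennreal_leI d2) auto
  also have "\<dots> = ennreal (\<Sum>i. (1/2)^i)"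
    by (rule suminf_ennreal2) (auto intro: summable_geometric)
  also have "\<dots> < \<infinity>" by simp
  finally have "AE x in N. (\<Sum>i. ennreal \<bar>?d i x\<bar>) \<noteq> \<infinity>"
    by (intro nn_integral_PInf_AE) auto
  then have conv: "AE x in N. convergent (\<lambda>i. S (r i) x)"
  proof (rule AE_mp, intro AE_I2 impI)
    fix x assume "(\<Sum>i. ennreal \<bar>?d i x\<bar>) \<noteq> \<infinity>"
    then have "summable (\<lambda>i. \<bar>?d i x\<bar>)"
      by (intro summable_suminf_not_top) (auto simp: infinity_ennreal_def)
    then have "summable (\<lambda>i. ?d i x)" by (rule summable_rabs_cancel)
    then have "convergent (\<lambda>n. \<Sum>i<n. ?d i x)" by (simp add: summable_iff_convergent)
    then have "convergent (\<lambda>n. S (r n) x - S (r 0) x)" by (subst (asm) sum_lessThan_telescope)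
    then show "convergent (\<lambda>i. S (r i) x)"
      using convergent_diff_const_right_iff by blast
  qed
  define u where "u x = lim (\<lambda>i. S (r i) x)" for x
  have [measurable]: "u \<in> borel_measurable N" unfolding u_def by measurable
  have lim: "AE x in N. (\<lambda>i. S (r i) x) \<longlonglongrightarrow> u x"
    using conv by eventually_elim (auto simp: u_def convergent_LIMSEQ_iff)
  have fat: "(\<integral>\<^sup>+x. ennreal ((u x - S n x)\<^sup>2) \<partial>N) \<le> ennreal e"
    if "e > 0" and n1: "\<forall>m\<ge>n1. \<forall>n\<ge>n1. (\<integral>x. (S n x - S m x)\<^sup>2 \<partial>N) \<le> e" and "n \<ge> n1" for e n n1
  proof -
    have "(\<integral>\<^sup>+x. ennreal ((u x - S n x)\<^sup>2) \<partial>N) = (\<integral>\<^sup>+x. liminf (\<lambda>i. ennreal ((S (r i) x - S n x)\<^sup>2)) \<partial>N)"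
    proof (rule nn_integral_cong_AE)
      show "AE x in N. ennreal ((u x - S n x)\<^sup>2) = liminf (\<lambda>i. ennreal ((S (r i) x - S n x)\<^sup>2))"
        using lim
      proof eventually_elim
        case (elim x)
        have "(\<lambda>i. ennreal ((S (r i) x - S n x)\<^sup>2)) \<longlonglongrightarrow> ennreal ((u x - S n x)\<^sup>2)"
          by (intro tendsto_ennrealI tendsto_intros elim)
        from lim_imp_Liminf[OF _ this] show ?case by simp
      qed
    qed
    also have "\<dots> \<le> liminf (\<lambda>i. \<integral>\<^sup>+x. ennreal ((S (r i) x - S n x)\<^sup>2) \<partial>N)"
      by (rule nn_integral_liminf) simp
    also have "\<dots> \<le> ennreal e"
    proof -
      have "(\<integral>\<^sup>+x. ennreal ((S (r i) x - S n x)\<^sup>2) \<partial>N) \<le> ennreal e" if "i \<ge> n1" for i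
      proof -
        have "r i \<ge> n1" using r2[of i] that by linarith
        then have "(\<integral>x. (S (r i) x - S n x)\<^sup>2 \<partial>N) \<le> e" using n1 \<open>n \<ge> n1\<close> by auto
        then show ?thesis using sq by (subst nn_integral_eq_integral) (auto intro!: ennreal_leI)
      qed
      then have "eventually (\<lambda>i. (\<integral>\<^sup>+x. ennreal ((S (r i) x - S n x)\<^sup>2) \<partial>N) \<le> ennreal e) sequentially"
        by (auto simp: eventually_sequentially)
      then have "liminf (\<lambda>i. \<integral>\<^sup>+x. ennreal ((S (r i) x - S n x)\<^sup>2) \<partial>N) \<le> liminf (\<lambda>i. ennreal e)"
        by (rule Liminf_mono)
      then show ?thesis by (simp add: Liminf_const)
    qed
    finally show ?thesis .
  qed
  have fati: "integrable N (\<lambda>x. (u x - S n x)\<^sup>2) \<and> (\<integral>x. (u x - S n x)\<^sup>2 \<partial>N) \<le> e"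
    if "e > 0" and n1: "\<forall>m\<ge>n1. \<forall>n\<ge>n1. (\<integral>x. (S n x - S m x)\<^sup>2 \<partial>N) \<le> e" and "n \<ge> n1" for e n n1
  proof -
    note f = fat[OF that]
    have i: "integrable N (\<lambda>x. (u x - S n x)\<^sup>2)"
      by (rule integrableI_nonneg) (use f in \<open>auto simp: le_less_trans\<close>)
    with f show ?thesis using \<open>e > 0\<close> by (subst (asm) nn_integral_eq_integral) auto
  qed
  have "(\<lambda>n. \<integral>x. (u x - S n x)\<^sup>2 \<partial>N) \<longlonglongrightarrow> 0"
  proof (rule LIMSEQ_I)
    fix e :: real assume e: "e > 0"
    obtain n1 where "\<forall>m\<ge>n1. \<forall>n\<ge>n1. (\<integral>x. (S n x - S m x)\<^sup>2 \<partial>N) \<le> e/2"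
      using C[of "e/2"] e by auto
    from fati[OF _ this] have "norm ((\<integral>x. (u x - S n x)\<^sup>2 \<partial>N) - 0) < e" if "n \<ge> n1" for n
      using that e by (fastforce simp: field_simps)
    then show "\<exists>no. \<forall>n\<ge>no. norm ((\<integral>x. (u x - S n x)\<^sup>2 \<partial>N) - 0) < e" by blast
  qed
  moreover have "integrable N (\<lambda>x. (u x)\<^sup>2)"
  proof -
    obtain n1 where "\<forall>m\<ge>n1. \<forall>n\<ge>n1. (\<integral>x. (S n x - S m x)\<^sup>2 \<partial>N) \<le> 1"
      using C[of 1] by auto
    from fati[OF _ this, of n1] have "integrable N (\<lambda>x. (u x - S n1 x)\<^sup>2)" by simp
    then have "integrable N (\<lambda>x. 2 * (u x - S n1 x)\<^sup>2 + 2 * (S n1 x)\<^sup>2)" using S[of n1] by (auto simp: square_integrable_def)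
    then show ?thesis
    proof (rule Bochner_Integration.integrable_bound)
      have "a\<^sup>2 \<le> 2 * (a - b)\<^sup>2 + 2 * b\<^sup>2" for a b :: real
        using zero_le_power2[of "a - 2 * b"] by (simp add: power2_eq_square algebra_simps)
      then show "AE x in N. norm ((u x)\<^sup>2) \<le> norm (2 * (u x - S n1 x)\<^sup>2 + 2 * (S n1 x)\<^sup>2)"
        by (auto intro!: AE_I2)
    qed simp
  qed
  ultimately show thesis by (intro that[of u]) (auto simp: square_integrable_def)
qed

section \<open>Density of the polynomials under exponential moments\<close>

locale light_tailed = real_distribution N for N :: "real measure" +
  fixes t0 :: real
  assumes t0_pos: "0 < t0"
    and exp_integrable: "\<And>t. \<bar>t\<bar> < t0 \<Longrightarrow> integrable N (\<lambda>x. exp (t * x))"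
begin

text \<open>A single term of the exponential series bounds
  \<open>(e * \<bar>x\<bar>) ^ n / fact n\<close> by \<open>exp (e * \<bar>x\<bar>)\<close>, so a
  power costs only a small increase of the rate. Taking \<open>e\<close> as half the gap keeps
  \<open>c + e\<close> below \<open>t0\<close>.\<close>

lemma integrable_power_exp:
  assumes "0 \<le> c" "c < t0"
  shows "integrable N (\<lambda>x. \<bar>x\<bar> ^ n * exp (c * \<bar>x\<bar>))"
proof (rule Bochner_Integration.integrable_bound)
  define e where "e = (t0 - c) / 2"
  have e: "e > 0" "c + e < t0" "c + e > 0" using assms by (auto simp: e_def field_simps)
  show "integrable N (\<lambda>x. fact n / e ^ n * (exp ((c + e) * x) + exp (- (c + e) * x)))"
    using exp_integrable[of "c + e"] exp_integrable[of "- (c + e)"] e by auto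
  have "\<bar>x\<bar> ^ n * exp (c * \<bar>x\<bar>) \<le> fact n / e ^ n * (exp ((c + e) * x) + exp (- (c + e) * x))" for x
  proof -
    have "(e * \<bar>x\<bar>) ^ n /\<^sub>R fact n \<le> exp (e * \<bar>x\<bar>)"
      unfolding exp_def
      using sum_le_suminf[OF summable_exp_generic[of "e * \<bar>x\<bar>"], of "{n}"] e by auto
    then have "\<bar>x\<bar> ^ n \<le> fact n / e ^ n * exp (e * \<bar>x\<bar>)"
      using e by (simp add: power_mult_distrib field_simps)
    then have "\<bar>x\<bar> ^ n * exp (c * \<bar>x\<bar>) \<le> fact n / e ^ n * exp (e * \<bar>x\<bar>) * exp (c * \<bar>x\<bar>)"
      by (rule mult_right_mono) simp
    also have "\<dots> = fact n / e ^ n * exp ((c + e) * \<bar>x\<bar>)"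
      by (simp add: algebra_simps flip: exp_add)
    also have "exp ((c + e) * \<bar>x\<bar>) \<le> exp ((c + e) * x) + exp (- (c + e) * x)"
      by (cases "x \<ge> 0") (auto simp: algebra_simps)
    finally show ?thesis using e by (simp add: mult_left_mono divide_right_mono)
  qed
  then show "AE x in N. norm (\<bar>x\<bar> ^ n * exp (c * \<bar>x\<bar>))
      \<le> norm (fact n / e ^ n * (exp ((c + e) * x) + exp (- (c + e) * x)))"
    using e by (intro AE_I2) (auto simp: abs_of_pos)
qed simp

lemma square_integrable_power_exp:
  assumes "0 \<le> c" "c < t0 / 2"
  shows "square_integrable N (\<lambda>x. \<bar>x\<bar> ^ n * exp (c * \<bar>x\<bar>))"
  using integrable_power_exp[of "2 * c" "2 * n"] assms
  by (simp add: square_integrable_def power_mult_distrib exp_double mult.assoc flip: power_mult)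
     (simp add: mult.commute)

lemma square_integrable_poly: "square_integrable N (poly p)"
proof -
  have "square_integrable N (\<lambda>x. x ^ n)" for n
    using integrable_power_exp[of 0 "2 * n"] t0_pos
    by (simp add: square_integrable_def mult.commute power_even_abs flip: power_mult)
  then show ?thesis unfolding poly_altdef
    by (intro square_integrable_sum square_integrable_cmult)
qed

text \<open>The set of frequencies \<open>t\<close> at which all functions \<open>x\<^sup>n e\<^sup>i\<^sup>t\<^sup>x g\<close> have mean zero contains \<open>0\<close>
  and, by expanding \<open>e\<^sup>i\<^sup>u\<^sup>x\<close> for \<open>\<bar>u\<bar> \<le> t0 / 4\<close>, is closed under steps of length at most \<open>t0 / 4\<close>.\<close>

lemma fourier_zero_step:
  assumes g: "square_integrable N g" and u: "\<bar>u\<bar> \<le> t0 / 4"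
    and zero: "\<And>n. (CLINT x|N. of_real (g x * x ^ n) * iexp (t * x)) = 0"
  shows "(CLINT x|N. of_real (g x * x ^ n) * iexp ((t + u) * x)) = 0"
proof -
  have [measurable]: "g \<in> borel_measurable borel"
    using g by (simp add: square_integrable_def cong: measurable_cong_sets)
  define s :: "nat \<Rightarrow> real \<Rightarrow> complex" where
    "s k x = (\<Sum>m<k. (\<i> * u) ^ m /\<^sub>R fact m * (of_real (g x * x ^ (n + m)) * iexp (t * x)))" for k x
  define w where "w x = \<bar>g x\<bar> * (\<bar>x\<bar> ^ n * exp (\<bar>u\<bar> * \<bar>x\<bar>))" for x
  have s_eq: "s k x = of_real (g x * x ^ n) * iexp (t * x) * (\<Sum>m<k. (\<i> * (u * x)) ^ m /\<^sub>R fact m)" for k x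
    by (simp add: s_def sum_distrib_left power_mult_distrib power_add scaleR_conv_of_real mult_ac)
  have int: "integrable N (\<lambda>x. of_real (g x * x ^ m) * iexp (t * x))" for m
  proof (rule Bochner_Integration.integrable_bound)
    show "integrable N (\<lambda>x. g x * poly (monom 1 m) x)"
      by (rule square_integrable_mult[OF g square_integrable_poly])
    show "AE x in N. norm (of_real (g x * x ^ m) * iexp (t * x)) \<le> norm (g x * poly (monom 1 m) x)"
      by (simp add: norm_mult poly_monom norm_power abs_mult power_abs)
  qed simp
  \<comment> \<open>\<open>g\<close> has only a second moment, so the exponential factor must be
    square integrable as well. Its rate must stay below \<open>t0 / 2\<close>, which
    \<open>\<bar>u\<bar> \<le> t0 / 4\<close> ensures.\<close>
  have wi: "integrable N w" unfolding w_def
    using square_integrable_mult[OF _ square_integrable_power_exp[of "\<bar>u\<bar>" n], of "\<lambda>x. \<bar>g x\<bar>"] g u t0_pos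
    by (simp add: square_integrable_def)
  have "(\<lambda>k. CLINT x|N. s k x) \<longlonglongrightarrow> (CLINT x|N. of_real (g x * x ^ n) * iexp ((t + u) * x))"
  proof (rule integral_dominated_convergence[where w = w])
    show "AE x in N. (\<lambda>k. s k x) \<longlonglongrightarrow> of_real (g x * x ^ n) * iexp ((t + u) * x)"
    proof (rule AE_I2)
      fix x
      have "(\<lambda>k. \<Sum>m<k. (\<i> * (u * x)) ^ m /\<^sub>R fact m) \<longlonglongrightarrow> iexp (u * x)"
        using summable_LIMSEQ[OF summable_exp_generic, of "\<i> * (u * x)"] by (simp add: exp_def)
      then have "(\<lambda>k. s k x) \<longlonglongrightarrow> of_real (g x * x ^ n) * iexp (t * x) * iexp (u * x)"
        unfolding s_eq by (rule tendsto_mult_left)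
      then show "(\<lambda>k. s k x) \<longlonglongrightarrow> of_real (g x * x ^ n) * iexp ((t + u) * x)"
        by (simp add: algebra_simps flip: exp_add)
    qed
    fix k
    show "AE x in N. norm (s k x) \<le> w x"
    proof (rule AE_I2)
      fix x
      have "norm (\<Sum>m<k. (\<i> * (u * x)) ^ m /\<^sub>R fact m) \<le> (\<Sum>m<k. (\<bar>u\<bar> * \<bar>x\<bar>) ^ m /\<^sub>R fact m)"
        by (rule order_trans[OF norm_sum]) (simp add: norm_mult norm_power abs_mult)
      also have "\<dots> \<le> exp (\<bar>u\<bar> * \<bar>x\<bar>)" unfolding exp_def
        by (rule sum_le_suminf[OF summable_exp_generic]) auto
      finally show "norm (s k x) \<le> w x" unfolding s_eq w_def
        by (simp add: norm_mult norm_power abs_mult mult.assoc mult_left_mono)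
    qed
  qed (auto simp: wi s_def)
  moreover have "(CLINT x|N. s k x) = 0" for k
    unfolding s_def using int zero by (subst Bochner_Integration.integral_sum) auto
  ultimately show ?thesis by (simp add: LIMSEQ_const_iff)
qed

lemma fourier_zero:
  assumes g: "square_integrable N g" and zero: "\<And>n. (\<integral>x. g x * x ^ n \<partial>N) = 0"
  shows "(CLINT x|N. of_real (g x) * iexp (t * x)) = 0"
proof -
  \<comment> \<open>The segment from 0 to \<open>t\<close> is cut into \<open>k\<close> steps of
    length at most \<open>t0 / 4\<close>.\<close>
  obtain k :: nat where k: "\<bar>t\<bar> / (t0 / 4) < k" using reals_Archimedean2 by blast
  define u where "u = t / k"
  have k0: "k > 0" using order_le_less_trans[OF _ k, of 0] t0_pos by simp
  have u: "\<bar>u\<bar> \<le> t0 / 4" using k k0 t0_pos by (simp add: u_def abs_divide field_simps)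
  \<comment> \<open>All \<open>n\<close> are carried along, because one step expands into terms with
    every higher power of \<open>x\<close>.\<close>
  have "(CLINT x|N. of_real (g x * x ^ n) * iexp ((j * u) * x)) = 0" for n and j :: nat
  proof (induction j arbitrary: n)
    case 0
    show ?case using zero[of n] integral_complex_of_real[of N "\<lambda>x. g x * x ^ n"] by simp
  next
    case (Suc j)
    show ?case using fourier_zero_step[OF g u Suc, of n] by (simp add: algebra_simps)
  qed
  from this[of 0 k] k0 show ?thesis by (simp add: u_def)
qed

text \<open>The positive and negative parts of \<open>g\<close> have the same mass \<open>c\<close>,
  because \<open>g\<close> has mean zero. If \<open>c\<close> is nonzero, dividing by it turns them
  into densities of two probability laws with equal characteristic functions, and Levy's uniqueness
  theorem identifies them.\<close>

lemma AE_zero_if_orthogonal_powers: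
  assumes g: "square_integrable N g" and zero: "\<And>n. (\<integral>x. g x * x ^ n \<partial>N) = 0"
  shows "AE x in N. g x = 0"
proof -
  have [measurable]: "g \<in> borel_measurable borel"
    using g by (simp add: square_integrable_def cong: measurable_cong_sets)
  have gi: "integrable N g" using square_integrable_mult[OF g square_integrable_poly[of 1]] by simp
  define p m where "p x = max 0 (g x)" and "m x = max 0 (- g x)" for x
  have [measurable]: "p \<in> borel_measurable borel" "m \<in> borel_measurable borel"
    unfolding p_def m_def by measurable
  have pm: "integrable N p" "integrable N m" unfolding p_def m_def using gi by auto
  have nn: "p x \<ge> 0" "m x \<ge> 0" "g x = p x - m x" for x by (auto simp: p_def m_def)
  define c where "c = (\<integral>x. p x \<partial>N)"
  have c: "(\<integral>x. m x \<partial>N) = c" using zero[of 0] pm by (simp add: nn(3) c_def)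
  have c0: "c \<ge> 0" unfolding c_def using nn by simp
  show ?thesis
  proof (cases "c = 0")
    case True
    have "AE x in N. p x = 0" "AE x in N. m x = 0"
      using pm nn True c by (auto simp flip: integral_nonneg_eq_0_iff_AE simp: c_def)
    then show ?thesis by eventually_elim (simp add: nn)
  next
    case False
    have rd: "real_distribution (density N (\<lambda>x. ennreal (h x / c)))"
      if h: "integrable N h" "\<And>x. h x \<ge> 0" "(\<integral>x. h x \<partial>N) = c" for h
    proof -
      have "h \<in> borel_measurable N" using h(1) by simp
      then have "emeasure (density N (\<lambda>x. ennreal (h x / c))) (space N) = (\<integral>\<^sup>+x. ennreal (h x / c) \<partial>N)"
        by (subst emeasure_density) (auto intro!: nn_integral_cong)
      also have "\<dots> = ennreal (\<integral>x. h x / c \<partial>N)"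
        by (rule nn_integral_eq_integral) (use h c0 in auto)
      also have "\<dots> = 1" using h False by simp
      finally have "prob_space (density N (\<lambda>x. ennreal (h x / c)))" by (intro prob_spaceI) simp
      then show ?thesis by (simp add: real_distribution_def real_distribution_axioms_def)
    qed
    have ch: "char (density N (\<lambda>x. ennreal (h x / c))) t = (CLINT x|N. of_real (h x) * iexp (t * x)) / c"
      if h: "integrable N h" "\<And>x. h x \<ge> 0" for h t
    proof -
      have [measurable]: "h \<in> borel_measurable borel" using h(1) by simp
      have "char (density N (\<lambda>x. ennreal (h x / c))) t = (CLINT x|N. (h x / c) *\<^sub>R iexp (t * x))"
        unfolding char_def by (rule integral_density) (use h c0 in auto)
      also have "\<dots> = (CLINT x|N. (of_real (h x) * iexp (t * x)) / c)"
        by (simp add: scaleR_conv_of_real)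
      finally show ?thesis by simp
    qed
    have ic: "integrable N (\<lambda>x. of_real (h x) * iexp (t * x))" if h: "integrable N h" for h t
    proof (rule Bochner_Integration.integrable_bound[OF h])
      have [measurable]: "h \<in> borel_measurable borel" using h(1) by simp
      show "(\<lambda>x. of_real (h x) * iexp (t * x)) \<in> borel_measurable N" by measurable
    qed (simp add: norm_mult)
    have "(CLINT x|N. of_real (p x) * iexp (t * x)) = (CLINT x|N. of_real (m x) * iexp (t * x))" for t
      using fourier_zero[OF g zero, of t] ic[OF pm(1), of t] ic[OF pm(2), of t]
      by (simp add: nn(3) algebra_simps)
    then have "char (density N (\<lambda>x. ennreal (p x / c))) = char (density N (\<lambda>x. ennreal (m x / c)))"
      using pm nn by (auto simp: ch)
    then have "density N (\<lambda>x. ennreal (p x / c)) = density N (\<lambda>x. ennreal (m x / c))"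
      using pm nn c by (intro Levy_uniqueness rd) (auto simp: c_def)
    then have "AE x in N. ennreal (p x / c) = ennreal (m x / c)"
      by (subst (asm) density_unique_iff) auto
    then show ?thesis
      by eventually_elim (use c0 False in \<open>auto simp: nn divide_simps split: if_splits\<close>)
  qed
qed

end

section \<open>Mean-square expansion in a complete orthogonal system of polynomials\<close>

locale orthogonal_polys = light_tailed +
  fixes P :: "nat \<Rightarrow> real poly"
  assumes orthogonal: "\<And>i j. i \<noteq> j \<Longrightarrow> (\<integral>x. poly (P i) x * poly (P j) x \<partial>N) = 0"
    and spanning: "\<And>m. \<exists>T. degree T = m \<and> T \<noteq> 0 \<and> (T = P m \<or> (AE x in N. poly T x = 0))"
begin

text \<open>Induction on the power: a polynomial \<open>T\<close> of degree \<open>n\<close> that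
  pairs to zero with \<open>R\<close> expresses the integral of \<open>R x * x ^ n\<close> through
  lower powers. \<open>spanning\<close> supplies such a \<open>T\<close> even where
  \<open>P n\<close> has dropped in degree.\<close>

lemma AE_zero_if_orthogonal:
  assumes R: "square_integrable N R" and zero: "\<And>k. (\<integral>x. R x * poly (P k) x \<partial>N) = 0"
  shows "AE x in N. R x = 0"
proof (rule AE_zero_if_orthogonal_powers[OF R])
  fix n
  have i: "integrable N (\<lambda>x. R x * x ^ k)" for k
    using square_integrable_mult[OF R square_integrable_poly[of "monom 1 k"]] by (simp add: poly_monom)
  show "(\<integral>x. R x * x ^ n \<partial>N) = 0"
  proof (induction n rule: less_induct)
    case (less n)
    obtain T where T: "degree T = n" "T \<noteq> 0" "T = P n \<or> (AE x in N. poly T x = 0)"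
      using spanning by blast
    have "0 = (\<integral>x. R x * poly T x \<partial>N)"
      using T(3)
    proof
      assume "AE x in N. poly T x = 0"
      then have "(\<integral>x. R x * poly T x \<partial>N) = (\<integral>x. 0 \<partial>N)"
        using R square_integrable_poly[of T]
        by (intro integral_cong_AE) (auto simp: square_integrable_def)
      then show ?thesis by simp
    qed (use zero in simp)
    also have "\<dots> = (\<integral>x. (\<Sum>i\<le>n. coeff T i * (R x * x ^ i)) \<partial>N)"
      by (simp add: poly_altdef T(1) sum_distrib_left mult_ac)
    also have "\<dots> = (\<Sum>i\<le>n. coeff T i * (\<integral>x. R x * x ^ i \<partial>N))"
      using i by (subst Bochner_Integration.integral_sum) auto
    also have "\<dots> = coeff T n * (\<integral>x. R x * x ^ n \<partial>N)"
      using less by (simp flip: lessThan_Suc_atMost)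
    finally show ?case using T by (metis leading_coeff_0_iff mult_eq_0_iff)
  qed
qed

text \<open>Bessel's inequality makes the partial sums \<open>S n\<close> Cauchy in mean square.
  Their limit \<open>u\<close> has the same coefficients as \<open>g\<close>, so
  \<open>g - u\<close> is orthogonal to every \<open>P k\<close> and vanishes almost
  everywhere.\<close>

lemma Parseval:
  assumes g: "square_integrable N g"
  shows "(\<lambda>k. (\<integral>x. g x * poly (P k) x \<partial>N)\<^sup>2 / (\<integral>x. (poly (P k) x)\<^sup>2 \<partial>N)) sums (\<integral>x. (g x)\<^sup>2 \<partial>N)"
proof -
  define e where "e k = (\<integral>x. (poly (P k) x)\<^sup>2 \<partial>N)" for k
  define b where "b k = (\<integral>x. g x * poly (P k) x \<partial>N)" for k
  define a where "a k = b k / e k" for k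
  define S where "S n x = (\<Sum>k<n. a k * poly (P k) x)" for n x
  have e0: "e k \<ge> 0" for k by (simp add: e_def)
  note sqp = square_integrable_poly
  have sqS: "square_integrable N (S n)" for n
    unfolding S_def by (intro square_integrable_sum square_integrable_cmult sqp)
  \<comment> \<open>If \<open>P k\<close> is null, then \<open>a k = 0\<close> because division by
    zero yields 0, and Cauchy-Schwarz gives \<open>b k = 0\<close>. Null members therefore cause no
    exceptions below.\<close>
  have ae: "a k * e k = b k" for k
  proof (cases "e k = 0")
    case True
    have "(b k)\<^sup>2 \<le> 0"
      using square_integrable_Cauchy_Schwarz[OF g sqp, of "P k"] True by (simp add: e_def b_def)
    with True show ?thesis by simp
  qed (simp add: a_def)
  have inner_g: "(\<integral>x. g x * (\<Sum>k\<in>A. c k * poly (P k) x) \<partial>N) = (\<Sum>k\<in>A. c k * b k)" for A c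
  proof -
    have "(\<integral>x. g x * (\<Sum>k\<in>A. c k * poly (P k) x) \<partial>N) = (\<integral>x. (\<Sum>k\<in>A. c k * (g x * poly (P k) x)) \<partial>N)"
      by (simp add: sum_distrib_left mult_ac)
    also have "\<dots> = (\<Sum>k\<in>A. c k * b k)"
      using square_integrable_mult[OF g sqp] by (subst Bochner_Integration.integral_sum) (auto simp: b_def)
    finally show ?thesis .
  qed
  have inner_P: "(\<integral>x. poly (P m) x * (\<Sum>k\<in>A. c k * poly (P k) x) \<partial>N) = (if m \<in> A then c m * e m else 0)"
    if "finite A" for A c m
  proof -
    have "(\<integral>x. poly (P m) x * (\<Sum>k\<in>A. c k * poly (P k) x) \<partial>N)
        = (\<integral>x. (\<Sum>k\<in>A. c k * (poly (P m) x * poly (P k) x)) \<partial>N)"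
      by (simp add: sum_distrib_left mult_ac)
    also have "\<dots> = (\<Sum>k\<in>A. c k * (\<integral>x. poly (P m) x * poly (P k) x \<partial>N))"
      using square_integrable_mult[OF sqp sqp] by (subst Bochner_Integration.integral_sum) auto
    also have "\<dots> = (\<Sum>k\<in>A. if k = m then c m * e m else 0)"
      by (rule sum.cong) (auto simp: orthogonal e_def power2_eq_square)
    finally show ?thesis using that by simp
  qed
  have norm_sum: "(\<integral>x. (\<Sum>k\<in>A. a k * poly (P k) x)\<^sup>2 \<partial>N) = (\<Sum>k\<in>A. (a k)\<^sup>2 * e k)" if "finite A" for A
  proof -
    have "(\<integral>x. (\<Sum>k\<in>A. a k * poly (P k) x)\<^sup>2 \<partial>N)
        = (\<integral>x. (\<Sum>m\<in>A. a m * (poly (P m) x * (\<Sum>k\<in>A. a k * poly (P k) x))) \<partial>N)"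
      by (simp add: power2_eq_square sum_distrib_right mult_ac)
    also have "\<dots> = (\<Sum>m\<in>A. a m * (\<integral>x. poly (P m) x * (\<Sum>k\<in>A. a k * poly (P k) x) \<partial>N))"
      by (subst Bochner_Integration.integral_sum)
         (auto intro!: integrable_mult_right square_integrable_mult sqp square_integrable_sum square_integrable_cmult)
    also have "\<dots> = (\<Sum>k\<in>A. (a k)\<^sup>2 * e k)"
      using that by (intro sum.cong) (auto simp: inner_P power2_eq_square)
    finally show ?thesis .
  qed
  have ig: "integrable N (\<lambda>x. (g x)\<^sup>2)" using g by (simp add: square_integrable_def)
  have resid: "(\<integral>x. (g x - S n x)\<^sup>2 \<partial>N) = (\<integral>x. (g x)\<^sup>2 \<partial>N) - (\<Sum>k<n. (a k)\<^sup>2 * e k)" for n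
  proof -
    have "(\<integral>x. (g x - S n x)\<^sup>2 \<partial>N) = (\<integral>x. (g x)\<^sup>2 - 2 * (g x * S n x) + (S n x)\<^sup>2 \<partial>N)"
      by (simp add: power2_diff algebra_simps)
    also have "\<dots> = (\<integral>x. (g x)\<^sup>2 \<partial>N) - 2 * (\<integral>x. g x * S n x \<partial>N) + (\<integral>x. (S n x)\<^sup>2 \<partial>N)"
      using ig square_integrable_mult[OF g sqS[of n]] sqS[of n] by (simp add: square_integrable_def)
    also have "(\<integral>x. g x * S n x \<partial>N) = (\<Sum>k<n. (a k)\<^sup>2 * e k)"
      unfolding S_def inner_g by (simp add: power2_eq_square mult.assoc flip: ae)
    also have "(\<integral>x. (S n x)\<^sup>2 \<partial>N) = (\<Sum>k<n. (a k)\<^sup>2 * e k)"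
      unfolding S_def by (rule norm_sum) simp
    finally show ?thesis by simp
  qed
  have summ: "summable (\<lambda>k. (a k)\<^sup>2 * e k)"
  proof (rule bounded_imp_summable)
    fix n
    have "0 \<le> (\<integral>x. (g x - S (Suc n) x)\<^sup>2 \<partial>N)" by simp
    then show "(\<Sum>k\<le>n. (a k)\<^sup>2 * e k) \<le> (\<integral>x. (g x)\<^sup>2 \<partial>N)"
      unfolding resid lessThan_Suc_atMost by simp
  qed (use e0 in simp)
  have diff: "(\<integral>x. (S n x - S m x)\<^sup>2 \<partial>N) = (\<Sum>k\<in>{m..<n}. (a k)\<^sup>2 * e k)" if "m \<le> n" for m n
  proof -
    have "S n x - S m x = (\<Sum>k\<in>{m..<n}. a k * poly (P k) x)" for x
      unfolding S_def using that
      by (simp add: sum_diff_nat_ivl flip: atLeast0LessThan)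
    then show ?thesis by (simp add: norm_sum)
  qed
  have "\<exists>n0. \<forall>m\<ge>n0. \<forall>n\<ge>n0. (\<integral>x. (S n x - S m x)\<^sup>2 \<partial>N) \<le> r" if r: "r > 0" for r
  proof -
    obtain n0 where n0: "\<And>m n. m \<ge> n0 \<Longrightarrow> norm (\<Sum>k\<in>{m..<n}. (a k)\<^sup>2 * e k) < r"
      using summ r unfolding summable_Cauchy by blast
    have "(\<integral>x. (S n x - S m x)\<^sup>2 \<partial>N) \<le> r" if "m \<ge> n0" "n \<ge> n0" for m n
    proof (cases "m \<le> n")
      case True
      then show ?thesis using diff[of m n] n0[of m n] that by auto
    next
      case False
      then show ?thesis using diff[of n m] n0[of n m] that by (auto simp: power2_commute)
    qed
    then show ?thesis by blast
  qed
  from square_integrable_Cauchy_convergent[OF prob_space_axioms sqS this]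
  obtain u where u: "square_integrable N u" "(\<lambda>n. \<integral>x. (u x - S n x)\<^sup>2 \<partial>N) \<longlonglongrightarrow> 0" by blast
  have sqR: "square_integrable N (\<lambda>x. g x - u x)"
    by (rule square_integrable_diff[OF g u(1)])
  have R0: "AE x in N. g x - u x = 0"
  proof (rule AE_zero_if_orthogonal[OF sqR])
    fix m
    let ?I = "\<integral>x. (g x - u x) * poly (P m) x \<partial>N"
    \<comment> \<open>For \<open>n > m\<close> both \<open>g\<close> and \<open>S n\<close> have
      pairing \<open>b m\<close> with \<open>P m\<close>, so \<open>?I\<close> sees only
      \<open>S n - u\<close>, which tends to 0 in mean square.\<close>
    have "(?I)\<^sup>2 \<le> (\<integral>x. (u x - S n x)\<^sup>2 \<partial>N) * e m" if "n > m" for n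
    proof -
      have "(\<integral>x. g x * poly (P m) x - S n x * poly (P m) x \<partial>N) = b m - (\<integral>x. poly (P m) x * S n x \<partial>N)"
        using square_integrable_mult[OF g sqp, of "P m"] square_integrable_mult[OF sqS[of n] sqp, of "P m"]
        by (simp add: b_def mult.commute)
      also have "(\<integral>x. poly (P m) x * S n x \<partial>N) = b m"
        unfolding S_def using that by (simp add: inner_P ae)
      finally have "?I = - (\<integral>x. (u x - S n x) * poly (P m) x \<partial>N)"
        using square_integrable_mult[OF g sqp, of "P m"] square_integrable_mult[OF sqS[of n] sqp, of "P m"]
          square_integrable_mult[OF u(1) sqp, of "P m"]
        by (simp add: algebra_simps)
      then show ?thesis
        using square_integrable_Cauchy_Schwarz[OF square_integrable_diff[OF u(1) sqS[of n]] sqp[of "P m"]]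
        by (simp add: e_def)
    qed
    then have "(?I)\<^sup>2 \<le> 0 * e m"
      by (intro tendsto_lowerbound[OF tendsto_mult_right[OF u(2)]])
         (auto simp: eventually_at_top_dense)
    then show "?I = 0" by simp
  qed
  have "(\<integral>x. (g x - S n x)\<^sup>2 \<partial>N) = (\<integral>x. (u x - S n x)\<^sup>2 \<partial>N)" for n
    using R0 g sqS[of n] u(1) by (intro integral_cong_AE) (auto simp: square_integrable_def)
  with u(2) have "(\<lambda>n. (\<integral>x. (g x)\<^sup>2 \<partial>N) - (\<Sum>k<n. (a k)\<^sup>2 * e k)) \<longlonglongrightarrow> 0" by (simp add: resid)
  from tendsto_diff[OF tendsto_const[of "\<integral>x. (g x)\<^sup>2 \<partial>N"] this]
  have "(\<lambda>k. (a k)\<^sup>2 * e k) sums (\<integral>x. (g x)\<^sup>2 \<partial>N)" by (simp add: sums_def)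
  moreover have "(a k)\<^sup>2 * e k = (b k)\<^sup>2 / e k" for k
    by (simp add: a_def power2_eq_square)
  ultimately show ?thesis by (simp add: b_def e_def)
qed

text \<open>Polarization: a quarter of the difference of \<open>Parseval\<close> for
  \<open>g + h\<close> and for \<open>g - h\<close>.\<close>

lemma Parseval_inner:
  assumes g: "square_integrable N g" and h: "square_integrable N h"
  shows "(\<lambda>k. (\<integral>x. g x * poly (P k) x \<partial>N) * (\<integral>x. h x * poly (P k) x \<partial>N) / (\<integral>x. (poly (P k) x)\<^sup>2 \<partial>N))
    sums (\<integral>x. g x * h x \<partial>N)"
proof -
  have "(\<lambda>k. ((\<integral>x. (g x + h x) * poly (P k) x \<partial>N)\<^sup>2 / (\<integral>x. (poly (P k) x)\<^sup>2 \<partial>N)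
      - (\<integral>x. (g x - h x) * poly (P k) x \<partial>N)\<^sup>2 / (\<integral>x. (poly (P k) x)\<^sup>2 \<partial>N)) / 4)
    sums (((\<integral>x. (g x + h x)\<^sup>2 \<partial>N) - (\<integral>x. (g x - h x)\<^sup>2 \<partial>N)) / 4)"
    by (intro sums_divide sums_diff Parseval square_integrable_add square_integrable_diff g h)
  moreover have "((\<integral>x. (g x + h x)\<^sup>2 \<partial>N) - (\<integral>x. (g x - h x)\<^sup>2 \<partial>N)) / 4 = (\<integral>x. g x * h x \<partial>N)"
    using g h square_integrable_mult[OF g h]
    by (simp add: power2_sum power2_diff square_integrable_def mult.assoc)
  moreover have "((\<integral>x. (g x + h x) * poly (P k) x \<partial>N)\<^sup>2 / (\<integral>x. (poly (P k) x)\<^sup>2 \<partial>N)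
      - (\<integral>x. (g x - h x) * poly (P k) x \<partial>N)\<^sup>2 / (\<integral>x. (poly (P k) x)\<^sup>2 \<partial>N)) / 4
    = (\<integral>x. g x * poly (P k) x \<partial>N) * (\<integral>x. h x * poly (P k) x \<partial>N) / (\<integral>x. (poly (P k) x)\<^sup>2 \<partial>N)" for k
    using square_integrable_mult[OF g square_integrable_poly, of "P k"]
      square_integrable_mult[OF h square_integrable_poly, of "P k"]
    by (simp add: distrib_right left_diff_distrib power2_sum power2_diff flip: diff_divide_distrib)
  ultimately show ?thesis by simp
qed

end

section \<open>Rodrigues polynomials and the covariance series\<close>

text \<open>One set of axioms for both cases. \<open>D\<close> acts on polynomials only; general
  functions enter through \<open>adjoint\<close>. \<open>w_pos_or_finite\<close> replaces positivity
  of the weights: a discrete law with finite support can give \<open>w m\<close> mean zero, and then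
  some polynomial of degree \<open>m\<close> vanishes almost everywhere.\<close>

locale pearson_ladder = light_tailed +
  fixes \<delta> :: real and D :: "real poly \<Rightarrow> real poly" and B :: "nat \<Rightarrow> real poly \<Rightarrow> real poly"
    and w :: "nat \<Rightarrow> real \<Rightarrow> real"
  assumes D_const: "\<And>p. degree p = 0 \<Longrightarrow> D p = 0"
    and degree_D: "\<And>p n. degree p \<le> Suc n \<Longrightarrow> degree (D p) \<le> n"
    and coeff_D: "\<And>p n. degree p \<le> Suc n \<Longrightarrow> coeff (D p) n = real (Suc n) * coeff p (Suc n)"
    and degree_B: "\<And>p m k. degree p \<le> m \<Longrightarrow> degree (B k p) \<le> Suc m"
    and coeff_B: "\<And>p m k. degree p \<le> m \<Longrightarrow>
        coeff (B k p) (Suc m) = (1 - real (2 * k + m) * \<delta>) * coeff p m"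
    and w_0: "\<And>x. w 0 x = 1"
    and adjoint_poly: "\<And>p u j. (\<integral>x. poly (D p) x * poly u x * w (Suc j) x \<partial>N)
        = (\<integral>x. poly p x * poly (B j u) x * w j x \<partial>N)"
    and w_pos_or_finite: "\<And>m. (\<integral>x. w m x \<partial>N) \<noteq> 0 \<or>
        (\<exists>T. degree T = m \<and> T \<noteq> 0 \<and> (AE x in N. poly T x = 0))"
begin

text \<open>\<open>G j\<close> stands for the j-th derivative or difference of \<open>G 0\<close>. A
  sequence takes the place of an operator on functions because derivatives make sense on the support
  only.\<close>

definition adjoint :: "(nat \<Rightarrow> real \<Rightarrow> real) \<Rightarrow> bool" where
  "adjoint G \<longleftrightarrow> (\<forall>j u. (\<integral>x. G (Suc j) x * poly u x * w (Suc j) x \<partial>N)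
     = (\<integral>x. G j x * poly (B j u) x * w j x \<partial>N))"

text \<open>\<open>R k i\<close> is \<open>B (k - i)\<close> applied to ... applied to
  \<open>B (k - 1) 1\<close>: the highest weight is lowered first.\<close>

primrec R :: "nat \<Rightarrow> nat \<Rightarrow> real poly" where
  "R k 0 = 1"
| "R k (Suc i) = B (k - Suc i) (R k i)"

definition P :: "nat \<Rightarrow> real poly" where "P k = R k k"

lemma degree_R: "degree (R k i) \<le> i"
  by (induction i) (auto intro: degree_B)

text \<open>Passing from \<open>i\<close> to \<open>i + 1\<close> applies
  \<open>B (k - 1 - i)\<close> to a polynomial of degree at most \<open>i\<close>, so the factor has
  index \<open>2 * (k - 1 - i) + i = 2 * k - 2 - i\<close>. For \<open>i < k\<close> these indices
  run through \<open>k - 1..2 * k - 2\<close>, the range in the theorem.\<close>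

lemma coeff_R: "i \<le> k \<Longrightarrow> coeff (R k i) i = (\<Prod>n<i. 1 - real (2 * k - 2 - n) * \<delta>)"
proof (induction i)
  case (Suc i)
  have "2 * (k - Suc i) + i = 2 * k - 2 - i" using Suc.prems by simp
  then show ?case using Suc coeff_B[OF degree_R, of "k - Suc i" k i] by simp
qed simp

lemma coeff_P: "coeff (P k) k = (\<Prod>n<k. 1 - real (2 * k - 2 - n) * \<delta>)"
  unfolding P_def by (rule coeff_R) simp

lemma Rodrigues:
  assumes "adjoint G"
  shows "(\<integral>x. G k x * w k x \<partial>N) = (\<integral>x. G 0 x * poly (P k) x \<partial>N)"
proof -
  have "i \<le> k \<Longrightarrow> (\<integral>x. G k x * w k x \<partial>N) = (\<integral>x. G (k - i) x * poly (R k i) x * w (k - i) x \<partial>N)" for i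
  proof (induction i)
    case (Suc i)
    then have "k - i = Suc (k - Suc i)" by simp
    with Suc assms show ?case by (simp add: adjoint_def)
  qed simp
  from this[of k] show ?thesis by (simp add: P_def w_0)
qed

lemma adjoint_iterate_poly: "adjoint (\<lambda>j. poly ((D ^^ j) p))"
  using adjoint_poly by (simp add: adjoint_def)

lemma iterate_D:
  "degree p \<le> n + k \<Longrightarrow> degree ((D ^^ k) p) \<le> n \<and>
     coeff ((D ^^ k) p) n = (\<Prod>i<k. real (Suc (n + i))) * coeff p (n + k)"
proof (induction k arbitrary: n)
  case (Suc k)
  have "degree ((D ^^ k) p) \<le> Suc n"
    "coeff ((D ^^ k) p) (Suc n) = (\<Prod>i<k. real (Suc (Suc n + i))) * coeff p (Suc n + k)"
    using Suc.IH[of "Suc n"] Suc.prems by auto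
  then show ?case
    using degree_D[of "(D ^^ k) p" n] coeff_D[of "(D ^^ k) p" n]
    by (simp add: prod.lessThan_Suc_shift del: prod.lessThan_Suc)
qed simp

lemma iterate_D_top:
  assumes "degree p \<le> k"
  shows "(D ^^ k) p = [: fact k * coeff p k :]"
proof -
  have "degree ((D ^^ k) p) \<le> 0" "coeff ((D ^^ k) p) 0 = (\<Prod>i<k. real (Suc i)) * coeff p k"
    using iterate_D[of p 0 k] assms by auto
  then show ?thesis
    by (metis coeff_pCons_0 degree_0_id fact_prod_Suc le_zero_eq lessThan_atLeast0 of_nat_prod)
qed

text \<open>This contains both orthogonality and the norm: the coefficient is zero when the degree
  is below \<open>k\<close>, and is the leading coefficient when \<open>p = P k\<close>.\<close>

lemma integral_P_mult:
  assumes "degree p \<le> k"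
  shows "(\<integral>x. poly p x * poly (P k) x \<partial>N) = fact k * coeff p k * (\<integral>x. w k x \<partial>N)"
  using Rodrigues[OF adjoint_iterate_poly, of k p] iterate_D_top[OF assms] by simp

lemma integral_P_square:
  "(\<integral>x. (poly (P k) x)\<^sup>2 \<partial>N) = fact k * (\<integral>x. w k x \<partial>N) * (\<Prod>n<k. 1 - real (2 * k - 2 - n) * \<delta>)"
  using integral_P_mult[of "P k" k] degree_R[of k k]
  by (simp add: P_def[symmetric] coeff_P power2_eq_square mult_ac)

text \<open>Otherwise \<open>P k\<close> would be null in mean square, and Cauchy-Schwarz would make
  its pairing with \<open>x ^ k\<close>, which is \<open>fact k\<close> times the mean of
  \<open>w k\<close>, vanish too. So no factor \<open>1 - j * \<delta>\<close> of the k-th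
  denominator can vanish unless the mean of \<open>w k\<close> does, whatever the sign of
  \<open>\<delta>\<close>.\<close>

lemma coeff_P_nonzero:
  assumes "(\<integral>x. w k x \<partial>N) \<noteq> 0"
  shows "coeff (P k) k \<noteq> 0"
proof
  assume "coeff (P k) k = 0"
  then have z: "(\<integral>x. (poly (P k) x)\<^sup>2 \<partial>N) = 0" 
    unfolding integral_P_square coeff_P[symmetric] by simp
  have "(\<integral>x. poly (monom 1 k) x * poly (P k) x \<partial>N)\<^sup>2 \<le> 0"
    using square_integrable_Cauchy_Schwarz[OF square_integrable_poly square_integrable_poly,
        of "monom 1 k" "P k"] z by simp
  with assms show False by (simp add: integral_P_mult degree_monom_le)
qed

sublocale orthogonal_polys N t0 P
proof
  have *: "(\<integral>x. poly (P i) x * poly (P j) x \<partial>N) = 0" if "i < j" for i j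
    using that degree_R[of i i] integral_P_mult[of "P i" j] coeff_eq_0[of "P i" j]
    by (simp add: P_def)
  show "(\<integral>x. poly (P i) x * poly (P j) x \<partial>N) = 0" if "i \<noteq> j" for i j
    using *[of i j] *[of j i] that by (cases "i < j") (auto simp: mult.commute)
  show "\<exists>T. degree T = m \<and> T \<noteq> 0 \<and> (T = P m \<or> (AE x in N. poly T x = 0))" for m
  proof (cases "(\<integral>x. w m x \<partial>N) = 0")
    case True
    with w_pos_or_finite[of m] show ?thesis by blast
  next
    case False
    from coeff_P_nonzero[OF this] have "degree (P m) = m" "P m \<noteq> 0"
      using degree_R[of m m] le_degree[of "P m" m] by (auto simp: P_def)
    then show ?thesis by blast
  qed
qed

lemma covariance_eq:
  assumes g: "square_integrable N g" and h: "square_integrable N h"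
  shows "covariance N g h = (\<integral>x. g x * h x \<partial>N) - (\<integral>x. g x \<partial>N) * (\<integral>x. h x \<partial>N)"
proof -
  let ?m = "\<integral>x. g x \<partial>N" and ?n = "\<integral>x. h x \<partial>N"
  have i: "integrable N g" "integrable N h" "integrable N (\<lambda>x. g x * h x)"
    using square_integrable_mult[OF g square_integrable_poly[of 1]]
      square_integrable_mult[OF h square_integrable_poly[of 1]] square_integrable_mult[OF g h] by auto
  have "covariance N g h = (\<integral>x. g x * h x - ?n * g x - ?m * h x + ?m * ?n \<partial>N)"
    unfolding covariance_def by (simp add: algebra_simps)
  also have "\<dots> = (\<integral>x. g x * h x \<partial>N) - ?n * ?m - ?m * ?n + ?m * ?n"
    using i prob_space by simp
  finally show ?thesis by simp
qed

theorem covariance_sums: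
  assumes G: "adjoint G" "square_integrable N (G 0)" and H: "adjoint H" "square_integrable N (H 0)"
  shows "(\<lambda>n. (\<integral>x. w (Suc n) x * G (Suc n) x \<partial>N) * (\<integral>x. w (Suc n) x * H (Suc n) x \<partial>N) /
      (fact (Suc n) * (\<integral>x. w (Suc n) x \<partial>N) * (\<Prod>j = n..2 * n. 1 - real j * \<delta>)))
    sums covariance N (G 0) (H 0)"
proof -
  define c where "c k = fact k * (\<integral>x. w k x \<partial>N) * (\<Prod>n<k. 1 - real (2 * k - 2 - n) * \<delta>)" for k
  define f where "f k = (\<integral>x. w k x * G k x \<partial>N) * (\<integral>x. w k x * H k x \<partial>N) / c k" for k
  have "f sums (\<integral>x. G 0 x * H 0 x \<partial>N)"
    using Parseval_inner[OF G(2) H(2)] unfolding f_def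
    by (simp add: integral_P_square c_def mult.commute[of "w _ _"] flip: Rodrigues[OF G(1)] Rodrigues[OF H(1)])
  \<comment> \<open>\<open>f 0\<close> is the product of the two means, since \<open>w 0\<close> is
    1 and \<open>c 0 = 1\<close>. Removing it turns the mixed moment into the covariance.\<close>
  then have "f sums (covariance N (G 0) (H 0) + f 0)"
    using prob_space by (simp add: f_def covariance_eq[OF G(2) H(2)] c_def w_0)
  then have "(\<lambda>n. f (Suc n)) sums covariance N (G 0) (H 0)"
    by (simp only: sums_Suc_iff)
  moreover have "c (Suc n) = fact (Suc n) * (\<integral>x. w (Suc n) x \<partial>N) * (\<Prod>j = n..2 * n. 1 - real j * \<delta>)" for n
  proof -
    have "(\<Prod>i<Suc n. 1 - real (2 * n - i) * \<delta>) = (\<Prod>j = n..2 * n. 1 - real j * \<delta>)"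
      by (rule prod.reindex_bij_witness[of _ "\<lambda>j. 2 * n - j" "\<lambda>i. 2 * n - i"]) auto
    then show ?thesis by (simp add: c_def)
  qed
  ultimately show ?thesis by (simp add: f_def)
qed

end

section \<open>Integration by parts on an open interval\<close>

lemma eventually_at_left_ereal:
  assumes "ereal c < b"
  shows "eventually (\<lambda>y. \<exists>x. y = ereal x \<and> c < x \<and> ereal x < b) (at_left b)"
  unfolding eventually_at_left[OF assms]
proof (intro exI[of _ "ereal c"] conjI allI impI assms)
  fix y assume "ereal c < y" "y < b"
  then show "\<exists>x. y = ereal x \<and> c < x \<and> ereal x < b" by (cases y) auto
qed

lemma set_borel_measurable_isCont:
  fixes f :: "real \<Rightarrow> real"
  assumes "open A" "\<And>x. x \<in> A \<Longrightarrow> isCont f x"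
  shows "set_borel_measurable lborel A f"
  unfolding set_borel_measurable_def using assms
  by (auto simp del: real_scaleR_def intro!: borel_measurable_continuous_on_indicator
      simp: continuous_on_eq_continuous_at)

text \<open>Existence of the limit is a conclusion here: integrability of the derivative up to
  \<open>b\<close>, which may be infinite, forces \<open>F\<close> to converge by dominated
  convergence.\<close>

lemma antiderivative_tendsto_at_left:
  fixes F f :: "real \<Rightarrow> real"
  assumes cb: "ereal c < b"
    and F: "\<And>x. c \<le> x \<Longrightarrow> ereal x < b \<Longrightarrow> DERIV F x :> f x"
    and f: "\<And>x. c \<le> x \<Longrightarrow> ereal x < b \<Longrightarrow> isCont f x"
    and int: "set_integrable lborel (einterval c b) f"
  shows "((F \<circ> real_of_ereal) \<longlongrightarrow> F c + (LBINT x:einterval c b. f x)) (at_left b)"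
proof (rule tendsto_at_left_sequentially[OF cb])
  fix S assume S: "\<And>n. S n < b" "\<And>n. ereal c < S n" "incseq S" "S \<longlonglongrightarrow> b"
  define u where "u n = real_of_ereal (S n)" for n
  have u: "ereal (u n) = S n" for n
    using S(1)[of n] S(2)[of n] by (cases "S n") (auto simp: u_def)
  have cu: "c < u n" for n using S(2)[of n] unfolding u[symmetric] by simp
  have ub: "ereal x < b" if "x \<le> u n" for x n
    using S(1)[of n] that unfolding u[symmetric] by (metis ereal_less_eq(3) le_less_trans)
  have eq: "F (u n) = F c + (LBINT x:einterval c (u n). f x)" for n
  proof -
    have "(LBINT x=c..u n. f x) = F (u n) - F c"
    proof (rule interval_integral_FTC_finite)
      show "continuous_on {min c (u n)..max c (u n)} f"
        using cu[of n] f ub[of _ n] by (intro continuous_at_imp_continuous_on) auto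
      show "(F has_vector_derivative f x) (at x within {min c (u n)..max c (u n)})"
        if "min c (u n) \<le> x" "x \<le> max c (u n)" for x
        using that cu[of n] F[of x] ub[of x n]
        by (auto simp: has_real_derivative_iff_has_vector_derivative intro: has_vector_derivative_at_within)
    qed
    then show ?thesis using cu[of n] by (simp add: interval_lebesgue_integral_def)
  qed
  have "(\<lambda>n. LBINT x:einterval c (u n). f x) \<longlonglongrightarrow> (LBINT x:einterval c b. f x)"
    unfolding set_lebesgue_integral_def
  proof (rule integral_dominated_convergence[where w = "\<lambda>x. \<bar>indicator (einterval c b) x *\<^sub>R f x\<bar>"])
    show "integrable lborel (\<lambda>x. \<bar>indicator (einterval c b) x *\<^sub>R f x\<bar>)"
      using int unfolding set_integrable_def by (rule integrable_abs)
    have "set_integrable lborel (einterval c (u n)) f" for n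
      by (rule set_integrable_subset[OF int]) (auto simp: einterval_iff intro: ub[OF less_imp_le])
    then show "(\<lambda>x. indicator (einterval c (u n)) x *\<^sub>R f x) \<in> borel_measurable lborel" for n
      by (auto simp: set_integrable_def)
    show "(\<lambda>x. indicator (einterval c b) x *\<^sub>R f x) \<in> borel_measurable lborel"
      using int by (auto simp: set_integrable_def)
    show "AE x in lborel. norm (indicator (einterval c (u n)) x *\<^sub>R f x)
        \<le> \<bar>indicator (einterval c b) x *\<^sub>R f x\<bar>" for n
      by (intro AE_I2) (auto simp: indicator_def einterval_iff intro: ub[OF less_imp_le])
    show "AE x in lborel. (\<lambda>n. indicator (einterval c (u n)) x *\<^sub>R f x)
        \<longlonglongrightarrow> indicator (einterval c b) x *\<^sub>R f x"
    proof (rule AE_I2)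
      fix x
      have "\<forall>\<^sub>F n in sequentially. indicator (einterval c (u n)) x *\<^sub>R f x = indicator (einterval c b) x *\<^sub>R f x"
      proof (cases "ereal x < b")
        case True
        have "\<forall>\<^sub>F n in sequentially. ereal x < S n"
          using S(4) True by (rule order_tendstoD)
        then show ?thesis
          by eventually_elim (use True in \<open>auto simp: indicator_def einterval_iff u\<close>)
      next
        case False
        then have "\<not> x < u n" for n using ub[of x n] by auto
        with False show ?thesis by (auto simp: indicator_def einterval_iff)
      qed
      then show "(\<lambda>n. indicator (einterval c (u n)) x *\<^sub>R f x)
        \<longlonglongrightarrow> indicator (einterval c b) x *\<^sub>R f x"
        by (rule tendsto_eventually)
    qed
  qed
  then have "(\<lambda>n. F (u n)) \<longlonglongrightarrow> F c + (LBINT x:einterval c b. f x)"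
    unfolding eq by (intro tendsto_intros)
  then show "(\<lambda>n. (F \<circ> real_of_ereal) (S n)) \<longlonglongrightarrow> F c + (LBINT x:einterval c b. f x)"
    by (simp add: u_def)
qed

text \<open>\<open>F\<close> is nondecreasing, so its supremum \<open>B\<close> is its limit at
  \<open>b\<close>, and the fundamental theorem for nonnegative integrands yields
  integrability.\<close>

lemma set_integrable_if_antiderivative_bounded:
  fixes F f :: "real \<Rightarrow> real"
  assumes cb: "ereal c < b"
    and F: "\<And>x. c \<le> x \<Longrightarrow> ereal x < b \<Longrightarrow> DERIV F x :> f x"
    and f: "\<And>x. c \<le> x \<Longrightarrow> ereal x < b \<Longrightarrow> isCont f x"
    and nonneg: "\<And>x. c \<le> x \<Longrightarrow> ereal x < b \<Longrightarrow> 0 \<le> f x"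
    and bound: "\<And>x. c \<le> x \<Longrightarrow> ereal x < b \<Longrightarrow> F x \<le> C"
  shows "set_integrable lborel (einterval c b) f"
proof -
  let ?A = "{x. c \<le> x \<and> ereal x < b}"
  define B where "B = (SUP x\<in>?A. F x)"
  have bdd: "bdd_above (F ` ?A)" using bound by (auto intro!: bdd_aboveI2)
  have FB: "F x \<le> B" if "x \<in> ?A" for x
    unfolding B_def by (rule cSUP_upper[OF that bdd])
  have mono: "F x \<le> F y" if "c \<le> x" "x \<le> y" "ereal y < b" for x y
  proof (rule DERIV_nonneg_imp_nondecreasing[OF that(2)])
    fix z assume "x \<le> z" "z \<le> y"
    moreover then have "ereal z < b" using that(3) by (metis ereal_less_eq(3) le_less_trans)
    ultimately show "\<exists>d. DERIV F z :> d \<and> 0 \<le> d" using F[of z] nonneg[of z] that(1) by auto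
  qed
  have "((F \<circ> real_of_ereal) \<longlongrightarrow> B) (at_left b)"
  proof (rule increasing_tendsto)
    show "\<forall>\<^sub>F n in at_left b. (F \<circ> real_of_ereal) n \<le> B"
      using eventually_at_left_ereal[OF cb] by eventually_elim (auto intro!: FB)
    fix y assume "y < B"
    then obtain x where x: "x \<in> ?A" "y < F x"
      unfolding B_def using cb by (subst (asm) less_cSUP_iff[OF _ bdd]) auto
    then have "ereal x < b" by simp
    from eventually_at_left_ereal[OF this] show "\<forall>\<^sub>F n in at_left b. y < (F \<circ> real_of_ereal) n"
    proof eventually_elim
      case (elim n)
      then obtain z where "n = ereal z" "x < z" "ereal z < b" by blast
      with mono[of x z] x show ?case by auto
    qed
  qed
  moreover have "((F \<circ> real_of_ereal) \<longlongrightarrow> F c) (at_right (ereal c))"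
    unfolding ereal_tendsto_simps
    using F[of c] cb DERIV_isCont[of F "f c" c] by (auto simp: isCont_def intro: tendsto_mono[OF at_le])
  ultimately show ?thesis
    by (intro interval_integral_FTC_nonneg(1)[OF cb, where F = F]) (auto intro!: AE_I2 intro: F f nonneg)
qed

text \<open>With \<open>k = sqrt (1 + h\<^sup>2)\<close> in place of \<open>\<bar>h\<bar>\<close>, the product \<open>k W\<close> has a limit at \<open>b\<close>. A nonzero limit would
  make \<open>- v / W\<close>, the derivative of \<open>- ln W\<close>, integrable near \<open>b\<close>, contradicting \<open>W \<longlongrightarrow> 0\<close>.\<close>

lemma boundary_term_at_left:
  fixes W v h h' :: "real \<Rightarrow> real"
  assumes ac: "a < ereal c" and cb: "ereal c < b"
    and W: "\<And>x. a < ereal x \<Longrightarrow> ereal x < b \<Longrightarrow> DERIV W x :> v x"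
    and v: "\<And>x. a < ereal x \<Longrightarrow> ereal x < b \<Longrightarrow> isCont v x"
    and W_pos: "\<And>x. a < ereal x \<Longrightarrow> ereal x < b \<Longrightarrow> 0 < W x"
    and v_le: "\<And>x. c \<le> x \<Longrightarrow> ereal x < b \<Longrightarrow> v x \<le> 0"
    and W_lim: "((W \<circ> real_of_ereal) \<longlongrightarrow> 0) (at_left b)"
    and h: "\<And>x. a < ereal x \<Longrightarrow> ereal x < b \<Longrightarrow> DERIV h x :> h' x"
    and h': "\<And>x. a < ereal x \<Longrightarrow> ereal x < b \<Longrightarrow> isCont h' x"
    and int: "set_integrable lborel (einterval c b) (\<lambda>x. h' x * W x)"
  shows "set_integrable lborel (einterval c b) (\<lambda>x. h x * v x)"
    and "(((\<lambda>x. h x * W x) \<circ> real_of_ereal) \<longlongrightarrow> 0) (at_left b)"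
proof -
  have ax: "a < ereal x" if "c \<le> x" for x
    using ac that by (metis ereal_less_eq(3) less_le_trans)
  have ab: "a < b" using ac cb by order
  note contW = DERIV_isCont[OF W] and conth = DERIV_isCont[OF h]
  \<comment> \<open>\<open>k\<close> dominates \<open>\<bar>h\<bar>\<close>, is differentiable even
    at the zeros of \<open>h\<close>, and satisfies
    \<open>\<bar>k' x\<bar> \<le> \<bar>h' x\<bar>\<close>, so \<open>k' * W\<close> inherits
    integrability.\<close>
  define k where "k x = sqrt (1 + (h x)\<^sup>2)" for x
  define k' where "k' x = h x * h' x / k x" for x
  have kpos: "k x > 0" "k x \<ge> \<bar>h x\<bar>" "k x \<noteq> 0" for x
    by (auto simp: k_def add_pos_nonneg real_le_rsqrt add_nonneg_eq_0_iff)
  have k: "DERIV k x :> k' x" if "a < ereal x" "ereal x < b" for x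
  proof -
    have 1: "DERIV (\<lambda>x. 1 + (h x)\<^sup>2) x :> 2 * h x * h' x"
      by (auto intro!: derivative_eq_intros h[OF that])
    have 2: "DERIV sqrt (1 + (h x)\<^sup>2) :> inverse (sqrt (1 + (h x)\<^sup>2)) / 2"
      by (rule DERIV_real_sqrt) (simp add: add_pos_nonneg)
    have "DERIV (\<lambda>x. sqrt (1 + (h x)\<^sup>2)) x :> inverse (sqrt (1 + (h x)\<^sup>2)) / 2 * (2 * h x * h' x)"
      by (rule DERIV_chain2[where f = sqrt, OF 2 1])
    also have "inverse (sqrt (1 + (h x)\<^sup>2)) / 2 * (2 * h x * h' x) = k' x"
      unfolding k'_def k_def divide_inverse by (simp only: mult_ac) simp
    also have "(\<lambda>x. sqrt (1 + (h x)\<^sup>2)) = k"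
      by (rule ext) (rule k_def[symmetric])
    finally show ?thesis .
  qed
  note contk = DERIV_isCont[OF k]
  have contk': "isCont k' x" if "a < ereal x" "ereal x < b" for x
    unfolding k'_def using that kpos
    by (auto intro!: continuous_intros contk conth h')
  have k'_le: "\<bar>k' x\<bar> \<le> \<bar>h' x\<bar>" for x
    using kpos[of x] mult_right_mono[OF kpos(2), of "\<bar>h' x\<bar>" x]
    by (simp add: k'_def abs_mult divide_simps mult.commute)
  have int_k: "set_integrable lborel (einterval c b) (\<lambda>x. k' x * W x)"
  proof (rule set_integrable_bound[OF int])
    show "set_borel_measurable lborel (einterval c b) (\<lambda>x. k' x * W x)"
      by (rule set_borel_measurable_isCont)
         (auto simp: einterval_iff intro!: continuous_intros contk' contW ax)
    show "AE x in lborel. x \<in> einterval c b \<longrightarrow> norm (k' x * W x) \<le> norm (h' x * W x)"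
      using k'_le by (auto simp: abs_mult intro!: AE_I2 mult_right_mono)
  qed
  have ivl_measurable: "set_borel_measurable lborel (einterval c b) f"
    if "\<And>x. a < ereal x \<Longrightarrow> ereal x < b \<Longrightarrow> isCont f x" for f :: "real \<Rightarrow> real"
    by (rule set_borel_measurable_isCont) (auto simp: einterval_iff intro!: that ax)
  obtain G where G: "\<And>x. a < ereal x \<Longrightarrow> ereal x < b \<Longrightarrow> DERIV G x :> k' x * W x"
    using einterval_antiderivative[OF ab, of "\<lambda>x. k' x * W x"]
    by (auto simp: has_real_derivative_iff_has_vector_derivative contk' contW)
  \<comment> \<open>\<open>- k * v\<close> is nonnegative with antiderivative
    \<open>G - k * W\<close>. Dropping the negative term \<open>- k * W\<close> leaves
    \<open>G\<close>, whose growth is controlled by the integral of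
    \<open>\<bar>k' * W\<bar>\<close>.\<close>
  have int_kv: "set_integrable lborel (einterval c b) (\<lambda>x. - (k x * v x))"
  proof (rule set_integrable_if_antiderivative_bounded[OF cb, where F = "\<lambda>x. G x - k x * W x"])
    fix x assume x: "c \<le> x" "ereal x < b"
    note x' = ax[OF x(1)] x(2)
    show "DERIV (\<lambda>x. G x - k x * W x) x :> - (k x * v x)"
      by (rule derivative_eq_intros G[OF x'] k[OF x'] W[OF x'] refl)+ (simp add: algebra_simps)
    show "isCont (\<lambda>x. - (k x * v x)) x"
      by (intro continuous_intros contk v x')
    show "0 \<le> - (k x * v x)"
      using kpos(1)[of x] v_le[OF x] by (simp add: mult_nonneg_nonpos)
    have lt: "ereal z < b" if "z \<le> x" for z
      using x(2) that by (metis ereal_less_eq(3) le_less_trans)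
    have "G x - G c = (LBINT x=c..x. k' x * W x)"
    proof (rule interval_integral_FTC_finite[symmetric])
      show "continuous_on {min c x..max c x} (\<lambda>x. k' x * W x)"
        using x lt by (intro continuous_at_imp_continuous_on) (auto intro!: continuous_intros contk' contW ax)
      show "(G has_vector_derivative k' z * W z) (at z within {min c x..max c x})"
        if "min c x \<le> z" "z \<le> max c x" for z
        using that x G[of z] ax[of z] lt[of z]
        by (auto simp: has_real_derivative_iff_has_vector_derivative intro: has_vector_derivative_at_within)
    qed
    also have "\<dots> = (LBINT x:einterval c x. k' x * W x)"
      using x by (simp add: interval_lebesgue_integral_def)
    also have "\<dots> \<le> (LBINT x:einterval c b. \<bar>k' x * W x\<bar>)"
      unfolding set_lebesgue_integral_def
    proof (rule integral_mono')
      show "integrable lborel (\<lambda>x. indicator (einterval c b) x *\<^sub>R \<bar>k' x * W x\<bar>)"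
        using set_integrable_abs[OF int_k] by (simp add: set_integrable_def)
      fix z show "indicator (einterval c x) z *\<^sub>R (k' z * W z) \<le> indicator (einterval c b) z *\<^sub>R \<bar>k' z * W z\<bar>"
        using x by (auto simp: indicator_def einterval_iff dest: lt[OF less_imp_le])
    qed (auto simp: indicator_def)
    finally show "G x - k x * W x \<le> G c + (LBINT x:einterval c b. \<bar>k' x * W x\<bar>)"
      using kpos(1)[of x] W_pos[OF x'] mult_pos_pos[of "k x" "W x"] by linarith
  qed
  have int_kv': "set_integrable lborel (einterval c b) (\<lambda>x. k x * v x)"
    using set_integrable_mult_right[OF int_kv, of "-1"] by simp
  show "set_integrable lborel (einterval c b) (\<lambda>x. h x * v x)"
  proof (rule set_integrable_bound[OF int_kv'])
    show "AE x in lborel. x \<in> einterval c b \<longrightarrow> norm (h x * v x) \<le> norm (k x * v x)"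
      using kpos(2) by (auto simp: abs_mult abs_of_pos[OF kpos(1)] intro!: AE_I2 mult_right_mono)
  qed (intro ivl_measurable continuous_intros conth v)
  define L where "L = k c * W c + (LBINT x:einterval c b. k' x * W x + k x * v x)"
  have lim: "(((\<lambda>x. k x * W x) \<circ> real_of_ereal) \<longlongrightarrow> L) (at_left b)"
    unfolding L_def
  proof (rule antiderivative_tendsto_at_left[OF cb])
    fix x assume x: "c \<le> x" "ereal x < b"
    note x' = ax[OF x(1)] x(2)
    show "DERIV (\<lambda>x. k x * W x) x :> k' x * W x + k x * v x"
      by (rule derivative_eq_intros k[OF x'] W[OF x'] refl)+ (simp add: algebra_simps)
    show "isCont (\<lambda>x. k' x * W x + k x * v x) x"
      by (intro continuous_intros contk contk' contW v x')
  qed (intro set_integral_add int_k int_kv')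
  have nontriv: "at_left b \<noteq> bot"
    using eventually_at_left[OF cb, of "\<lambda>_. False"] dense[where y = b] by auto
  have "L = 0"
  proof (rule ccontr)
    assume "L \<noteq> 0"
    moreover have "L \<ge> 0"
      by (rule tendsto_lowerbound[OF lim _ nontriv], rule eventually_mono[OF eventually_at_left_ereal[OF cb]])
         (use kpos W_pos ax in \<open>auto intro!: mult_nonneg_nonneg less_imp_le\<close>)
    ultimately have L: "L > 0" by simp
    then have "\<forall>\<^sub>F y in at_left b. L / 2 < ((\<lambda>x. k x * W x) \<circ> real_of_ereal) y"
      by (intro order_tendstoD(1)[OF lim]) simp
    then have "\<forall>\<^sub>F y in at_left b. L / 2 < ((\<lambda>x. k x * W x) \<circ> real_of_ereal) y \<and>
        (\<exists>x. y = ereal x \<and> c < x \<and> ereal x < b)"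
      by (intro eventually_conj eventually_at_left_ereal cb)
    then obtain y0 where y0: "y0 < b" "\<And>y. y0 < y \<Longrightarrow> y < b \<Longrightarrow> L / 2 < k (real_of_ereal y) * W (real_of_ereal y)"
      unfolding eventually_at_left[OF cb] by auto
    obtain y1 where "max y0 (ereal c) < y1" "y1 < b" using dense[of "max y0 (ereal c)" b] y0(1) cb by auto
    moreover then obtain d where "y1 = ereal d" by (cases y1) auto
    ultimately have d: "c < d" "ereal d < b" "y0 < ereal d" by auto
    \<comment> \<open>Near \<open>b\<close> this bounds \<open>1 / W\<close> by
      \<open>2 / L * k\<close>, so \<open>v / W\<close> is dominated by a multiple of the integrable
      \<open>k * v\<close>, and \<open>ln W\<close> acquires a finite limit.\<close>
    have kW: "L / 2 < k x * W x" if "d \<le> x" "ereal x < b" for x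
      using y0(2)[of "ereal x"] that d by (metis ereal_less_eq(3) less_le_trans real_of_ereal.simps(1))
    have ad: "a < ereal x" if "d \<le> x" for x using ax d that by simp
    have "(((\<lambda>x. ln (W x)) \<circ> real_of_ereal) \<longlongrightarrow> ln (W d) + (LBINT x:einterval d b. v x / W x)) (at_left b)"
    proof (rule antiderivative_tendsto_at_left[OF d(2)])
      fix x assume x: "d \<le> x" "ereal x < b"
      note x' = ad[OF x(1)] x(2)
      show "DERIV (\<lambda>x. ln (W x)) x :> v x / W x"
        using W_pos[OF x'] by (auto intro!: derivative_eq_intros W[OF x'])
      show "isCont (\<lambda>x. v x / W x) x"
        using W_pos[OF x'] by (auto intro!: continuous_intros contW v x')
    next
      have "set_integrable lborel (einterval d b) (\<lambda>x. k x * v x)"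
        by (rule set_integrable_subset[OF int_kv']) (use d in \<open>auto simp: einterval_iff\<close>)
      then have "set_integrable lborel (einterval d b) (\<lambda>x. 2 / L * (k x * v x))" by simp
      then show "set_integrable lborel (einterval d b) (\<lambda>x. v x / W x)"
      proof (rule set_integrable_bound)
        show "set_borel_measurable lborel (einterval d b) (\<lambda>x. v x / W x)"
        proof (rule set_borel_measurable_isCont)
          fix x assume "x \<in> einterval d b"
          then have x: "a < ereal x" "ereal x < b" using ad[of x] by (auto simp: einterval_iff)
          show "isCont (\<lambda>x. v x / W x) x"
            using W_pos[OF x] by (intro continuous_intros v contW x) simp
        qed simp
        show "AE x in lborel. x \<in> einterval d b \<longrightarrow> norm (v x / W x) \<le> norm (2 / L * (k x * v x))"
        proof (intro AE_I2 impI)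
          fix x assume "x \<in> einterval d b"
          then have x: "d \<le> x" "ereal x < b" by (auto simp: einterval_iff)
          have "1 / W x \<le> 2 / L * k x"
            using kW[OF x] W_pos[OF ad[OF x(1)] x(2)] L by (simp add: divide_simps mult_ac)
          from mult_right_mono[OF this, of "\<bar>v x\<bar>"]
          show "norm (v x / W x) \<le> norm (2 / L * (k x * v x))"
            using W_pos[OF ad[OF x(1)] x(2)] L kpos(1)[of x] by (simp add: abs_mult mult_ac)
        qed
      qed
    qed
    then have "((\<lambda>y. exp (((\<lambda>x. ln (W x)) \<circ> real_of_ereal) y)) \<longlongrightarrow>
       exp (ln (W d) + (LBINT x:einterval d b. v x / W x))) (at_left b)"
      by (rule tendsto_exp)
    moreover have "\<forall>\<^sub>F y in at_left b. exp (((\<lambda>x. ln (W x)) \<circ> real_of_ereal) y) = (W \<circ> real_of_ereal) y"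
      by (rule eventually_mono[OF eventually_at_left_ereal[OF cb]]) (use W_pos ax in auto)
    ultimately have "((W \<circ> real_of_ereal) \<longlongrightarrow> exp (ln (W d) + (LBINT x:einterval d b. v x / W x))) (at_left b)"
      by (rule Lim_transform_eventually)
    from tendsto_unique[OF nontriv this W_lim] show False by simp
  qed
  with lim have lim0: "(((\<lambda>x. k x * W x) \<circ> real_of_ereal) \<longlongrightarrow> 0) (at_left b)" by simp
  show "(((\<lambda>x. h x * W x) \<circ> real_of_ereal) \<longlongrightarrow> 0) (at_left b)"
  proof (rule Lim_null_comparison[OF _ lim0], rule eventually_mono[OF eventually_at_left_ereal[OF cb]])
    fix y assume "\<exists>x. y = ereal x \<and> c < x \<and> ereal x < b"
    then obtain x where x: "y = ereal x" "c \<le> x" "ereal x < b" by auto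
    show "norm (((\<lambda>x. h x * W x) \<circ> real_of_ereal) y) \<le> ((\<lambda>x. k x * W x) \<circ> real_of_ereal) y"
      using x kpos(2)[of x] W_pos[OF ax[OF x(2)] x(3)] by (simp add: abs_mult)
  qed
qed

lemma tendsto_at_right_ereal_uminus:
  fixes f :: "real \<Rightarrow> 'b::topological_space" and a :: ereal
  shows "((f \<circ> real_of_ereal) \<longlongrightarrow> L) (at_right a) \<longleftrightarrow>
    (((\<lambda>x. f (- x)) \<circ> real_of_ereal) \<longlongrightarrow> L) (at_left (- a))"
proof -
  have "filterlim uminus (at_left (- a)) (at_right a)"
    by (simp add: filterlim_at eventually_at_filter tendsto_uminus_ereal)
  from filterlim_compose[OF _ this, of "(\<lambda>x. f (- x)) \<circ> real_of_ereal" "nhds L"]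
  have 1: "(((\<lambda>x. f (- x)) \<circ> real_of_ereal) \<longlongrightarrow> L) (at_left (- a)) \<Longrightarrow> ((f \<circ> real_of_ereal) \<longlongrightarrow> L) (at_right a)"
    by (simp add: o_def)
  have "filterlim uminus (at_right a) (at_left (- a))"
    using tendsto_uminus_ereal[OF tendsto_ident_at, of "- a" "{..< - a}"]
    by (simp add: filterlim_at eventually_at_filter ereal_less_uminus_reorder ereal_uminus_eq_reorder)
  from filterlim_compose[OF _ this, of "f \<circ> real_of_ereal" "nhds L"]
  have 2: "((f \<circ> real_of_ereal) \<longlongrightarrow> L) (at_right a) \<Longrightarrow> (((\<lambda>x. f (- x)) \<circ> real_of_ereal) \<longlongrightarrow> L) (at_left (- a))"
    by (simp add: o_def)
  from 1 2 show ?thesis by blast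
qed

lemma set_integrable_einterval_uminus:
  fixes f :: "real \<Rightarrow> real"
  assumes "a \<le> b"
  shows "set_integrable lborel (einterval (- b) (- a)) (\<lambda>x. f (- x)) \<longleftrightarrow> set_integrable lborel (einterval a b) f"
  using interval_integrable_mirror[of "- b" "- a" f] assms
  by (simp add: interval_lebesgue_integrable_def)

text \<open>Reflection at 0 exchanges the endpoints and flips the sign of the derivative of
  \<open>W\<close>, which turns \<open>v_ge\<close> into the sign condition of
  \<open>boundary_term_at_left\<close>.\<close>

lemma boundary_term_at_right:
  fixes W v h h' :: "real \<Rightarrow> real"
  assumes ac: "a < ereal c" and cb: "ereal c < b"
    and W: "\<And>x. a < ereal x \<Longrightarrow> ereal x < b \<Longrightarrow> DERIV W x :> v x"
    and v: "\<And>x. a < ereal x \<Longrightarrow> ereal x < b \<Longrightarrow> isCont v x"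
    and W_pos: "\<And>x. a < ereal x \<Longrightarrow> ereal x < b \<Longrightarrow> 0 < W x"
    and v_ge: "\<And>x. a < ereal x \<Longrightarrow> x \<le> c \<Longrightarrow> 0 \<le> v x"
    and W_lim: "((W \<circ> real_of_ereal) \<longlongrightarrow> 0) (at_right a)"
    and h: "\<And>x. a < ereal x \<Longrightarrow> ereal x < b \<Longrightarrow> DERIV h x :> h' x"
    and h': "\<And>x. a < ereal x \<Longrightarrow> ereal x < b \<Longrightarrow> isCont h' x"
    and int: "set_integrable lborel (einterval a c) (\<lambda>x. h' x * W x)"
  shows "set_integrable lborel (einterval a c) (\<lambda>x. h x * v x)"
    and "(((\<lambda>x. h x * W x) \<circ> real_of_ereal) \<longlongrightarrow> 0) (at_right a)"
proof -
  have D: "DERIV (\<lambda>x. f (- x)) x :> - y" if "DERIV f (- x) :> y" for f :: "real \<Rightarrow> real" and x y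
    using that by (simp add: DERIV_mirror)
  have C: "isCont (\<lambda>x. - f (- x)) x" if "isCont f (- x)" for f :: "real \<Rightarrow> real" and x
  proof -
    have "isCont uminus x" by simp
    from isCont_o2[OF this, of f] that show ?thesis by (intro continuous_minus)
  qed
  have bd: "a < ereal (- x) \<and> ereal (- x) < b" if "- b < ereal x" "ereal x < - a" for x
    using that by (cases a; cases b) auto
  have "set_integrable lborel (einterval (- ereal c) (- a)) (\<lambda>x. - h' (- x) * W (- x))"
    using set_integrable_mult_right[OF iffD2[OF set_integrable_einterval_uminus[OF less_imp_le[OF ac]] int], of "-1"]
    by simp
  then have i: "set_integrable lborel (einterval (ereal (- c)) (- a)) (\<lambda>x. - h' (- x) * W (- x))" by simp
  have W_lim': "(((\<lambda>x. W (- x)) \<circ> real_of_ereal) \<longlongrightarrow> 0) (at_left (- a))"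
    using W_lim tendsto_at_right_ereal_uminus by blast
  have sgn: "- v (- x) \<le> 0" if "- c \<le> x" "ereal x < - a" for x
    using that v_ge[of "- x"] by (cases a) auto
  have ab': "- b < ereal (- c)" "ereal (- c) < - a" using ac cb by (cases a; cases b; auto)+
  have 1: "DERIV (\<lambda>x. W (- x)) x :> - v (- x)" "DERIV (\<lambda>x. h (- x)) x :> - h' (- x)"
    "isCont (\<lambda>x. - v (- x)) x" "isCont (\<lambda>x. - h' (- x)) x" "0 < W (- x)"
    if "- b < ereal x" "ereal x < - a" for x
    using bd[OF that] by (auto intro!: D C W v h h' W_pos)
  note * = boundary_term_at_left[where a = "- b" and b = "- a" and c = "- c" and W = "\<lambda>x. W (- x)"
    and v = "\<lambda>x. - v (- x)" and h = "\<lambda>x. h (- x)" and h' = "\<lambda>x. - h' (- x)",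
    OF ab' 1(1) 1(3) 1(5) sgn W_lim' 1(2) 1(4) i]
  have "set_integrable lborel (einterval (- ereal c) (- a)) (\<lambda>x. h (- x) * (- v (- x)))"
    using *(1) by simp
  from set_integrable_mult_right[OF this, of "-1"]
  show "set_integrable lborel (einterval a c) (\<lambda>x. h x * v x)"
    using set_integrable_einterval_uminus[OF less_imp_le[OF ac], of "\<lambda>x. h x * v x"] by simp
  show "(((\<lambda>x. h x * W x) \<circ> real_of_ereal) \<longlongrightarrow> 0) (at_right a)"
    using *(2) tendsto_at_right_ereal_uminus[of "\<lambda>x. h x * W x"] by blast
qed

text \<open>The sign of \<open>v\<close> near each end makes that part of \<open>h * v\<close>
  integrable and removes the boundary term there. The remaining stretch between \<open>c\<close> and
  \<open>d\<close>, which may come in either order, is compact.\<close>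

lemma integration_by_parts_einterval:
  fixes W v h h' :: "real \<Rightarrow> real"
  assumes W: "\<And>x. x \<in> einterval a b \<Longrightarrow> DERIV W x :> v x"
    and v: "\<And>x. x \<in> einterval a b \<Longrightarrow> isCont v x"
    and W_pos: "\<And>x. x \<in> einterval a b \<Longrightarrow> 0 < W x"
    and c: "c \<in> einterval a b" and v_le: "\<And>x. x \<in> einterval a b \<Longrightarrow> c \<le> x \<Longrightarrow> v x \<le> 0"
    and d: "d \<in> einterval a b" and v_ge: "\<And>x. x \<in> einterval a b \<Longrightarrow> x \<le> d \<Longrightarrow> 0 \<le> v x"
    and W_lim: "((W \<circ> real_of_ereal) \<longlongrightarrow> 0) (at_right a)" "((W \<circ> real_of_ereal) \<longlongrightarrow> 0) (at_left b)"
    and h: "\<And>x. x \<in> einterval a b \<Longrightarrow> DERIV h x :> h' x"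
    and h': "\<And>x. x \<in> einterval a b \<Longrightarrow> isCont h' x"
    and int: "set_integrable lborel (einterval a b) (\<lambda>x. h' x * W x)"
  shows "set_integrable lborel (einterval a b) (\<lambda>x. h x * v x)"
    and "(((\<lambda>x. h x * W x) \<circ> real_of_ereal) \<longlongrightarrow> 0) (at_right a)"
    and "(((\<lambda>x. h x * W x) \<circ> real_of_ereal) \<longlongrightarrow> 0) (at_left b)"
    and "(LBINT x:einterval a b. h' x * W x) = - (LBINT x:einterval a b. h x * v x)"
proof -
  have ab: "a < ereal c" "ereal c < b" "a < ereal d" "ereal d < b" "a < b"
    using c d by (auto simp: einterval_iff)
  have cx: "a < ereal x" if "c \<le> x" for x using ab that by (metis ereal_less_eq(3) less_le_trans)
  have dx: "ereal x < b" if "x \<le> d" for x using ab that by (metis ereal_less_eq(3) le_less_trans)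
  have sub: "set_integrable lborel (einterval c b) (\<lambda>x. h' x * W x)" "set_integrable lborel (einterval a d) (\<lambda>x. h' x * W x)"
    by (rule set_integrable_subset[OF int], use cx dx in \<open>auto simp: einterval_iff less_imp_le\<close>)+
  note left = boundary_term_at_left[OF ab(1,2) W v W_pos v_le W_lim(2) h h' sub(1), unfolded einterval_iff]
  note right = boundary_term_at_right[OF ab(3,4) W v W_pos v_ge W_lim(1) h h' sub(2), unfolded einterval_iff]
  have l: "set_integrable lborel (einterval c b) (\<lambda>x. h x * v x)"
    "(((\<lambda>x. h x * W x) \<circ> real_of_ereal) \<longlongrightarrow> 0) (at_left b)"
    using left cx by auto
  have r: "set_integrable lborel (einterval a d) (\<lambda>x. h x * v x)"
    "(((\<lambda>x. h x * W x) \<circ> real_of_ereal) \<longlongrightarrow> 0) (at_right a)"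
    using right dx by auto
  have m: "set_integrable lborel {min c d..max c d} (\<lambda>x. h x * v x)"
  proof (rule borel_integrable_atLeastAtMost', intro continuous_at_imp_continuous_on ballI)
    fix x assume x: "x \<in> {min c d..max c d}"
    have "a < ereal (min c d)" "ereal (max c d) < b" using ab by (auto simp: min_def max_def)
    with x have "x \<in> einterval a b" unfolding einterval_iff
      by (metis atLeastAtMost_iff ereal_less_eq(3) le_less_trans less_le_trans)
    then show "isCont (\<lambda>x. h x * v x) x" by (intro continuous_intros DERIV_isCont[OF h] v)
  qed
  have "set_integrable lborel (einterval a d \<union> ({min c d..max c d} \<union> einterval c b)) (\<lambda>x. h x * v x)"
    by (intro set_integrable_Un l(1) r(1) m) auto
  then show hv: "set_integrable lborel (einterval a b) (\<lambda>x. h x * v x)"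
    by (rule set_integrable_subset) (auto simp: einterval_iff)
  show "(((\<lambda>x. h x * W x) \<circ> real_of_ereal) \<longlongrightarrow> 0) (at_right a)" by (rule r(2))
  show "(((\<lambda>x. h x * W x) \<circ> real_of_ereal) \<longlongrightarrow> 0) (at_left b)" by (rule l(2))
  have "(LBINT x=a..b. h' x * W x + h x * v x) = 0 - 0"
  proof (rule interval_integral_FTC_integrable[OF ab(5) _ _ _ r(2) l(2)])
    fix x assume "a < ereal x" "ereal x < b"
    then have x: "x \<in> einterval a b" by (simp add: einterval_iff)
    have "DERIV (\<lambda>x. h x * W x) x :> h' x * W x + h x * v x"
      by (rule derivative_eq_intros h[OF x] W[OF x] refl)+ (simp add: algebra_simps)
    then show "((\<lambda>x. h x * W x) has_vector_derivative h' x * W x + h x * v x) (at x)"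
      by (simp add: has_real_derivative_iff_has_vector_derivative)
    show "isCont (\<lambda>x. h' x * W x + h x * v x) x"
      by (intro continuous_intros h' v DERIV_isCont[OF h] DERIV_isCont[OF W] x)
  qed (intro set_integral_add int hv)
  then have "(LBINT x:einterval a b. h' x * W x + h x * v x) = 0"
    using less_imp_le[OF ab(5)] by (simp add: interval_lebesgue_integral_def)
  then show "(LBINT x:einterval a b. h' x * W x) = - (LBINT x:einterval a b. h x * v x)"
    using set_integral_add(2)[OF int hv] by simp
qed

section \<open>Continuous laws\<close>

text \<open>Common form of \<open>B\<close> in the two cases: \<open>p\<close> is the derivative of
  \<open>u\<close> or its backward difference. Only \<open>\<delta>\<close> and the slope
  \<open>2 * real k * \<delta> - 1\<close> reach the top coefficient, contributing
  \<open>- m * \<delta>\<close> and \<open>1 - 2 * k * \<delta>\<close>.\<close>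

lemma degree_coeff_pearson_operator:
  fixes u p :: "real poly" and a b c \<delta> :: real and k m :: nat
  assumes u: "degree u \<le> m" and p: "\<And>i. m \<le> i \<Longrightarrow> coeff p i = 0"
    and lead: "\<And>n. m = Suc n \<Longrightarrow> coeff p n = real m * coeff u m"
  defines "v \<equiv> - ([:a, b, \<delta>:] * p + [:c, 2 * real k * \<delta> - 1:] * u)"
  shows "degree v \<le> Suc m" and "coeff v (Suc m) = (1 - real (2 * k + m) * \<delta>) * coeff u m"
proof -
  have cu: "coeff u i = 0" if "m < i" for i using u that by (simp add: coeff_eq_0)
  have cv: "coeff v (Suc i) = - (a * coeff p (Suc i) + b * coeff p i + (case i of 0 \<Rightarrow> 0 | Suc n \<Rightarrow> \<delta> * coeff p n)
      + c * coeff u (Suc i) + (2 * real k * \<delta> - 1) * coeff u i)" for i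
    by (cases i) (simp_all add: v_def)
  show "degree v \<le> Suc m"
  proof (rule degree_le, intro allI impI)
    fix i assume "Suc m < i"
    then obtain i' where "i = Suc i'" "m < i'" by (cases i) auto
    then show "coeff v i = 0"
      by (cases i') (auto simp: cv p cu less_imp_le)
  qed
  show "coeff v (Suc m) = (1 - real (2 * k + m) * \<delta>) * coeff u m"
    using lead by (cases m) (auto simp: cv p cu algebra_simps)
qed

lemma eventually_at_right_ereal:
  assumes "a < ereal c"
  shows "eventually (\<lambda>y. \<exists>x. y = ereal x \<and> a < ereal x \<and> x < c) (at_right a)"
  unfolding eventually_at_right[OF assms]
proof (intro exI[of _ "ereal c"] conjI allI impI assms)
  fix y assume "a < y" "y < ereal c"
  then show "\<exists>x. y = ereal x \<and> a < ereal x \<and> x < c" by (cases y) auto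
qed

lemma set_integral_pos:
  fixes g :: "real \<Rightarrow> real"
  assumes I: "open I" "I \<noteq> {}" and g: "set_integrable lborel I g" and pos: "\<And>x. x \<in> I \<Longrightarrow> 0 < g x"
  shows "0 < (LBINT x:I. g x)"
proof -
  have nn: "AE x in lborel. 0 \<le> indicator I x *\<^sub>R g x"
    using pos by (intro AE_I2) (auto simp: indicator_def less_imp_le)
  have "(LBINT x:I. g x) \<noteq> 0"
  proof
    assume "(LBINT x:I. g x) = 0"
    then have "AE x in lborel. indicator I x *\<^sub>R g x = 0"
      using g nn unfolding set_lebesgue_integral_def set_integrable_def
      by (subst (asm) integral_nonneg_eq_0_iff_AE) auto
    then have "AE x in lborel. x \<notin> I" by (rule eventually_mono) (use pos in \<open>force simp: indicator_def\<close>)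
    then have "I \<in> null_sets lborel" using I by (subst AE_iff_null_sets) auto
    then show False using I negligible_iff_null_sets open_not_negligible null_sets_completionI by blast
  qed
  moreover have "0 \<le> (LBINT x:I. g x)"
    unfolding set_lebesgue_integral_def by (rule integral_nonneg_AE[OF nn])
  ultimately show ?thesis by simp
qed

section \<open>Pearson densities on their open support\<close>

locale pearson_density =
  fixes f :: "real \<Rightarrow> real" and r s :: ereal and \<delta> \<beta> \<gamma> \<mu> :: real
    and I :: "real set" and q :: "real poly" and L :: "nat \<Rightarrow> real poly"
  defines "I \<equiv> einterval r s" and "q \<equiv> [:\<gamma>, \<beta>, \<delta>:]"
    and "L \<equiv> \<lambda>j. [:\<mu> + real j * \<beta>, 2 * real j * \<delta> - 1:]"
  assumes rs: "r < s"
    and f_pos: "\<And>x. x \<in> I \<Longrightarrow> 0 < f x"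
    and q_pos: "\<And>x. x \<in> I \<Longrightarrow> 0 < poly q x"
    and isCont_f: "\<And>x. x \<in> I \<Longrightarrow> isCont f x"
    and DERIV_qf: "\<And>x. x \<in> I \<Longrightarrow> DERIV (\<lambda>x. poly q x * f x) x :> (\<mu> - x) * f x"
    and qf_lim: "(((\<lambda>x. poly q x * f x) \<circ> real_of_ereal) \<longlongrightarrow> 0) (at_right r)"
      "(((\<lambda>x. poly q x * f x) \<circ> real_of_ereal) \<longlongrightarrow> 0) (at_left s)"
    and moments: "\<And>n. set_integrable lborel I (\<lambda>x. x ^ n * f x)"
begin

text \<open>Unlike the weight of the ladder, this one includes the density, so expectations appear
  as Lebesgue integrals over \<open>I\<close>.\<close>

definition w :: "nat \<Rightarrow> real \<Rightarrow> real" where "w j x = poly q x ^ j * f x"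

lemma open_I: "open I" by (simp add: I_def)

lemma I_nonempty: "I \<noteq> {}" using einterval_nonempty[OF rs] by (auto simp: I_def)

lemma w_pos: "x \<in> I \<Longrightarrow> 0 < w j x"
  by (simp add: w_def f_pos q_pos)

lemma isCont_w: "x \<in> I \<Longrightarrow> isCont (w j) x"
  unfolding w_def[abs_def] by (intro continuous_intros isCont_f)

lemma integrable_poly_f: "set_integrable lborel I (\<lambda>x. poly p x * f x)"
proof -
  have "set_integrable lborel I (\<lambda>x. coeff p i * (x ^ i * f x))" for i
    using moments by simp
  then have "set_integrable lborel I (\<lambda>x. \<Sum>i\<le>degree p. coeff p i * (x ^ i * f x))"
    unfolding set_integrable_def scaleR_sum_right by (intro Bochner_Integration.integrable_sum)
  then show ?thesis by (simp add: poly_altdef sum_distrib_right mult.assoc)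
qed

lemma integrable_poly_w: "set_integrable lborel I (\<lambda>x. poly p x * w j x)"
  using integrable_poly_f[of "p * q ^ j"] by (simp add: w_def mult.assoc)

lemma poly_L: "poly (L j) x = \<mu> - x + real j * poly (pderiv q) x"
  by (simp add: L_def q_def pderiv_pCons algebra_simps)

text \<open>\<open>L j\<close> is \<open>\<mu> - x\<close> plus \<open>j\<close> times the
  derivative of \<open>q\<close>. Writing the weight as \<open>q ^ j * (q * f)\<close> uses the
  derivative of \<open>q * f\<close>, which the Pearson identity provides, whereas \<open>f\<close>
  is only known to be continuous.\<close>

lemma DERIV_w: 
  assumes "x \<in> I"
  shows "DERIV (w (Suc j)) x :> poly (L j) x * w j x"
proof -
  have "DERIV (\<lambda>x. poly q x ^ j * (poly q x * f x)) x :>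
      (real j * poly q x ^ (j - 1) * poly (pderiv q) x) * (poly q x * f x) + ((\<mu> - x) * f x) * poly q x ^ j"
    by (rule DERIV_mult'[THEN DERIV_cong, OF _ DERIV_qf[OF assms]])
       (auto intro!: derivative_eq_intros poly_DERIV)
  moreover have "(real j * poly q x ^ (j - 1) * poly (pderiv q) x) * (poly q x * f x) + ((\<mu> - x) * f x) * poly q x ^ j
    = poly (L j) x * w j x"
    unfolding poly_L w_def by (cases j) (auto simp: algebra_simps)
  ultimately show ?thesis by (simp add: w_def[abs_def] mult_ac)
qed

text \<open>Since \<open>w (Suc j)\<close> is positive and vanishes at both ends, its derivative takes both signs.\<close>

lemma sign_change:
  assumes j: "2 * real j * \<delta> < 1"
    and lim: "((w (Suc j) \<circ> real_of_ereal) \<longlongrightarrow> 0) (at_right r)" "((w (Suc j) \<circ> real_of_ereal) \<longlongrightarrow> 0) (at_left s)"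
  obtains c d where "c \<in> I" "\<And>x. x \<in> I \<Longrightarrow> c \<le> x \<Longrightarrow> poly (L j) x * w j x \<le> 0"
    "d \<in> I" "\<And>x. x \<in> I \<Longrightarrow> x \<le> d \<Longrightarrow> 0 \<le> poly (L j) x * w j x"
proof -
  obtain x0 where x0: "x0 \<in> I" using I_nonempty by auto
  then have x0': "r < ereal x0" "ereal x0 < s" by (auto simp: I_def einterval_iff)
  have between: "z \<in> I" if "x \<in> I" "y \<in> I" "x \<le> z" "z \<le> y" for x y z
    using that unfolding I_def einterval_iff by (metis ereal_less_eq(3) le_less_trans less_le_trans)
  \<comment> \<open>The slope of \<open>L j\<close> is negative, so a sign found at one point
    persists up to the corresponding end of the interval.\<close>
  have antimono: "poly (L j) y \<le> poly (L j) x" if "x \<le> y" for x y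
  proof -
    have "(1 - 2 * real j * \<delta>) * x \<le> (1 - 2 * real j * \<delta>) * y" using j that by (intro mult_left_mono) auto
    then show ?thesis by (simp add: L_def algebra_simps)
  qed
  have mvt: "\<exists>z\<in>I. w (Suc j) y - w (Suc j) x = (y - x) * (poly (L j) z * w j z)" if "x \<in> I" "y \<in> I" "x < y" for x y
  proof -
    have "\<exists>z>x. z < y \<and> w (Suc j) y - w (Suc j) x = (y - x) * (poly (L j) z * w j z)"
      by (rule MVT2[OF that(3)]) (auto intro!: DERIV_w between[OF that(1,2)])
    then show ?thesis using between[OF that(1,2)] by (meson less_imp_le)
  qed
  have "\<forall>\<^sub>F y in at_left s. (w (Suc j) \<circ> real_of_ereal) y < w (Suc j) x0 \<and> (\<exists>x. y = ereal x \<and> x0 < x \<and> ereal x < s)"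
    by (intro eventually_conj order_tendstoD(2)[OF lim(2)] eventually_at_left_ereal w_pos x0 x0')
  moreover have "at_left s \<noteq> bot"
    using eventually_at_left[OF x0'(2), of "\<lambda>_. False"] dense[where y = s] by auto
  ultimately obtain y where "(w (Suc j) \<circ> real_of_ereal) y < w (Suc j) x0" "\<exists>x. y = ereal x \<and> x0 < x \<and> ereal x < s"
    using eventually_happens by blast
  then obtain x1 where x1: "w (Suc j) x1 < w (Suc j) x0" "x0 < x1" "ereal x1 < s" by auto
  have "x1 \<in> I" using x1 x0' less_trans[of r "ereal x0" "ereal x1"] by (simp add: I_def einterval_iff)
  then obtain c where c: "c \<in> I" "w (Suc j) x1 - w (Suc j) x0 = (x1 - x0) * (poly (L j) c * w j c)"
    using mvt[OF x0 _ x1(2)] by blast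
  have "poly (L j) c \<le> 0"
  proof (rule ccontr)
    assume "\<not> ?thesis"
    then have "0 \<le> (x1 - x0) * (poly (L j) c * w j c)"
      using w_pos[OF c(1), of j] x1 by (intro mult_nonneg_nonneg) auto
    then show False using c x1 by simp
  qed
  then have C: "poly (L j) x * w j x \<le> 0" if "x \<in> I" "c \<le> x" for x
    using antimono[OF that(2)] w_pos[OF that(1), of j] by (simp add: mult_nonpos_nonneg)
  have "\<forall>\<^sub>F y in at_right r. (w (Suc j) \<circ> real_of_ereal) y < w (Suc j) x0 \<and> (\<exists>x. y = ereal x \<and> r < ereal x \<and> x < x0)"
    by (intro eventually_conj order_tendstoD(2)[OF lim(1)] eventually_at_right_ereal w_pos x0 x0')
  moreover have "at_right r \<noteq> bot"
    using eventually_at_right[OF x0'(1), of "\<lambda>_. False"] dense[where x = r] by auto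
  ultimately obtain y where "(w (Suc j) \<circ> real_of_ereal) y < w (Suc j) x0" "\<exists>x. y = ereal x \<and> r < ereal x \<and> x < x0"
    using eventually_happens by blast
  then obtain x2 where x2: "w (Suc j) x2 < w (Suc j) x0" "x2 < x0" "r < ereal x2" by auto
  have "x2 \<in> I" using x2 x0' less_trans[of "ereal x2" "ereal x0" s] by (simp add: I_def einterval_iff)
  then obtain d where d: "d \<in> I" "w (Suc j) x0 - w (Suc j) x2 = (x0 - x2) * (poly (L j) d * w j d)"
    using mvt[OF _ x0 x2(2)] by blast
  have "0 \<le> poly (L j) d"
  proof (rule ccontr)
    assume "\<not> ?thesis"
    then have "(x0 - x2) * (poly (L j) d * w j d) \<le> 0"
      using w_pos[OF d(1), of j] x2 by (intro mult_nonneg_nonpos mult_nonpos_nonneg) auto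
    then show False using d x2 by simp
  qed
  then have D: "0 \<le> poly (L j) x * w j x" if "x \<in> I" "x \<le> d" for x
    using antimono[OF that(2)] w_pos[OF that(1), of j] by simp
  show thesis by (rule that[OF c(1) C d(1) D])
qed

lemma by_parts:
  assumes j: "2 * real j * \<delta> < 1"
    and lim: "((w (Suc j) \<circ> real_of_ereal) \<longlongrightarrow> 0) (at_right r)" "((w (Suc j) \<circ> real_of_ereal) \<longlongrightarrow> 0) (at_left s)"
    and h: "\<And>x. x \<in> I \<Longrightarrow> DERIV h x :> h' x"
    and h': "\<And>x. x \<in> I \<Longrightarrow> isCont h' x"
    and int: "set_integrable lborel I (\<lambda>x. h' x * w (Suc j) x)"
  shows "set_integrable lborel I (\<lambda>x. h x * (poly (L j) x * w j x))"
    and "(((\<lambda>x. h x * w (Suc j) x) \<circ> real_of_ereal) \<longlongrightarrow> 0) (at_right r)"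
    and "(((\<lambda>x. h x * w (Suc j) x) \<circ> real_of_ereal) \<longlongrightarrow> 0) (at_left s)"
    and "(LBINT x:I. h' x * w (Suc j) x) = - (LBINT x:I. h x * (poly (L j) x * w j x))"
proof -
  obtain c d where cd: "c \<in> I" "\<And>x. x \<in> I \<Longrightarrow> c \<le> x \<Longrightarrow> poly (L j) x * w j x \<le> 0"
    "d \<in> I" "\<And>x. x \<in> I \<Longrightarrow> x \<le> d \<Longrightarrow> 0 \<le> poly (L j) x * w j x"
    using sign_change[OF j lim] by blast
  have v: "isCont (\<lambda>x. poly (L j) x * w j x) x" if "x \<in> I" for x
    by (intro continuous_intros isCont_w that)
  note * = integration_by_parts_einterval[where a = r and b = s and W = "w (Suc j)"
      and v = "\<lambda>x. poly (L j) x * w j x" and h = h and h' = h', folded I_def,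
      OF DERIV_w v w_pos cd lim h h' int]
  show "set_integrable lborel I (\<lambda>x. h x * (poly (L j) x * w j x))"
    "(((\<lambda>x. h x * w (Suc j) x) \<circ> real_of_ereal) \<longlongrightarrow> 0) (at_right r)"
    "(((\<lambda>x. h x * w (Suc j) x) \<circ> real_of_ereal) \<longlongrightarrow> 0) (at_left s)"
    "(LBINT x:I. h' x * w (Suc j) x) = - (LBINT x:I. h x * (poly (L j) x * w j x))"
    by (rule *; assumption)+
qed

lemma w_1_lim: "((w (Suc 0) \<circ> real_of_ereal) \<longlongrightarrow> 0) (at_right r)" "((w (Suc 0) \<circ> real_of_ereal) \<longlongrightarrow> 0) (at_left s)"
  using qf_lim by (simp_all add: w_def[abs_def])

text \<open>At \<open>j = 0\<close> the condition \<open>2 * real j * \<delta> < 1\<close> is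
  trivial and the moments give integrability, so this instance is available before the sign of
  \<open>\<delta>\<close> is known.\<close>

lemmas by_parts_poly = by_parts[OF _ w_1_lim poly_DERIV poly_isCont integrable_poly_w, simplified]

text \<open>\<open>w (Suc j)\<close> is the polynomial \<open>q ^ j\<close> times
  \<open>w (Suc 0)\<close>, hence itself one of the vanishing boundary terms of
  \<open>by_parts_poly\<close>.\<close>

lemma w_lim: "((w (Suc j) \<circ> real_of_ereal) \<longlongrightarrow> 0) (at_right r)" "((w (Suc j) \<circ> real_of_ereal) \<longlongrightarrow> 0) (at_left s)"
proof -
  have *: "w (Suc j) = (\<lambda>x. poly (q ^ j) x * w (Suc 0) x)" by (auto simp: w_def mult_ac)
  show "((w (Suc j) \<circ> real_of_ereal) \<longlongrightarrow> 0) (at_right r)" "((w (Suc j) \<circ> real_of_ereal) \<longlongrightarrow> 0) (at_left s)"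
    unfolding * by (rule by_parts_poly)+
qed

text \<open>Testing with \<open>q ^ j * L j\<close> shows that
  \<open>1 - 2 * real j * \<delta>\<close> times the positive integral of \<open>w (Suc j)\<close>
  equals the integral of \<open>L j ^ 2 * w j\<close>, which is nonnegative. All moments exist, so
  \<open>j\<close> can be arbitrarily large, and \<open>\<delta>\<close> cannot be positive.\<close>

lemma delta_le: "\<delta> \<le> 0"
proof -
  have *: "2 * real j * \<delta> \<le> 1" for j
  proof -
    \<comment> \<open>With \<open>q ^ j\<close> inside the test polynomial, integration by parts is
      needed at level 0 only. At level \<open>j\<close> it would presuppose
      \<open>2 * real j * \<delta> < 1\<close>.\<close>
    let ?p = "q ^ j * L j"
    have id: "poly (pderiv ?p) x * w (Suc 0) x + poly ?p x * (poly (L 0) x * w 0 x)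
        = poly (L j ^ 2) x * w j x - (1 - 2 * real j * \<delta>) * w (Suc j) x" for x
    proof -
      have "poly (pderiv (L j)) x = 2 * real j * \<delta> - 1" by (simp add: L_def pderiv_pCons)
      then have D: "poly (pderiv ?p) x = poly q x ^ j * (2 * real j * \<delta> - 1)
          + poly (L j) x * (real j * poly q x ^ (j - 1) * poly (pderiv q) x)"
        by (simp add: pderiv_mult pderiv_power)
      show ?thesis unfolding D
        by (cases j) (simp_all add: w_def poly_L[of _ x] power2_eq_square algebra_simps)
    qed
    have i: "set_integrable lborel I (\<lambda>x. poly (pderiv ?p) x * w (Suc 0) x)"
      "set_integrable lborel I (\<lambda>x. poly ?p x * (poly (L 0) x * w 0 x))"
      "set_integrable lborel I (\<lambda>x. poly (L j ^ 2) x * w j x)" "set_integrable lborel I (\<lambda>x. w (Suc j) x)"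
      using integrable_poly_w[of _ "Suc 0"] integrable_poly_w[of "?p * L 0" 0] integrable_poly_w[of "L j ^ 2" j]
        integrable_poly_w[of 1 "Suc j"] by (auto simp: mult.assoc)
    have "0 = (LBINT x:I. poly (pderiv ?p) x * w (Suc 0) x + poly ?p x * (poly (L 0) x * w 0 x))"
      using by_parts_poly(4)[of ?p] i by simp
    also have "\<dots> = (LBINT x:I. poly (L j ^ 2) x * w j x) - (1 - 2 * real j * \<delta>) * (LBINT x:I. w (Suc j) x)"
      unfolding id using i by simp
    finally have "(1 - 2 * real j * \<delta>) * (LBINT x:I. w (Suc j) x) = (LBINT x:I. poly (L j ^ 2) x * w j x)" by simp
    also have "\<dots> \<ge> 0"
      unfolding set_lebesgue_integral_def
      by (rule integral_nonneg_AE) (auto simp: indicator_def intro!: AE_I2 mult_nonneg_nonneg less_imp_le[OF w_pos])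
    finally have "0 \<le> (1 - 2 * real j * \<delta>) * (LBINT x:I. w (Suc j) x)" .
    moreover have "0 < (LBINT x:I. w (Suc j) x)"
      by (rule set_integral_pos[OF open_I I_nonempty i(4) w_pos])
    ultimately show ?thesis by (simp add: zero_le_mult_iff)
  qed
  show ?thesis
  proof (rule ccontr)
    assume "\<not> \<delta> \<le> 0"
    then obtain j :: nat where "1 / (2 * \<delta>) < real j" using reals_Archimedean2 by blast
    with *[of j] \<open>\<not> \<delta> \<le> 0\<close> show False by (simp add: field_simps)
  qed
qed

end

section \<open>Adjointness on the support\<close>

context pearson_density
begin

lemma w_Suc: "w (Suc j) x = poly q x * w j x"
  by (simp add: w_def)

lemma slope: "2 * real j * \<delta> < 1"
  by (rule le_less_trans[OF mult_nonneg_nonpos]) (use delta_le in auto)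

lemma integrable_bounded_mult:
  assumes g: "set_integrable lborel I g" and b: "\<And>x. x \<in> I \<Longrightarrow> \<bar>poly p x\<bar> \<le> C"
  shows "set_integrable lborel I (\<lambda>x. poly p x * g x)"
proof (rule set_integrable_bound)
  show "set_integrable lborel I (\<lambda>x. C * g x)" using g by simp
  have "(\<lambda>x. poly p x * (indicator I x *\<^sub>R g x)) \<in> borel_measurable lborel"
    using g by (intro borel_measurable_times) (simp_all add: set_integrable_def)
  then show "set_borel_measurable lborel I (\<lambda>x. poly p x * g x)"
    unfolding set_borel_measurable_def by (simp add: mult.left_commute)
  show "AE x in lborel. x \<in> I \<longrightarrow> norm (poly p x * g x) \<le> norm (C * g x)"
  proof (intro AE_I2 impI)
    fix x assume "x \<in> I"
    from b[OF this] have "\<bar>poly p x\<bar> \<le> \<bar>C\<bar>" by linarith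
    then show "norm (poly p x * g x) \<le> norm (C * g x)" by (simp add: abs_mult mult_right_mono)
  qed
qed

lemma bounded_if_delta_neg:
  assumes "\<delta> < 0"
  shows "\<exists>C. \<forall>x\<in>I. \<bar>x\<bar> \<le> C"
proof (intro exI ballI)
  fix x assume "x \<in> I"
  then have q: "0 < \<gamma> + x * \<beta> + x * x * \<delta>" using q_pos[of x] by (simp add: q_def algebra_simps)
  \<comment> \<open>For \<open>\<bar>x\<bar> > 1\<close>, positivity of \<open>q\<close> gives
    \<open>- \<delta> * \<bar>x\<bar> * \<bar>x\<bar> \<le> (\<bar>\<beta>\<bar> +
    \<bar>\<gamma>\<bar>) * \<bar>x\<bar>\<close>; dividing by \<open>\<bar>x\<bar>\<close> leaves
    this bound.\<close>
  show "\<bar>x\<bar> \<le> max 1 ((\<bar>\<beta>\<bar> + \<bar>\<gamma>\<bar>) / (- \<delta>))"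
  proof (cases "\<bar>x\<bar> \<le> 1")
    case False
    have "- \<delta> * \<bar>x\<bar> * \<bar>x\<bar> \<le> \<bar>\<beta>\<bar> * \<bar>x\<bar> + \<bar>\<gamma>\<bar>"
      using q abs_ge_self[of "x * \<beta>"] abs_ge_self[of \<gamma>] by (simp add: abs_mult mult_ac)
    also have "\<dots> \<le> (\<bar>\<beta>\<bar> + \<bar>\<gamma>\<bar>) * \<bar>x\<bar>"
      using False mult_left_mono[of 1 "\<bar>x\<bar>" "\<bar>\<gamma>\<bar>"] by (simp add: algebra_simps)
    finally have "- \<delta> * \<bar>x\<bar> \<le> \<bar>\<beta>\<bar> + \<bar>\<gamma>\<bar>" 
      using False by (intro mult_right_le_imp_le[of "- \<delta> * \<bar>x\<bar>" "\<bar>x\<bar>"]) auto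
    then have "\<bar>x\<bar> \<le> (\<bar>\<beta>\<bar> + \<bar>\<gamma>\<bar>) / (- \<delta>)" using assms by (simp add: field_simps)
    then show ?thesis by simp
  qed simp
qed

text \<open>For \<open>\<delta> = 0\<close>, \<open>q\<close> has degree at most 1, so with
  \<open>h = x ^ k * G j\<close> the product \<open>h' * w (Suc j)\<close> involves exponents up to
  \<open>k\<close> only. Integration by parts then makes \<open>h * L j * w j\<close> integrable,
  and \<open>L j\<close> has slope -1, which gives exponent \<open>k + 1\<close>. One term sits at
  level \<open>Suc j\<close>, hence the induction covers all \<open>j\<close> at once.\<close>

lemma integrable_poly_mult:
  assumes G: "\<And>j x. x \<in> I \<Longrightarrow> DERIV (G j) x :> G (Suc j) x"
    and int: "\<And>j. set_integrable lborel I (\<lambda>x. G j x * w j x)"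
  shows "set_integrable lborel I (\<lambda>x. poly p x * (G j x * w j x))"
proof (cases "\<delta> < 0")
  case True
  then obtain C where C: "\<And>x. x \<in> I \<Longrightarrow> \<bar>x\<bar> \<le> C"
    using bounded_if_delta_neg by blast
  show ?thesis
  proof (rule integrable_bounded_mult[OF int])
    fix x assume "x \<in> I"
    have "\<bar>poly p x\<bar> \<le> (\<Sum>i\<le>degree p. \<bar>coeff p i * x ^ i\<bar>)"
      unfolding poly_altdef by (rule sum_abs)
    also have "\<dots> \<le> (\<Sum>i\<le>degree p. \<bar>coeff p i\<bar> * C ^ i)"
      using C[OF \<open>x \<in> I\<close>] by (intro sum_mono) (auto simp: abs_mult power_abs intro!: mult_left_mono power_mono)
    finally show "\<bar>poly p x\<bar> \<le> (\<Sum>i\<le>degree p. \<bar>coeff p i\<bar> * C ^ i)" .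
  qed
next
  case False
  then have \<delta>: "\<delta> = 0" using delta_le by simp
  have q0: "poly q x = \<gamma> + x * \<beta>" and L0: "poly (L j) x = \<mu> + real j * \<beta> - x" for x j
    by (simp_all add: q_def L_def \<delta>)
  have pw: "set_integrable lborel I (\<lambda>x. x ^ n * (G j x * w j x))" for n j
  proof (induction n arbitrary: j rule: less_induct)
    case (less n)
    show ?case
    proof (cases n)
      case (Suc k)
      have h': "set_integrable lborel I (\<lambda>x. (real k * x ^ (k - 1) * G j x + x ^ k * G (Suc j) x) * w (Suc j) x)"
      proof -
        have "set_integrable lborel I (\<lambda>x. real k * \<gamma> * (x ^ (k - 1) * (G j x * w j x))
          + real k * \<beta> * (x ^ k * (G j x * w j x)) + x ^ k * (G (Suc j) x * w (Suc j) x))"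
          using less Suc by (intro set_integral_add set_integrable_mult_right) auto
        also have "(\<lambda>x. real k * \<gamma> * (x ^ (k - 1) * (G j x * w j x))
          + real k * \<beta> * (x ^ k * (G j x * w j x)) + x ^ k * (G (Suc j) x * w (Suc j) x))
          = (\<lambda>x. (real k * x ^ (k - 1) * G j x + x ^ k * G (Suc j) x) * w (Suc j) x)"
          by (rule ext, cases k) (simp_all add: w_Suc q0 algebra_simps)
        finally show ?thesis .
      qed
      have "set_integrable lborel I (\<lambda>x. (x ^ k * G j x) * (poly (L j) x * w j x))"
      proof (rule by_parts(1)[OF slope w_lim _ _ h'])
        fix x assume x: "x \<in> I"
        show "DERIV (\<lambda>x. x ^ k * G j x) x :> real k * x ^ (k - 1) * G j x + x ^ k * G (Suc j) x"
          by (rule derivative_eq_intros G[OF x] refl)+ simp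
        show "isCont (\<lambda>x. real k * x ^ (k - 1) * G j x + x ^ k * G (Suc j) x) x"
          by (intro continuous_intros DERIV_isCont[OF G] x)
      qed
      moreover have "set_integrable lborel I (\<lambda>x. (\<mu> + real j * \<beta>) * (x ^ k * (G j x * w j x)))"
        using less Suc by simp
      ultimately have "set_integrable lborel I (\<lambda>x. (\<mu> + real j * \<beta>) * (x ^ k * (G j x * w j x))
          - (x ^ k * G j x) * (poly (L j) x * w j x))"
        by (rule set_integral_diff(1)[rotated])
      then show ?thesis by (simp add: Suc L0 algebra_simps)
    qed (use int in simp)
  qed
  have "set_integrable lborel I (\<lambda>x. coeff p i * (x ^ i * (G j x * w j x)))" for i
    using pw by simp
  then have "set_integrable lborel I (\<lambda>x. \<Sum>i\<le>degree p. coeff p i * (x ^ i * (G j x * w j x)))"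
    unfolding set_integrable_def scaleR_sum_right by (intro Bochner_Integration.integrable_sum)
  then show ?thesis by (simp add: poly_altdef sum_distrib_right mult.assoc)
qed

text \<open>\<open>B j u * w j\<close> is minus the derivative of
  \<open>u * w (Suc j)\<close>.\<close>

definition B :: "nat \<Rightarrow> real poly \<Rightarrow> real poly" where
  "B j u = - (q * pderiv u + L j * u)"

lemma degree_coeff_B:
  assumes "degree u \<le> m"
  shows degree_B: "degree (B j u) \<le> Suc m"
    and coeff_B: "coeff (B j u) (Suc m) = (1 - real (2 * j + m) * \<delta>) * coeff u m"
proof -
  have 1: "coeff (pderiv u) i = 0" if "m \<le> i" for i
    using assms that by (simp add: coeff_pderiv coeff_eq_0)
  have 2: "coeff (pderiv u) n = real m * coeff u m" if "m = Suc n" for n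
    using that by (simp add: coeff_pderiv)
  note * = degree_coeff_pearson_operator[OF assms, of "pderiv u" \<gamma> \<beta> \<delta> "\<mu> + real j * \<beta>" j, OF 1 2]
  show "degree (B j u) \<le> Suc m" "coeff (B j u) (Suc m) = (1 - real (2 * j + m) * \<delta>) * coeff u m"
    unfolding B_def q_def L_def by (rule *; assumption)+
qed

text \<open>Integration by parts for the product of \<open>h\<close> and \<open>u\<close>.
  Integrability of all polynomial multiples lets the resulting integrals be separated; it comes from
  the moments when \<open>h\<close> is a polynomial and from \<open>integrable_poly_mult\<close>
  otherwise.\<close>

lemma ladder_step:
  assumes h: "\<And>x. x \<in> I \<Longrightarrow> DERIV h x :> h' x" and h': "\<And>x. x \<in> I \<Longrightarrow> isCont h' x"
    and int: "\<And>p. set_integrable lborel I (\<lambda>x. poly p x * (h x * w j x))"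
    and int': "\<And>p. set_integrable lborel I (\<lambda>x. poly p x * (h' x * w (Suc j) x))"
  shows "(LBINT x:I. h' x * poly u x * w (Suc j) x) = (LBINT x:I. h x * poly (B j u) x * w j x)"
proof -
  have eq: "(h' x * poly u x + h x * poly (pderiv u) x) * w (Suc j) x
      = poly u x * (h' x * w (Suc j) x) + poly (pderiv u * q) x * (h x * w j x)" for x
    by (simp add: w_def algebra_simps)
  have i: "set_integrable lborel I (\<lambda>x. (h' x * poly u x + h x * poly (pderiv u) x) * w (Suc j) x)"
    unfolding eq by (intro set_integral_add int int')
  have "(LBINT x:I. (h' x * poly u x + h x * poly (pderiv u) x) * w (Suc j) x)
      = - (LBINT x:I. (h x * poly u x) * (poly (L j) x * w j x))"
  proof (rule by_parts(4)[OF slope w_lim _ _ i])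
    fix x assume x: "x \<in> I"
    show "DERIV (\<lambda>x. h x * poly u x) x :> h' x * poly u x + h x * poly (pderiv u) x"
      by (rule derivative_eq_intros h[OF x] poly_DERIV refl)+ (simp add: mult.commute)
    show "isCont (\<lambda>x. h' x * poly u x + h x * poly (pderiv u) x) x"
      by (intro continuous_intros h' DERIV_isCont[OF h] x)
  qed
  also have "(\<lambda>x. (h x * poly u x) * (poly (L j) x * w j x)) = (\<lambda>x. poly (L j * u) x * (h x * w j x))"
    by (auto simp: algebra_simps)
  finally have "(LBINT x:I. poly u x * (h' x * w (Suc j) x)) =
     - (LBINT x:I. poly (pderiv u * q) x * (h x * w j x)) - (LBINT x:I. poly (L j * u) x * (h x * w j x))"
    unfolding eq using set_integral_add(2)[OF int'[of u] int[of "pderiv u * q"]] by simp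
  also have "\<dots> = (LBINT x:I. - (poly (pderiv u * q) x * (h x * w j x)) - poly (L j * u) x * (h x * w j x))"
    using set_integral_diff(2)[OF set_integrable_mult_right[OF int[of "pderiv u * q"], of "-1"] int[of "L j * u"]]
    by (simp add: set_lebesgue_integral_def)
  also have "(\<lambda>x. - (poly (pderiv u * q) x * (h x * w j x)) - poly (L j * u) x * (h x * w j x))
      = (\<lambda>x. h x * poly (B j u) x * w j x)"
    by (auto simp: B_def algebra_simps)
  finally show ?thesis by (simp add: mult_ac)
qed

lemma ladder:
  assumes G: "\<And>j x. x \<in> I \<Longrightarrow> DERIV (G j) x :> G (Suc j) x"
    and int: "\<And>j. set_integrable lborel I (\<lambda>x. G j x * w j x)"
  shows "(LBINT x:I. G (Suc j) x * poly u x * w (Suc j) x) = (LBINT x:I. G j x * poly (B j u) x * w j x)"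
proof (rule ladder_step)
  show "isCont (G (Suc j)) x" if "x \<in> I" for x by (rule DERIV_isCont[OF G[OF that]])
  show "DERIV (G j) x :> G (Suc j) x" if "x \<in> I" for x by (rule G[OF that])
  have *: "set_integrable lborel I (\<lambda>x. poly p x * (G k x * w k x))" for p k
    by (rule integrable_poly_mult[OF G int])
  show "set_integrable lborel I (\<lambda>x. poly p x * (G j x * w j x))"
    "set_integrable lborel I (\<lambda>x. poly p x * (G (Suc j) x * w (Suc j) x))" for p
    by (rule *)+
qed

lemma ladder_poly:
  "(LBINT x:I. poly (pderiv p) x * poly u x * w (Suc j) x) = (LBINT x:I. poly p x * poly (B j u) x * w j x)"
proof (rule ladder_step)
  show "set_integrable lborel I (\<lambda>x. poly p' x * (poly p x * w j x))" for p'
    using integrable_poly_w[of "p' * p" j] by (simp add: mult.assoc)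
  show "set_integrable lborel I (\<lambda>x. poly p' x * (poly (pderiv p) x * w (Suc j) x))" for p'
    using integrable_poly_w[of "p' * pderiv p" "Suc j"] by (simp add: mult.assoc)
qed (rule poly_DERIV poly_isCont)+

end

section \<open>Regularity of the density from the Pearson identity\<close>

locale pearson_law = light_tailed +
  fixes f :: "real \<Rightarrow> real" and r s :: ereal and \<delta> \<beta> \<gamma> \<mu> :: real and I :: "real set"
  defines "I \<equiv> einterval r s"
  assumes f_measurable[measurable]: "f \<in> borel_measurable borel"
    and f_nonneg: "\<And>x. 0 \<le> f x"
    and N_eq: "N = density lborel (\<lambda>x. ennreal (f x))"
    and mean: "\<mu> = (\<integral>x. x \<partial>N)"
    and pearson: "\<And>x. (LBINT t:{..x}. (\<mu> - t) * f t) = poly [:\<gamma>, \<beta>, \<delta>:] x * f x"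
    and f_pos: "\<And>x. x \<in> I \<Longrightarrow> 0 < f x"
    and support: "\<And>x. 0 < f x \<Longrightarrow> r \<le> ereal x \<and> ereal x \<le> s"
begin

lemma I_measurable[measurable]: "I \<in> sets borel" by (simp add: I_def)

lemma AE_f_zero: "AE x in lborel. f x \<noteq> 0 \<longrightarrow> x \<in> I"
proof -
  \<comment> \<open>\<open>real_of_ereal\<close> sends an infinite endpoint to 0, which merely
    excludes one more point.\<close>
  have "AE x in lborel. x \<notin> {real_of_ereal r, real_of_ereal s}"
    by (intro AE_not_in finite_imp_null_set_lborel) simp
  then show ?thesis
  proof (rule eventually_mono, intro impI)
    fix x assume "x \<notin> {real_of_ereal r, real_of_ereal s}" "f x \<noteq> 0"
    moreover then have "r \<le> ereal x" "ereal x \<le> s" using support[of x] f_nonneg[of x] by auto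
    ultimately show "x \<in> I" by (cases r; cases s) (auto simp: I_def einterval_iff)
  qed
qed

lemma integrable_iff:
  assumes "\<phi> \<in> borel_measurable borel"
  shows "integrable N \<phi> \<longleftrightarrow> set_integrable lborel I (\<lambda>x. \<phi> x * f x)"
proof -
  have "integrable N \<phi> \<longleftrightarrow> integrable lborel (\<lambda>x. f x * \<phi> x)"
    unfolding N_eq using assms f_nonneg by (subst integrable_real_density) auto
  also have "\<dots> \<longleftrightarrow> integrable lborel (\<lambda>x. indicator I x *\<^sub>R (\<phi> x * f x))"
    using assms AE_f_zero by (intro integrable_cong_AE) (auto elim!: eventually_mono simp: indicator_def)
  finally show ?thesis by (simp add: set_integrable_def)
qed

lemma integral_eq:
  assumes "\<phi> \<in> borel_measurable borel"
  shows "(\<integral>x. \<phi> x \<partial>N) = (LBINT x:I. \<phi> x * f x)"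
proof -
  have "(\<integral>x. \<phi> x \<partial>N) = (\<integral>x. f x * \<phi> x \<partial>lborel)"
    unfolding N_eq using assms f_nonneg by (subst integral_real_density) auto
  also have "\<dots> = (\<integral>x. indicator I x *\<^sub>R (\<phi> x * f x) \<partial>lborel)"
    using assms AE_f_zero by (intro integral_cong_AE) (auto elim!: eventually_mono simp: indicator_def)
  finally show ?thesis by (simp add: set_lebesgue_integral_def)
qed

lemma AE_I: "AE x in N. x \<in> I"
  unfolding N_eq using AE_f_zero
  by (subst AE_density) (auto elim!: eventually_mono)

lemma r_less_s: "r < s"
proof (rule ccontr)
  assume "\<not> r < s"
  then have "I = {}" by (auto simp: I_def einterval_iff dest: less_trans)
  then show False using AE_I by (simp add: AE_False)
qed

abbreviation \<psi> :: "real \<Rightarrow> real" where "\<psi> t \<equiv> (\<mu> - t) * f t"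

text \<open>\<open>f\<close> is only known to be measurable at first; its regularity is read off
  from this integral, which equals \<open>q * f\<close>. Continuity of \<open>F\<close> gives that
  of \<open>f = F / q\<close> on \<open>I\<close>, which makes \<open>\<psi>\<close> continuous
  there and \<open>F\<close> differentiable.\<close>

definition F :: "real \<Rightarrow> real" where "F x = (LBINT t:{..x}. \<psi> t)"

lemma F_eq: "F x = poly [:\<gamma>, \<beta>, \<delta>:] x * f x"
  by (simp add: F_def pearson)

lemma integrable_poly:
  assumes "\<And>x. \<phi> x = poly p x"
  shows "integrable N \<phi>"
proof -
  have "\<phi> = (\<lambda>x. poly 1 x * poly p x)" using assms by auto
  then show ?thesis
    using square_integrable_mult[OF square_integrable_poly[of 1] square_integrable_poly[of p]] by simp
qed

lemma integrable_psi: "integrable lborel \<psi>" and integral_psi: "(\<integral>t. \<psi> t \<partial>lborel) = 0"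
proof -
  have i: "integrable N (\<lambda>x. x)" "integrable N (\<lambda>x. \<mu> - x)"
    by (rule integrable_poly[of _ "[:0, 1:]"] integrable_poly[of _ "[:\<mu>, -1:]"], simp)+
  show "integrable lborel \<psi>"
    using i(2) f_nonneg unfolding N_eq by (subst (asm) integrable_real_density) (auto simp: mult.commute)
  have "(\<integral>t. \<psi> t \<partial>lborel) = (\<integral>x. \<mu> - x \<partial>N)"
    unfolding N_eq using f_nonneg by (subst integral_real_density) (auto simp: mult.commute)
  also have "\<dots> = 0" using i prob_space by (simp add: mean)
  finally show "(\<integral>t. \<psi> t \<partial>lborel) = 0" .
qed

lemma AE_psi: "AE t in lborel. \<psi> t \<noteq> 0 \<longrightarrow> t \<in> I"
  using AE_f_zero by (rule eventually_mono) auto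

lemma integral_indicator_psi_cong:
  assumes "A \<in> sets borel" "B \<in> sets borel" "A \<inter> I = B \<inter> I"
  shows "(LBINT t:A. \<psi> t) = (LBINT t:B. \<psi> t)"
  unfolding set_lebesgue_integral_def
  using AE_psi assms by (intro integral_cong_AE) (auto elim!: eventually_mono simp: indicator_def)

text \<open>Dominated convergence, with \<open>A\<close> the almost everywhere limit of the
  half-lines \<open>{..u n}\<close>. It serves both ends of the support and the continuity of
  \<open>F\<close>.\<close>

lemma F_tendsto:
  assumes A: "A \<in> sets borel"
    and "AE t in lborel. \<forall>\<^sub>F n in sequentially. t \<le> u n \<longleftrightarrow> t \<in> A"
  shows "(\<lambda>n. F (u n)) \<longlonglongrightarrow> (LBINT t:A. \<psi> t)"
  unfolding F_def set_lebesgue_integral_def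
proof (rule integral_dominated_convergence[where w = "\<lambda>t. \<bar>\<psi> t\<bar>"])
  show "AE t in lborel. (\<lambda>n. indicator {..u n} t *\<^sub>R \<psi> t) \<longlonglongrightarrow> indicator A t *\<^sub>R \<psi> t"
    using assms(2)
  proof eventually_elim
    case (elim t)
    show ?case
      by (rule tendsto_eventually, rule eventually_mono[OF elim]) (auto simp: indicator_def)
  qed
qed (use A integrable_psi in \<open>auto simp: indicator_def\<close>)

text \<open>At \<open>r\<close> the half-lines shrink to a set disjoint from \<open>I\<close>. At
  \<open>s\<close> they exhaust \<open>I\<close>, and the total integral of \<open>\<psi>\<close> is
  0 because \<open>\<mu>\<close> is the mean.\<close>

lemma F_lim: "((F \<circ> real_of_ereal) \<longlongrightarrow> 0) (at_right r)" "((F \<circ> real_of_ereal) \<longlongrightarrow> 0) (at_left s)"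
proof -
  show "((F \<circ> real_of_ereal) \<longlongrightarrow> 0) (at_right r)"
  proof (rule tendsto_at_right_sequentially[OF r_less_s])
    fix S assume S: "\<And>n. r < S n" "\<And>n. S n < s" "decseq S" "S \<longlonglongrightarrow> r"
    define u where "u n = real_of_ereal (S n)" for n
    have u: "ereal (u n) = S n" for n
      using S(1,2)[of n] by (cases "S n") (auto simp: u_def)
    have "(\<lambda>n. F (u n)) \<longlonglongrightarrow> (LBINT t:{t. ereal t \<le> r}. \<psi> t)"
    proof (rule F_tendsto, simp, intro AE_I2)
      fix t
      show "\<forall>\<^sub>F n in sequentially. t \<le> u n \<longleftrightarrow> t \<in> {t. ereal t \<le> r}"
      proof (cases "ereal t \<le> r")
        case True
        then have "ereal t \<le> ereal (u n)" for n using S(1)[of n] u[of n] by (metis le_less_trans less_imp_le)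
        with True show ?thesis by simp
      next
        case False
        then have "\<forall>\<^sub>F n in sequentially. S n < ereal t" using S(4) by (intro order_tendstoD) auto
        then show ?thesis by eventually_elim (use False in \<open>auto simp flip: u\<close>)
      qed
    qed
    also have "(LBINT t:{t. ereal t \<le> r}. \<psi> t) = (LBINT t:{}. \<psi> t)"
      by (rule integral_indicator_psi_cong) (auto simp: I_def einterval_iff)
    finally show "(\<lambda>n. (F \<circ> real_of_ereal) (S n)) \<longlonglongrightarrow> 0"
      by (simp add: u_def set_lebesgue_integral_def)
  qed
  show "((F \<circ> real_of_ereal) \<longlongrightarrow> 0) (at_left s)"
  proof (rule tendsto_at_left_sequentially[OF r_less_s])
    fix S assume S: "\<And>n. S n < s" "\<And>n. r < S n" "incseq S" "S \<longlonglongrightarrow> s"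
    define u where "u n = real_of_ereal (S n)" for n
    have u: "ereal (u n) = S n" for n
      using S(1,2)[of n] by (cases "S n") (auto simp: u_def)
    have "(\<lambda>n. F (u n)) \<longlonglongrightarrow> (LBINT t:{t. ereal t < s}. \<psi> t)"
    proof (rule F_tendsto, simp, intro AE_I2)
      fix t
      show "\<forall>\<^sub>F n in sequentially. t \<le> u n \<longleftrightarrow> t \<in> {t. ereal t < s}"
      proof (cases "ereal t < s")
        case True
        then have "\<forall>\<^sub>F n in sequentially. ereal t < S n" using S(4) by (intro order_tendstoD) auto
        then show ?thesis by eventually_elim (use True in \<open>auto simp flip: u\<close>)
      next
        case False
        then have "\<not> ereal t \<le> ereal (u n)" for n using S(1)[of n] u[of n] by (metis le_less_trans)
        with False show ?thesis by simp
      qed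
    qed
    also have "(LBINT t:{t. ereal t < s}. \<psi> t) = (LBINT t:UNIV. \<psi> t)"
      by (rule integral_indicator_psi_cong) (auto simp: I_def einterval_iff)
    also have "\<dots> = 0" using integral_psi by (simp add: set_lebesgue_integral_def)
    finally show "(\<lambda>n. (F \<circ> real_of_ereal) (S n)) \<longlonglongrightarrow> 0" by (simp add: u_def)
  qed
qed

lemma isCont_F: "isCont F x"
  unfolding continuous_at_sequentially o_def
proof (intro allI impI)
  fix u :: "nat \<Rightarrow> real" assume u: "u \<longlonglongrightarrow> x"
  have "AE t in lborel. t \<noteq> x" by (rule AE_lborel_singleton)
  then have "AE t in lborel. \<forall>\<^sub>F n in sequentially. t \<le> u n \<longleftrightarrow> t \<in> {..x}"
  proof eventually_elim
    case (elim t)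
    show ?case
    proof (cases "t < x")
      case True
      from order_tendstoD(1)[OF u this] show ?thesis by eventually_elim (use True in auto)
    next
      case False
      with elim have "x < t" by simp
      from order_tendstoD(2)[OF u this] show ?thesis by eventually_elim (use \<open>x < t\<close> in auto)
    qed
  qed
  from F_tendsto[OF _ this] show "(\<lambda>n. F (u n)) \<longlonglongrightarrow> F x" unfolding F_def[of x] by simp
qed

text \<open>On the support, \<open>\<psi> t\<close> has the sign of \<open>\<mu> - t\<close>. For
  \<open>x \<le> \<mu>\<close> the integral runs over positive values; otherwise \<open>F x\<close>
  is minus the integral over the rest of the support, as the total is 0.\<close>

lemma F_pos:
  assumes x: "x \<in> I"
  shows "0 < F x"
proof (cases "x \<le> \<mu>")
  case True
  have lt: "ereal t < s" if "t < x" for t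
    using x that less_trans[of "ereal t" "ereal x" s] by (simp add: I_def einterval_iff)
  have "F x = (LBINT t:einterval r x. \<psi> t)"
  proof -
    have "F x = (LBINT t:{..<x}. \<psi> t)"
      unfolding F_def set_lebesgue_integral_def
      using AE_lborel_singleton[of x] by (intro integral_cong_AE) (auto elim!: eventually_mono simp: indicator_def)
    also have "\<dots> = (LBINT t:einterval r x. \<psi> t)"
      by (rule integral_indicator_psi_cong) (auto simp: I_def einterval_iff)
    finally show ?thesis .
  qed
  also have "\<dots> > 0"
  proof (rule set_integral_pos)
    show "einterval r (ereal x) \<noteq> {}" using einterval_nonempty[of r "ereal x"] x by (auto simp: I_def einterval_iff)
    show "set_integrable lborel (einterval r (ereal x)) \<psi>"
      unfolding set_integrable_def by (rule integrable_mult_indicator) (auto intro: integrable_psi)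
    show "0 < \<psi> t" if "t \<in> einterval r (ereal x)" for t
      using that True lt[of t] by (intro mult_pos_pos f_pos) (auto simp: I_def einterval_iff)
  qed simp
  finally show ?thesis .
next
  case False
  have lt: "r < ereal t" if "x < t" for t
    using x that less_trans[of r "ereal x" "ereal t"] by (simp add: I_def einterval_iff)
  have "0 < (LBINT t:einterval x s. - \<psi> t)"
  proof (rule set_integral_pos)
    show "einterval (ereal x) s \<noteq> {}" using einterval_nonempty[of "ereal x" s] x by (auto simp: I_def einterval_iff)
    show "set_integrable lborel (einterval (ereal x) s) (\<lambda>t. - \<psi> t)"
      unfolding set_integrable_def by (rule integrable_mult_indicator) (auto intro: integrable_psi)
    show "0 < - \<psi> t" if "t \<in> einterval (ereal x) s" for t
    proof -
      have "0 < (t - \<mu>) * f t"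
        using that False lt[of t] by (intro mult_pos_pos f_pos) (auto simp: I_def einterval_iff)
      then show ?thesis by (simp add: algebra_simps)
    qed
  qed simp
  also have "(LBINT t:einterval x s. - \<psi> t) = - (LBINT t:einterval x s. \<psi> t)"
    by (simp add: set_lebesgue_integral_def)
  also have "(LBINT t:einterval x s. \<psi> t) = (LBINT t:{x<..}. \<psi> t)"
    by (rule integral_indicator_psi_cong) (auto simp: I_def einterval_iff)
  also have "\<dots> = - F x"
  proof -
    have i: "set_integrable lborel A \<psi>" if "A \<in> sets borel" for A
      unfolding set_integrable_def by (rule integrable_mult_indicator) (use that in \<open>auto intro: integrable_psi\<close>)
    have "(LBINT t:{..x} \<union> {x<..}. \<psi> t) = F x + (LBINT t:{x<..}. \<psi> t)"
      unfolding F_def by (rule set_integral_Un) (auto intro: i)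
    moreover have "{..x} \<union> {x<..} = UNIV" by auto
    ultimately show ?thesis using integral_psi by (simp add: set_lebesgue_integral_def)
  qed
  finally show ?thesis by simp
qed

lemma q_pos:
  assumes "x \<in> I"
  shows "0 < poly [:\<gamma>, \<beta>, \<delta>:] x"
  using F_pos[OF assms] f_pos[OF assms] by (simp add: F_eq zero_less_mult_iff)

lemma isCont_f:
  assumes "x \<in> I"
  shows "isCont f x"
proof -
  have "isCont (\<lambda>x. F x / poly [:\<gamma>, \<beta>, \<delta>:] x) x"
    using q_pos[OF assms] by (intro continuous_intros isCont_F) auto
  moreover have "\<forall>\<^sub>F y in nhds x. F y / poly [:\<gamma>, \<beta>, \<delta>:] y = f y"
    by (rule eventually_mono[OF eventually_nhds_in_open[of I]])
       (use assms q_pos F_eq in \<open>auto simp: I_def less_imp_neq[symmetric]\<close>)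
  ultimately show ?thesis by (subst (asm) isCont_cong)
qed

lemma DERIV_F:
  assumes x: "x \<in> I"
  shows "DERIV F x :> \<psi> x"
proof -
  have "open I" by (simp add: I_def)
  then obtain e where e: "e > 0" "cball x e \<subseteq> I" using x open_contains_cball by blast
  let ?a = "x - e" and ?b = "x + e"
  have sub: "{?a..?b} \<subseteq> I" using e by (auto simp: subset_iff dist_real_def abs_le_iff)
  have "continuous_on {?a..?b} \<psi>"
    using sub by (intro continuous_at_imp_continuous_on ballI continuous_intros isCont_f) auto
  then have "((\<lambda>u. LBINT t=?a..u. \<psi> t) has_vector_derivative \<psi> x) (at x within {?a..?b})"
    using e by (intro interval_integral_FTC2) auto
  then have "((\<lambda>u. LBINT t=?a..u. \<psi> t) has_real_derivative \<psi> x) (at x)"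
    using e at_within_interior[of x "{?a..?b}"]
    by (simp add: has_real_derivative_iff_has_vector_derivative)
  then have "((\<lambda>u. F ?a + (LBINT t=?a..u. \<psi> t)) has_real_derivative \<psi> x) (at x)"
    using DERIV_add[OF DERIV_const] by fastforce
  moreover have "\<forall>\<^sub>F u in nhds x. F ?a + (LBINT t=?a..u. \<psi> t) = F u"
  proof (rule eventually_mono[OF eventually_nhds_in_open[of "{?a<..<?b}"]])
    fix u assume u: "u \<in> {?a<..<?b}"
    have i: "set_integrable lborel A \<psi>" if "A \<in> sets borel" for A
      unfolding set_integrable_def by (rule integrable_mult_indicator) (use that in \<open>auto intro: integrable_psi\<close>)
    have "(LBINT t:{..?a} \<union> {?a<..u}. \<psi> t) = F ?a + (LBINT t:{?a<..u}. \<psi> t)"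
      unfolding F_def by (rule set_integral_Un) (auto intro: i)
    moreover have "{..?a} \<union> {?a<..u} = {..u}" using u by auto
    ultimately show "F ?a + (LBINT t=?a..u. \<psi> t) = F u"
      using u by (simp add: interval_integral_Ioc F_def)
  qed (use e in auto)
  ultimately show ?thesis by (subst (asm) DERIV_cong_ev[OF refl _ refl])
qed

sublocale pearson_density f r s \<delta> \<beta> \<gamma> \<mu> "einterval r s" "[:\<gamma>, \<beta>, \<delta>:]"
  "\<lambda>j. [:\<mu> + real j * \<beta>, 2 * real j * \<delta> - 1:]"
proof (unfold_locales)
  have F: "F = (\<lambda>x. poly [:\<gamma>, \<beta>, \<delta>:] x * f x)" by (rule ext) (rule F_eq)
  show "r < s" by (rule r_less_s)
  fix x assume "x \<in> einterval r s"
  then have x: "x \<in> I" by (simp add: I_def)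
  show "0 < f x" "0 < poly [:\<gamma>, \<beta>, \<delta>:] x" "isCont f x"
    by (rule f_pos[OF x] q_pos[OF x] isCont_f[OF x])+
  show "DERIV (\<lambda>x. poly [:\<gamma>, \<beta>, \<delta>:] x * f x) x :> \<psi> x"
    using DERIV_F[OF x] unfolding F .
next
  have F: "F = (\<lambda>x. poly [:\<gamma>, \<beta>, \<delta>:] x * f x)" by (rule ext) (rule F_eq)
  show "(((\<lambda>x. poly [:\<gamma>, \<beta>, \<delta>:] x * f x) \<circ> real_of_ereal) \<longlongrightarrow> 0) (at_right r)"
    "(((\<lambda>x. poly [:\<gamma>, \<beta>, \<delta>:] x * f x) \<circ> real_of_ereal) \<longlongrightarrow> 0) (at_left s)"
    using F_lim unfolding F by auto
  show "set_integrable lborel (einterval r s) (\<lambda>x. x ^ n * f x)" for n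
    using integrable_poly[of "\<lambda>x. x ^ n" "monom 1 n"] integrable_iff[of "\<lambda>x. x ^ n"]
    by (simp add: poly_monom I_def)
qed

end

section \<open>The covariance series for densities\<close>

context pearson_law
begin

sublocale ladder: pearson_ladder N t0 \<delta> pderiv B "\<lambda>k x. poly [:\<gamma>, \<beta>, \<delta>:] x ^ k"
proof
  let ?q = "[:\<gamma>, \<beta>, \<delta>:]"
  have w: "poly ?q x ^ k * f x = w k x" for k x by (simp add: w_def)
  have m: "(\<lambda>x. poly a x * poly b x * poly ?q x ^ k) \<in> borel_measurable borel" for a b k
    by measurable
  show "pderiv p = 0" if "degree p = 0" for p :: "real poly"
    using that by (simp add: pderiv_eq_0_iff)
  show "degree (pderiv p) \<le> n" if "degree p \<le> Suc n" for p :: "real poly" and n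
    using that by (simp add: degree_pderiv)
  show "coeff (pderiv p) n = real (Suc n) * coeff p (Suc n)" for p :: "real poly" and n
    by (simp add: coeff_pderiv)
  show "degree (B k p) \<le> Suc m" if "degree p \<le> m" for k m p
    by (rule degree_B[OF that])
  show "coeff (B k p) (Suc m) = (1 - real (2 * k + m) * \<delta>) * coeff p m" if "degree p \<le> m" for k m p
    by (rule coeff_B[OF that])
  show "(\<integral>x. poly (pderiv p) x * poly u x * poly ?q x ^ Suc j \<partial>N)
      = (\<integral>x. poly p x * poly (B j u) x * poly ?q x ^ j \<partial>N)" for p u j
    unfolding integral_eq[OF m] mult.assoc[of _ "poly ?q _ ^ _"] w I_def by (rule ladder_poly)
  \<comment> \<open>For a density every weight has positive mean, so the first alternative of
    \<open>w_pos_or_finite\<close> always holds.\<close>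
  have pos: "0 < (LBINT x:einterval r s. w m x)" for m
    using set_integral_pos[OF open_I I_nonempty _ w_pos] integrable_poly_w[of 1 m] by simp
  have "(\<integral>x. poly ?q x ^ m \<partial>N) = (LBINT x:einterval r s. w m x)" for m
    by (subst integral_eq) (simp_all only: w I_def, measurable)
  then show "(\<integral>x. poly ?q x ^ m \<partial>N) \<noteq> 0 \<or> (\<exists>T. degree T = m \<and> T \<noteq> 0 \<and> (AE x in N. poly T x = 0))" for m
    using pos[of m] by (simp only: less_imp_neq[symmetric] simp_thms)
qed simp

lemma nth_deriv_on_measurable:
  assumes "infinitely_differentiable_on g I"
  shows "nth_deriv_on I k g \<in> borel_measurable borel"
proof -
  have "continuous_on I ((deriv ^^ k) g)"
    using assms by (auto simp: infinitely_differentiable_on_def intro: differentiable_imp_continuous_on)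
  then have "(\<lambda>x. indicator I x *\<^sub>R (deriv ^^ k) g x) \<in> borel_measurable borel"
    by (intro borel_measurable_continuous_on_indicator) auto
  moreover have "(\<lambda>x. indicator I x *\<^sub>R (deriv ^^ k) g x) = nth_deriv_on I k g"
    by (auto simp: nth_deriv_on_def indicator_def)
  ultimately show ?thesis by simp
qed

lemma adjoint_derivatives:
  assumes g: "infinitely_differentiable_on g I"
    and int: "\<And>k. integrable N (\<lambda>x. poly [:\<gamma>, \<beta>, \<delta>:] x ^ k * \<bar>nth_deriv_on I k g x\<bar>)"
  shows "ladder.adjoint (\<lambda>k. nth_deriv_on I k g)"
  unfolding ladder.adjoint_def
proof (intro allI)
  fix j u
  let ?q = "[:\<gamma>, \<beta>, \<delta>:]" and ?G = "\<lambda>k. nth_deriv_on I k g"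
  note [measurable] = nth_deriv_on_measurable[OF g]
  have m: "(\<lambda>x. ?G i x * poly a x * poly ?q x ^ k) \<in> borel_measurable borel" for a k i
    by measurable
  have w: "poly ?q x ^ k * f x = w k x" for k x by (simp add: w_def)
  have G: "DERIV (?G k) x :> ?G (Suc k) x" if x: "x \<in> I" for k x
  proof -
    have o: "open I" by (simp add: I_def)
    have "(deriv ^^ k) g differentiable (at x within I)"
      using g x by (simp add: infinitely_differentiable_on_def differentiable_on_def)
    then have "(deriv ^^ k) g differentiable (at x)" by (simp only: at_within_open[OF x o])
    then have "DERIV ((deriv ^^ k) g) x :> deriv ((deriv ^^ k) g) x"
      by (simp only: DERIV_deriv_iff_real_differentiable)
    then have "DERIV ((deriv ^^ k) g) x :> ?G (Suc k) x" using x by (simp add: nth_deriv_on_def)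
    moreover have "\<forall>\<^sub>F y in nhds x. (deriv ^^ k) g y = ?G k y"
      by (rule eventually_mono[OF eventually_nhds_in_open[OF o x]]) (simp add: nth_deriv_on_def)
    ultimately show ?thesis by (subst (asm) DERIV_cong_ev[OF refl _ refl])
  qed
  have i: "set_integrable lborel I (\<lambda>x. ?G k x * w k x)" for k
  proof (rule set_integrable_bound)
    show "set_integrable lborel I (\<lambda>x. \<bar>?G k x\<bar> * w k x)"
      using int[of k] by (subst (asm) integrable_iff) (auto simp: w_def mult_ac)
    show "set_borel_measurable lborel I (\<lambda>x. ?G k x * w k x)"
      unfolding set_borel_measurable_def w_def by measurable
    show "AE x in lborel. x \<in> I \<longrightarrow> norm (?G k x * w k x) \<le> norm (\<bar>?G k x\<bar> * w k x)"
      by (simp add: abs_mult)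
  qed
  show "(\<integral>x. ?G (Suc j) x * poly u x * poly ?q x ^ Suc j \<partial>N) = (\<integral>x. ?G j x * poly (B j u) x * poly ?q x ^ j \<partial>N)"
    unfolding integral_eq[OF m] mult.assoc[of _ "poly ?q _ ^ _"] w
    by (rule ladder[folded I_def, OF G i])
qed

lemma AE_nth_deriv_on_0: "AE x in N. nth_deriv_on I 0 g x = g x"
  using AE_I by eventually_elim (simp add: nth_deriv_on_def)

text \<open>The sequence in the ladder starts with \<open>nth_deriv_on I 0 g\<close>, which is cut
  off outside \<open>I\<close> and agrees with \<open>g\<close> almost everywhere. Square
  integrability and the covariance are transferred between the two.\<close>

lemma covariance_sums_density:
  assumes g: "square_integrable N g" "infinitely_differentiable_on g I"
    "\<And>k. integrable N (\<lambda>x. poly [:\<gamma>, \<beta>, \<delta>:] x ^ k * \<bar>nth_deriv_on I k g x\<bar>)"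
    and h: "square_integrable N h" "infinitely_differentiable_on h I"
    "\<And>k. integrable N (\<lambda>x. poly [:\<gamma>, \<beta>, \<delta>:] x ^ k * \<bar>nth_deriv_on I k h x\<bar>)"
  shows "(\<lambda>n. (\<integral>x. poly [:\<gamma>, \<beta>, \<delta>:] x ^ Suc n * nth_deriv_on I (Suc n) g x \<partial>N) *
      (\<integral>x. poly [:\<gamma>, \<beta>, \<delta>:] x ^ Suc n * nth_deriv_on I (Suc n) h x \<partial>N) /
      (fact (Suc n) * (\<integral>x. poly [:\<gamma>, \<beta>, \<delta>:] x ^ Suc n \<partial>N) * (\<Prod>j = n..2 * n. 1 - real j * \<delta>)))
    sums covariance N g h"
proof -
  have sq: "square_integrable N (nth_deriv_on I 0 k)" if "square_integrable N k" "infinitely_differentiable_on k I" for k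
  proof -
    note [measurable] = nth_deriv_on_measurable[OF that(2)]
    have "k \<in> borel_measurable N" "nth_deriv_on I 0 k \<in> borel_measurable N"
      using that(1) by (simp_all add: square_integrable_def)
    moreover have "integrable N (\<lambda>x. (nth_deriv_on I 0 k x)\<^sup>2) \<longleftrightarrow> integrable N (\<lambda>x. (k x)\<^sup>2)"
      using calculation AE_nth_deriv_on_0[of k] by (intro integrable_cong_AE) (auto elim!: eventually_mono)
    ultimately show ?thesis using that(1) by (simp add: square_integrable_def)
  qed
  have m: "k \<in> borel_measurable N \<and> nth_deriv_on I 0 k \<in> borel_measurable N"
    if "square_integrable N k" "infinitely_differentiable_on k I" for k
    using that sq[OF that] by (simp add: square_integrable_def)
  have "covariance N (nth_deriv_on I 0 g) (nth_deriv_on I 0 h) = covariance N g h"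
  proof -
    have 1: "(\<integral>x. nth_deriv_on I 0 k x \<partial>N) = (\<integral>x. k x \<partial>N)"
      if "square_integrable N k" "infinitely_differentiable_on k I" for k
      using m[OF that] AE_nth_deriv_on_0[of k] by (intro integral_cong_AE) auto
    show ?thesis
      unfolding covariance_def 1[OF g(1,2)] 1[OF h(1,2)]
    proof (rule integral_cong_AE)
      show "AE x in N. (nth_deriv_on I 0 g x - (\<integral>x. g x \<partial>N)) * (nth_deriv_on I 0 h x - (\<integral>x. h x \<partial>N))
        = (g x - (\<integral>x. g x \<partial>N)) * (h x - (\<integral>x. h x \<partial>N))"
        using AE_nth_deriv_on_0[of g] AE_nth_deriv_on_0[of h] by eventually_elim simp
    qed (use m[OF g(1,2)] m[OF h(1,2)] in auto)
  qed
  with ladder.covariance_sums[OF adjoint_derivatives[OF g(2,3)] sq[OF g(1,2)]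
      adjoint_derivatives[OF h(2,3)] sq[OF h(1,2)]]
  show ?thesis by simp
qed

end

section \<open>Discrete laws\<close>

text \<open>With \<open>T = p (x + a) - p x\<close>, the induction rests on
  \<open>(x + a) * p (x + a) - x * p x = x * T + a * (T + p x)\<close>. Speaking of coefficients
  also covers \<open>m = 0\<close>, where the difference is the zero polynomial.\<close>

lemma coeff_shift_diff:
  fixes p :: "real poly"
  assumes "degree p \<le> m"
  shows "(\<forall>i\<ge>m. coeff (pcompose p [:a, 1:] - p) i = 0) \<and>
    (\<forall>n. m = Suc n \<longrightarrow> coeff (pcompose p [:a, 1:] - p) n = a * real m * coeff p m)"
  using assms
proof (induction p arbitrary: m)
  case (pCons c p)
  let ?T = "pcompose p [:a, 1:] - p"
  have eq: "pcompose (pCons c p) [:a, 1:] - pCons c p = pCons 0 ?T + smult a (?T + p)"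
    by (simp add: pcompose_pCons algebra_simps)
  show ?case
  proof (cases "p = 0")
    case True
    then show ?thesis using pCons.prems by (auto simp: pcompose_pCons coeff_pCons split: nat.split)
  next
    case False
    then obtain m' where m: "m = Suc m'" "degree p \<le> m'" using pCons.prems by (cases m) auto
    note IH = pCons.IH[OF m(2)]
    have p0: "coeff p i = 0" if "i > m'" for i using m(2) that by (simp add: coeff_eq_0)
    have T0: "coeff ?T i = 0" if "m' \<le> i" for i using IH that by blast
    have T1: "coeff ?T n = a * real m' * coeff p m'" if "m' = Suc n" for n using IH that by blast
    have c: "coeff (pCons 0 ?T + smult a (?T + p)) i
        = (case i of 0 \<Rightarrow> 0 | Suc k \<Rightarrow> coeff ?T k) + a * (coeff ?T i + coeff p i)" for i
      by (cases i) (simp_all only: coeff_add coeff_smult coeff_pCons nat.case)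
    show ?thesis unfolding eq c
    proof (intro conjI allI impI)
      fix i assume "m \<le> i"
      then obtain k where "i = Suc k" "m' \<le> k" using m by (cases i) auto
      then show "(case i of 0 \<Rightarrow> 0 | Suc k \<Rightarrow> coeff ?T k) + a * (coeff ?T i + coeff p i) = 0"
        using T0[of k] T0[of "Suc k"] p0[of "Suc k"] by simp
    next
      fix n assume "m = Suc n"
      then have "n = m'" using m by simp
      then show "(case n of 0 \<Rightarrow> 0 | Suc k \<Rightarrow> coeff ?T k) + a * (coeff ?T n + coeff p n)
          = a * real m * coeff (pCons c p) m"
        using T0[of m'] T1 m(1) by (cases m') (auto simp: algebra_simps)
    qed
  qed
qed simp

lemma rising_prod_Suc: "rising_prod q (Suc k) x = rising_prod q k x * q (x + real k)"
  by (simp add: rising_prod_def)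

lemma rising_prod_Suc_shift: "rising_prod q (Suc k) x = q x * rising_prod q k (x + 1)"
  unfolding rising_prod_def prod.lessThan_Suc_shift by (simp add: add_ac)

section \<open>Pearson laws on the nonnegative integers\<close>

locale discrete_pearson_law = light_tailed +
  fixes p :: "nat \<Rightarrow> real" and \<delta> \<beta> \<gamma> \<mu> :: real and q :: "real poly" and w :: "nat \<Rightarrow> real \<Rightarrow> real"
  defines "q \<equiv> [:\<gamma>, \<beta>, \<delta>:]" and "w \<equiv> rising_prod (poly q)"
  assumes AE_Nats: "AE x in N. x \<in> \<nat>"
    and p_eq: "\<And>n. p n = measure N {real n}"
    and mean: "\<mu> = (\<integral>x. x \<partial>N)"
    and pearson: "\<And>x. (\<Sum>j\<le>x. (\<mu> - real j) * p j) = poly q (real x) * p x"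
begin

lemma p_nonneg: "0 \<le> p n" by (simp add: p_eq)

text \<open>\<open>nat \<lfloor>x\<rfloor>\<close> inverts \<open>real\<close> on the naturals and
  is measurable on the whole line, so it carries expectations under \<open>N\<close> to integrals
  against counting measure.\<close>

lemma distr_N: "distr N (count_space UNIV) (\<lambda>x. nat \<lfloor>x\<rfloor>) = density (count_space UNIV) (\<lambda>n. ennreal (p n))"
proof (rule measure_eqI_countable[where A = UNIV])
  fix n :: nat
  have "emeasure (distr N (count_space UNIV) (\<lambda>x. nat \<lfloor>x\<rfloor>)) {n} = emeasure N {x. nat \<lfloor>x\<rfloor> = n}"
    by (subst emeasure_distr) (auto intro!: arg_cong[where f = "emeasure N"])
  also have "\<dots> = emeasure N {real n}"
    using AE_Nats by (intro emeasure_eq_AE) (auto elim!: eventually_mono Nats_cases)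
  also have "\<dots> = emeasure (density (count_space UNIV) (\<lambda>n. ennreal (p n))) {n}"
    by (simp add: emeasure_density p_eq emeasure_eq_measure nn_integral_count_space_indicator[symmetric]
        nn_integral_count_space_finite)
  finally show "emeasure (distr N (count_space UNIV) (\<lambda>x. nat \<lfloor>x\<rfloor>)) {n}
    = emeasure (density (count_space UNIV) (\<lambda>n. ennreal (p n))) {n}" .
qed auto

lemma AE_floor: "AE x in N. real (nat \<lfloor>x\<rfloor>) = x"
  using AE_Nats by (rule eventually_mono) (auto elim!: Nats_cases)

lemma integrable_iff:
  assumes [measurable]: "\<phi> \<in> borel_measurable borel"
  shows "integrable N \<phi> \<longleftrightarrow> integrable (count_space UNIV) (\<lambda>n. p n * \<phi> (real n))"
proof -
  have "integrable N \<phi> \<longleftrightarrow> integrable N (\<lambda>x. \<phi> (real (nat \<lfloor>x\<rfloor>)))"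
    using AE_floor by (intro integrable_cong_AE) (auto elim!: eventually_mono)
  also have "\<dots> \<longleftrightarrow> integrable (distr N (count_space UNIV) (\<lambda>x. nat \<lfloor>x\<rfloor>)) (\<lambda>n. \<phi> (real n))"
    by (subst integrable_distr_eq) auto
  also have "\<dots> \<longleftrightarrow> integrable (count_space UNIV) (\<lambda>n. p n * \<phi> (real n))"
    unfolding distr_N by (subst integrable_real_density) (auto simp: p_nonneg)
  finally show ?thesis .
qed

lemma integral_eq:
  assumes [measurable]: "\<phi> \<in> borel_measurable borel"
  shows "(\<integral>x. \<phi> x \<partial>N) = (\<integral>n. p n * \<phi> (real n) \<partial>count_space UNIV)"
proof -
  have "(\<integral>x. \<phi> x \<partial>N) = (\<integral>x. \<phi> (real (nat \<lfloor>x\<rfloor>)) \<partial>N)"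
    using AE_floor by (intro integral_cong_AE) (auto elim!: eventually_mono)
  also have "\<dots> = (\<integral>n. \<phi> (real n) \<partial>distr N (count_space UNIV) (\<lambda>x. nat \<lfloor>x\<rfloor>))"
    by (subst integral_distr) auto
  also have "\<dots> = (\<integral>n. p n * \<phi> (real n) \<partial>count_space UNIV)"
    unfolding distr_N by (subst integral_real_density) (auto simp: p_nonneg)
  finally show ?thesis .
qed

lemma borel_measurable_w[measurable]: "w k \<in> borel_measurable borel"
  unfolding w_def rising_prod_def[abs_def] by measurable

lemma mean_sums: "(\<lambda>n. (\<mu> - real n) * p n) sums 0"
proof -
  have i: "integrable N (\<lambda>x. x)"
    using square_integrable_mult[OF square_integrable_poly[of 1] square_integrable_poly[of "[:0, 1:]"]] by simp
  have "integrable N (\<lambda>x. \<mu> - x)" using i by simp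
  then have "integrable (count_space UNIV) (\<lambda>n. p n * (\<mu> - real n))"
    by (subst (asm) integrable_iff) auto
  from sums_integral_count_space_nat[OF this]
  have "(\<lambda>n. p n * (\<mu> - real n)) sums (\<integral>x. \<mu> - x \<partial>N)" by (subst integral_eq) auto
  also have "(\<integral>x. \<mu> - x \<partial>N) = 0" using i prob_space by (simp add: mean)
  finally show ?thesis by (simp add: mult.commute)
qed

definition F :: "nat \<Rightarrow> real" where "F x = poly q (real x) * p x"

text \<open>Difference of the Pearson identity at \<open>x\<close> and \<open>Suc x\<close>, the
  counterpart of differentiating \<open>q * f\<close>: it trades mass at \<open>x\<close> for mass
  at \<open>Suc x\<close> with a polynomial factor.\<close>

lemma F_Suc: "F x = (poly q (real (Suc x)) - \<mu> + real (Suc x)) * p (Suc x)"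
  using pearson[of x] pearson[of "Suc x"] by (simp add: F_def algebra_simps)

lemma F_tail_sums: "(\<lambda>n. (real (n + Suc x) - \<mu>) * p (n + Suc x)) sums F x"
proof -
  have "(\<lambda>n. (\<mu> - real (n + Suc x)) * p (n + Suc x)) sums (0 - (\<Sum>i<Suc x. (\<mu> - real i) * p i))"
    using mean_sums by (subst sums_iff_shift) simp
  from sums_minus[OF this] have "(\<lambda>n. - ((\<mu> - real (n + Suc x)) * p (n + Suc x))) sums F x"
    by (simp add: F_def lessThan_Suc_atMost flip: pearson)
  moreover have "- ((\<mu> - real (n + Suc x)) * p (n + Suc x)) = (real (n + Suc x) - \<mu>) * p (n + Suc x)" for n
    by (simp add: algebra_simps)
  ultimately show ?thesis by simp
qed

text \<open>\<open>F x\<close> is a partial sum of \<open>(\<mu> - n) * p n\<close> and also,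
  because the total is 0, the remaining tail of \<open>(n - \<mu>) * p n\<close>. The terms of the
  former are nonnegative for \<open>x\<close> up to \<open>\<mu>\<close>, those of the latter beyond
  it.\<close>

lemma F_nonneg: "0 \<le> F x"
proof (cases "real x \<le> \<mu>")
  case True
  have "0 \<le> (\<Sum>j\<le>x. (\<mu> - real j) * p j)"
    by (intro sum_nonneg mult_nonneg_nonneg p_nonneg) (use True in auto)
  then show ?thesis by (simp add: pearson F_def)
next
  case False
  have "0 \<le> (real (n + Suc x) - \<mu>) * p (n + Suc x)" for n
    using False by (intro mult_nonneg_nonneg p_nonneg) auto
  then show ?thesis by (rule sums_le[OF _ sums_zero F_tail_sums])
qed

text \<open>Below \<open>\<mu>\<close> the mass at \<open>a\<close> would make the partial sum
  \<open>F x\<close> positive. From \<open>\<mu>\<close> on, \<open>F x\<close> is a tail of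
  nonnegative terms, all of which must vanish.\<close>

lemma p_zero_beyond:
  assumes F: "F x = 0" and a: "0 < p a" "a \<le> x" and y: "x < y"
  shows "p y = 0"
proof (cases "real x < \<mu>")
  case True
  have "(\<mu> - real a) * p a \<le> (\<Sum>j\<le>x. (\<mu> - real j) * p j)"
    using True a(2) by (intro member_le_sum mult_nonneg_nonneg p_nonneg) auto
  also have "\<dots> = F x" by (simp add: pearson F_def)
  finally have "(\<mu> - real a) * p a \<le> 0" using F by simp
  moreover have "0 < (\<mu> - real a) * p a" using True a by (intro mult_pos_pos) auto
  ultimately show ?thesis by simp
next
  case False
  have nn: "0 \<le> (real (n + Suc x) - \<mu>) * p (n + Suc x)" for n
    using False by (intro mult_nonneg_nonneg p_nonneg) auto
  have "(real (n + Suc x) - \<mu>) * p (n + Suc x) = 0" for n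
    using F_tail_sums[of x] F nn suminf_eq_zero_iff[of "\<lambda>n. (real (n + Suc x) - \<mu>) * p (n + Suc x)"]
    by (simp add: sums_iff)
  from this[of "y - Suc x"] y False show ?thesis by simp
qed

lemma p_w_Suc: "p x * w (Suc k) (real x) = F x * w k (real (Suc x))"
  by (simp add: w_def rising_prod_Suc_shift F_def add.commute)

text \<open>\<open>w k\<close> alone may be negative off the support. \<open>p_w_Suc\<close> moves
  the claim to \<open>Suc x\<close>, where the induction hypothesis fixes the sign of
  \<open>w k\<close> if \<open>p (Suc x)\<close> is nonzero; otherwise \<open>F x = 0\<close> by
  \<open>F_Suc\<close>.\<close>

lemma p_w_nonneg: "0 \<le> p x * w k (real x)"
proof (induction k arbitrary: x)
  case 0
  then show ?case by (simp add: w_def rising_prod_def p_nonneg)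
next
  case (Suc k)
  show ?case
  proof (cases "p (Suc x) = 0")
    case True
    then show ?thesis by (simp only: p_w_Suc F_Suc)
  next
    case False
    then have "0 \<le> w k (real (Suc x))"
      using Suc[of "Suc x"] p_nonneg[of "Suc x"] by (auto simp only: zero_le_mult_iff)
    then show ?thesis unfolding p_w_Suc by (intro mult_nonneg_nonneg F_nonneg)
  qed
qed

definition D :: "real poly \<Rightarrow> real poly" where "D u = pcompose u [:1, 1:] - u"

text \<open>The first summand is the shifted part of summation by parts, where \<open>F_Suc\<close>
  supplies the factor \<open>q + x - \<mu>\<close>. In the second, \<open>q (x + k)\<close> is the
  last factor of \<open>w (Suc k)\<close>.\<close>

definition B :: "nat \<Rightarrow> real poly \<Rightarrow> real poly" where
  "B k u = pcompose u [:-1, 1:] * (q + [:- \<mu>, 1:]) - u * pcompose q [:real k, 1:]"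

lemma poly_D: "poly (D u) x = fwd_diff (poly u) x"
  by (simp add: D_def fwd_diff_def poly_pcompose add.commute)

lemma degree_coeff_B:
  assumes "degree u \<le> m"
  shows degree_B: "degree (B k u) \<le> Suc m"
    and coeff_B: "coeff (B k u) (Suc m) = (1 - real (2 * k + m) * \<delta>) * coeff u m"
proof -
  let ?v = "u - pcompose u [:-1, 1:]"
  note c = coeff_shift_diff[OF assms, of "-1"]
  have 1: "coeff ?v i = 0" if "m \<le> i" for i
    using c that by simp
  have 2: "coeff ?v n = real m * coeff u m" if "m = Suc n" for n
    using c that by (simp add: algebra_simps)
  \<comment> \<open>Expand \<open>q (x + k) = q x + 2 * k * \<delta> * x + k * \<beta> + k ^ 2 *
    \<delta>\<close> and write the backward shift of \<open>u\<close> as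
    \<open>u - ?v\<close>.\<close>
  have "B k u = - ([:\<gamma> - \<mu>, \<beta> + 1, \<delta>:] * ?v + [:\<mu> + \<delta> * real k ^ 2 + \<beta> * real k, 2 * real k * \<delta> - 1:] * u)"
  proof (rule poly_eq_poly_eq_iff[THEN iffD1], rule ext)
    show "poly (B k u) x = poly (- ([:\<gamma> - \<mu>, \<beta> + 1, \<delta>:] * ?v
        + [:\<mu> + \<delta> * real k ^ 2 + \<beta> * real k, 2 * real k * \<delta> - 1:] * u)) x" for x
      by (simp add: B_def q_def poly_pcompose power2_eq_square algebra_simps)
  qed
  with degree_coeff_pearson_operator[OF assms, of ?v "\<gamma> - \<mu>" "\<beta> + 1" \<delta> "\<mu> + \<delta> * real k ^ 2 + \<beta> * real k" k, OF 1 2]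
  show "degree (B k u) \<le> Suc m" "coeff (B k u) (Suc m) = (1 - real (2 * k + m) * \<delta>) * coeff u m"
    by simp_all
qed

text \<open>Summation by parts has no boundary terms: by the Pearson relation, the shifted part of
  \<open>(h (n + 1) - h n) u n w\<^sub>j\<^sub>+\<^sub>1 n p n\<close> is a polynomial multiple of \<open>h w\<^sub>j p\<close> at \<open>n + 1\<close> that vanishes at \<open>0\<close>.\<close>

lemma ladder_step:
  assumes [measurable]: "h \<in> borel_measurable borel"
    and int: "\<And>u. integrable N (\<lambda>x. h x * poly u x * w j x)"
  shows "integrable N (\<lambda>x. fwd_diff h x * poly u x * w (Suc j) x)"
    and "(\<integral>x. fwd_diff h x * poly u x * w (Suc j) x \<partial>N) = (\<integral>x. h x * poly (B j u) x * w j x \<partial>N)"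
proof -
  have [measurable]: "fwd_diff h \<in> borel_measurable borel" unfolding fwd_diff_def by measurable
  define a where "a = pcompose u [:-1, 1:] * (q + [:- \<mu>, 1:])"
  define b where "b = u * pcompose q [:real j, 1:]"
  have ab: "B j u = a - b" by (simp add: B_def a_def b_def)
  define \<Phi> where "\<Phi> n = p n * (h (real n) * poly a (real n) * w j (real n))" for n
  define \<Psi> where "\<Psi> n = p n * (h (real n) * poly b (real n) * w j (real n))" for n
  have i: "integrable (count_space UNIV) \<Phi>" "integrable (count_space UNIV) \<Psi>"
    using int[of a] int[of b] by (simp_all add: integrable_iff \<Phi>_def[abs_def] \<Psi>_def[abs_def])
  have eq: "p n * (fwd_diff h (real n) * poly u (real n) * w (Suc j) (real n)) = \<Phi> (Suc n) - \<Psi> n" for n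
  proof -
    have "p n * (fwd_diff h (real n) * poly u (real n) * w (Suc j) (real n))
        = h (real (Suc n)) * poly u (real n) * (p n * w (Suc j) (real n))
          - h (real n) * poly u (real n) * (p n * w (Suc j) (real n))"
      by (simp add: fwd_diff_def algebra_simps)
    also have "h (real (Suc n)) * poly u (real n) * (p n * w (Suc j) (real n)) = \<Phi> (Suc n)"
      unfolding p_w_Suc F_Suc \<Phi>_def a_def by (simp add: poly_pcompose algebra_simps)
    also have "h (real n) * poly u (real n) * (p n * w (Suc j) (real n)) = \<Psi> n"
      by (simp add: w_def rising_prod_Suc \<Psi>_def b_def poly_pcompose algebra_simps)
    finally show ?thesis .
  qed
  \<comment> \<open>The Pearson identity at 0 reads \<open>\<mu> * p 0 = q 0 * p 0\<close>, so the
    factor \<open>q 0 - \<mu>\<close> of \<open>a\<close> at 0 is cancelled by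
    \<open>p 0\<close>.\<close>
  have \<Phi>0: "\<Phi> 0 = 0"
    using pearson[of 0] by (auto simp: \<Phi>_def a_def)
  have shift: "integrable (count_space UNIV) (\<lambda>n. \<Phi> (Suc n))"
    using i(1) summable_Suc_iff[of "\<lambda>n. \<bar>\<Phi> n\<bar>"] by (simp add: integrable_count_space_nat_iff)
  show "integrable N (\<lambda>x. fwd_diff h x * poly u x * w (Suc j) x)"
    by (subst integrable_iff) (use i(2) shift in \<open>auto simp: eq\<close>)
  have "(\<integral>x. fwd_diff h x * poly u x * w (Suc j) x \<partial>N) = (\<integral>n. \<Phi> (Suc n) - \<Psi> n \<partial>count_space UNIV)"
    by (subst integral_eq) (auto simp: eq)
  also have "\<dots> = (\<integral>n. \<Phi> (Suc n) \<partial>count_space UNIV) - (\<integral>n. \<Psi> n \<partial>count_space UNIV)"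
    by (rule Bochner_Integration.integral_diff[OF shift i(2)])
  also have "(\<integral>n. \<Phi> (Suc n) \<partial>count_space UNIV) = (\<integral>n. \<Phi> n \<partial>count_space UNIV)"
    using sums_integral_count_space_nat[OF shift] sums_integral_count_space_nat[OF i(1)] \<Phi>0
    by (metis add.right_neutral sums_Suc_iff sums_unique2)
  also have "(\<integral>n. \<Phi> n \<partial>count_space UNIV) - (\<integral>n. \<Psi> n \<partial>count_space UNIV) = (\<integral>n. \<Phi> n - \<Psi> n \<partial>count_space UNIV)"
    by (rule Bochner_Integration.integral_diff[OF i, symmetric])
  also have "\<dots> = (\<integral>x. h x * poly (B j u) x * w j x \<partial>N)"
    unfolding ab by (subst integral_eq) (auto simp: \<Phi>_def \<Psi>_def algebra_simps intro!: Bochner_Integration.integral_cong)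
  finally show "(\<integral>x. fwd_diff h x * poly u x * w (Suc j) x \<partial>N) = (\<integral>x. h x * poly (B j u) x * w j x \<partial>N)" .
qed

end

lemma borel_measurable_iterate_fwd_diff:
  assumes "g \<in> borel_measurable borel"
  shows "(fwd_diff ^^ j) g \<in> borel_measurable borel"
proof (induction j)
  case (Suc j)
  note [measurable] = Suc
  show ?case unfolding funpow.simps o_def fwd_diff_def[of "(fwd_diff ^^ j) g"] by measurable
qed (use assms in simp)

context discrete_pearson_law
begin

lemma w_eq_poly: "\<exists>r. \<forall>x. w j x = poly r x"
proof (induction j)
  case 0
  show ?case by (intro exI[of _ 1]) (simp add: w_def rising_prod_def)
next
  case (Suc j)
  then obtain r where "\<And>x. w j x = poly r x" by blast
  then show ?case
    by (intro exI[of _ "r * pcompose q [:real j, 1:]"])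
       (simp add: w_def rising_prod_Suc poly_pcompose add.commute)
qed

lemma integrable_poly_poly_w: "integrable N (\<lambda>x. poly v x * poly u x * w j x)"
proof -
  obtain r where "\<And>x. w j x = poly r x" using w_eq_poly by blast
  then show ?thesis
    using square_integrable_mult[OF square_integrable_poly[of "v * u"] square_integrable_poly[of r]] by simp
qed

text \<open>Since \<open>p n * w m n\<close> is nonnegative, mean zero makes it vanish for every
  \<open>n\<close>. At the least support point \<open>a\<close> this gives
  \<open>q (a + i) = 0\<close> for some \<open>i < m\<close>, hence \<open>F (a + i) = 0\<close>,
  and no mass lies beyond \<open>a + i\<close>. The product \<open>T\<close> over
  \<open>a..a + m - 1\<close> therefore vanishes on the support.\<close>

lemma vanishing_poly:
  assumes "(\<integral>x. w m x \<partial>N) = 0"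
  shows "\<exists>T. degree T = m \<and> T \<noteq> 0 \<and> (AE x in N. poly T x = 0)"
proof -
  have i: "integrable (count_space UNIV) (\<lambda>n. p n * w m (real n))"
    using integrable_poly_poly_w[of 1 1 m] by (simp add: integrable_iff)
  have "(\<integral>n. p n * w m (real n) \<partial>count_space UNIV) = 0" using assms by (simp add: integral_eq)
  then have w0: "p n * w m (real n) = 0" for n
    using i integral_nonneg_eq_0_iff_AE[OF i] p_w_nonneg by (simp add: AE_count_space)
  have "(\<integral>x. 1 \<partial>N) = (\<integral>n. p n * 1 \<partial>count_space UNIV)" by (subst integral_eq) auto
  then have "\<exists>n. p n \<noteq> 0"
    using prob_space by (cases "\<forall>n. p n = 0") auto
  define a where "a = (LEAST n. p n \<noteq> 0)"
  have pa: "p a \<noteq> 0" unfolding a_def by (rule LeastI_ex) fact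
  have least: "p n = 0" if "n < a" for n using not_less_Least[OF that[unfolded a_def]] by simp
  have "w m (real a) = 0" using w0[of a] pa by simp
  then obtain i where i: "i < m" "poly q (real (a + i)) = 0"
    by (auto simp: w_def rising_prod_def add.commute)
  define T where "T = (\<Prod>i<m. [:- real (a + i), 1:])"
  have "degree T = m" unfolding T_def by (subst degree_prod_eq_sum_degree) auto
  moreover have "T \<noteq> 0" unfolding T_def by simp
  moreover have "AE x in N. poly T x = 0"
  proof -
    have zero: "p n * (poly T (real n))\<^sup>2 = 0" for n
    proof -
      consider "n < a" | "a \<le> n" "n \<le> a + i" | "a + i < n" by linarith
      then show ?thesis
      proof cases
        case 2
        then have "poly T (real n) = 0"
          unfolding T_def poly_prod using i by (intro prod_zero bexI[of _ "n - a"]) auto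
        then show ?thesis by simp
      next
        case 3
        have "F (a + i) = 0" using i by (simp add: F_def)
        then have "p n = 0" using 3 pa p_nonneg[of a] by (intro p_zero_beyond[of "a + i" a]) auto
        then show ?thesis by simp
      qed (simp add: least)
    qed
    have "(\<integral>x. (poly T x)\<^sup>2 \<partial>N) = (\<integral>n. p n * (poly T (real n))\<^sup>2 \<partial>count_space UNIV)"
      by (rule integral_eq) measurable
    then have "(\<integral>x. (poly T x)\<^sup>2 \<partial>N) = 0" unfolding zero by simp
    moreover have "integrable N (\<lambda>x. (poly T x)\<^sup>2)" using square_integrable_poly[of T] by (simp add: square_integrable_def)
    ultimately show ?thesis by (subst (asm) integral_nonneg_eq_0_iff_AE) auto
  qed
  ultimately show ?thesis by blast
qed

sublocale ladder: pearson_ladder N t0 \<delta> D B w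
proof
  show "D u = 0" if "degree u = 0" for u
    using that by (auto simp: D_def elim!: degree_eq_zeroE)
  show "degree (D u) \<le> n" if "degree u \<le> Suc n" for u n
    using coeff_shift_diff[OF that, of 1] by (intro degree_le) (auto simp: D_def)
  show "coeff (D u) n = real (Suc n) * coeff u (Suc n)" if "degree u \<le> Suc n" for u n
    using coeff_shift_diff[OF that, of 1] by (auto simp: D_def)
  show "degree (B k u) \<le> Suc m" if "degree u \<le> m" for k m u
    by (rule degree_B[OF that])
  show "coeff (B k u) (Suc m) = (1 - real (2 * k + m) * \<delta>) * coeff u m" if "degree u \<le> m" for k m u
    by (rule coeff_B[OF that])
  show "w 0 x = 1" for x by (simp add: w_def rising_prod_def)
  show "(\<integral>x. poly (D v) x * poly u x * w (Suc j) x \<partial>N) = (\<integral>x. poly v x * poly (B j u) x * w j x \<partial>N)" for v u j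
    using ladder_step(2)[of "poly v" j u] integrable_poly_poly_w by (simp add: poly_D)
  show "(\<integral>x. w m x \<partial>N) \<noteq> 0 \<or> (\<exists>T. degree T = m \<and> T \<noteq> 0 \<and> (AE x in N. poly T x = 0))" for m
    using vanishing_poly by blast
qed

text \<open>Square integrability of \<open>g\<close> settles level 0 against every polynomial, and
  \<open>ladder_step(1)\<close> passes integrability on to the next difference.\<close>

lemma adjoint_differences:
  assumes g: "square_integrable N g"
  shows "ladder.adjoint (\<lambda>k. (fwd_diff ^^ k) g)"
proof -
  have m: "(fwd_diff ^^ j) g \<in> borel_measurable borel" for j
    using g by (intro borel_measurable_iterate_fwd_diff)
      (simp add: square_integrable_def cong: measurable_cong_sets)
  have i: "integrable N (\<lambda>x. (fwd_diff ^^ j) g x * poly u x * w j x)" for j u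
  proof (induction j arbitrary: u)
    case 0
    show ?case
      using square_integrable_mult[OF g square_integrable_poly[of u]] by (simp add: w_def rising_prod_def)
  next
    case (Suc j)
    show ?case using ladder_step(1)[OF m Suc] by simp
  qed
  show ?thesis
    unfolding ladder.adjoint_def using ladder_step(2)[OF m i] by simp
qed

lemma covariance_sums_discrete:
  assumes "square_integrable N g" "square_integrable N h"
  shows "(\<lambda>n. (\<integral>x. w (Suc n) x * (fwd_diff ^^ Suc n) g x \<partial>N) * (\<integral>x. w (Suc n) x * (fwd_diff ^^ Suc n) h x \<partial>N) /
      (fact (Suc n) * (\<integral>x. w (Suc n) x \<partial>N) * (\<Prod>j = n..2 * n. 1 - real j * \<delta>)))
    sums covariance N g h"
  using ladder.covariance_sums[OF adjoint_differences[OF assms(1)] _ adjoint_differences[OF assms(2)]] assms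
  by simp

end

section \<open>Transfer from the law back to the random variable\<close>

theorem theorem5p2:
  fixes M :: "'a measure" and X :: "'a \<Rightarrow> real"
    and q g1 g2 :: "real \<Rightarrow> real" and \<delta> \<beta> \<gamma> :: real
  assumes "prob_space M"
    and "X \<in> borel_measurable M"
    and "\<exists>t0>0. \<forall>t. -t0 < t \<and> t < t0 \<longrightarrow> integrable M (\<lambda>\<omega>. exp (t * X \<omega>))"
    and "\<And>x. q x = \<delta> * x\<^sup>2 + \<beta> * x + \<gamma>"
    and "square_integrable (distr M borel X) g1"
    and "square_integrable (distr M borel X) g2"
  shows
    "(\<forall>(f :: real \<Rightarrow> real) (r :: ereal) (s :: ereal) (I :: real set).
        (\<forall>x. 0 \<le> f x) \<and>
        distributed M lborel X (\<lambda>x. ennreal (f x)) \<and>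
        (\<forall>x. (LBINT t:{..x}. ((\<integral>\<omega>. X \<omega> \<partial>M) - t) * f t) = q x * f x) \<and>
        I = {x. r < ereal x \<and> ereal x < s} \<and>
        I \<subseteq> {x. 0 < f x} \<and>
        {x. 0 < f x} \<subseteq> {x. r \<le> ereal x \<and> ereal x \<le> s} \<and>
        (\<forall>g\<in>{g1, g2}. infinitely_differentiable_on g I \<and>
           (\<forall>k. integrable M (\<lambda>\<omega>. q (X \<omega>) ^ k * \<bar>nth_deriv_on I k g (X \<omega>)\<bar>)))
      \<longrightarrow>
        (\<lambda>n. let k = Suc n in
           (\<integral>\<omega>. q (X \<omega>) ^ k * nth_deriv_on I k g1 (X \<omega>) \<partial>M) *
           (\<integral>\<omega>. q (X \<omega>) ^ k * nth_deriv_on I k g2 (X \<omega>) \<partial>M) /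
           (fact k * (\<integral>\<omega>. q (X \<omega>) ^ k \<partial>M) * (\<Prod>j = k - 1..2 * k - 2. 1 - real j * \<delta>)))
        sums covariance M (\<lambda>\<omega>. g1 (X \<omega>)) (\<lambda>\<omega>. g2 (X \<omega>)))
   \<and>
     (\<forall>p :: nat \<Rightarrow> real.
        (AE \<omega> in M. X \<omega> \<in> \<nat>) \<and>
        (\<forall>x. p x = measure M {\<omega> \<in> space M. X \<omega> = real x}) \<and>
        (\<forall>x::nat. (\<Sum>j\<le>x. ((\<integral>\<omega>. X \<omega> \<partial>M) - real j) * p j) = q (real x) * p x) \<and>
        (\<forall>g\<in>{g1, g2}. \<forall>k.
           integrable M (\<lambda>\<omega>. rising_prod q k (X \<omega>) * \<bar>(fwd_diff ^^ k) g (X \<omega>)\<bar>))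
      \<longrightarrow>
        (\<lambda>n. let k = Suc n in
           if (\<integral>\<omega>. rising_prod q k (X \<omega>) \<partial>M) = 0 then 0
           else
           (\<integral>\<omega>. rising_prod q k (X \<omega>) * (fwd_diff ^^ k) g1 (X \<omega>) \<partial>M) *
           (\<integral>\<omega>. rising_prod q k (X \<omega>) * (fwd_diff ^^ k) g2 (X \<omega>) \<partial>M) /
           (fact k * (\<integral>\<omega>. rising_prod q k (X \<omega>) \<partial>M) * (\<Prod>j = k - 1..2 * k - 2. 1 - real j * \<delta>)))
        sums covariance M (\<lambda>\<omega>. g1 (X \<omega>)) (\<lambda>\<omega>. g2 (X \<omega>)))"
proof -
  interpret M: prob_space M by fact
  have X[measurable]: "X \<in> borel_measurable M" by fact
  define N where "N = distr M borel X"
  interpret N: real_distribution N unfolding N_def by (rule M.real_distribution_distr) (rule X)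
  obtain t0 where t0: "0 < t0" "\<And>t. - t0 < t \<and> t < t0 \<Longrightarrow> integrable M (\<lambda>\<omega>. exp (t * X \<omega>))"
    using assms(3) by blast
  interpret N: light_tailed N t0
  proof
    show "integrable N (\<lambda>x. exp (t * x))" if "\<bar>t\<bar> < t0" for t
      unfolding N_def using t0(2)[of t] that by (subst integrable_distr_eq) (auto simp: abs_less_iff)
  qed (rule t0(1))
  have q: "q = poly [:\<gamma>, \<beta>, \<delta>:]"
    using assms(4) by (auto simp: power2_eq_square algebra_simps)
  have q_measurable[measurable]: "q \<in> borel_measurable borel"
    unfolding q by (simp add: borel_measurable_continuous_onI continuous_at_imp_continuous_on)
  have sq: "square_integrable N g" if "g \<in> {g1, g2}" for g
    using that assms(5,6) by (auto simp: N_def)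
  have g_measurable[measurable]: "g1 \<in> borel_measurable borel" "g2 \<in> borel_measurable borel"
    using assms(5,6) by (simp_all add: square_integrable_def)
  have E: "(\<integral>x. \<phi> x \<partial>N) = (\<integral>\<omega>. \<phi> (X \<omega>) \<partial>M)" if "\<phi> \<in> borel_measurable borel" for \<phi> :: "real \<Rightarrow> real"
    unfolding N_def using that by (rule integral_distr[OF X])
  have mean_eq: "(\<integral>x. x \<partial>N) = (\<integral>\<omega>. X \<omega> \<partial>M)" by (rule E) simp
  have cov: "covariance N g1 g2 = covariance M (\<lambda>\<omega>. g1 (X \<omega>)) (\<lambda>\<omega>. g2 (X \<omega>))"
    unfolding covariance_def E[OF g_measurable(1)] E[OF g_measurable(2)] by (rule E) measurable
  show ?thesis
  proof (intro conjI allI impI, goal_cases)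
    case (1 f r s I)
    then have f: "\<And>x. 0 \<le> f x" "distributed M lborel X (\<lambda>x. ennreal (f x))"
      "\<And>x. (LBINT t:{..x}. ((\<integral>\<omega>. X \<omega> \<partial>M) - t) * f t) = q x * f x"
      and I: "I = einterval r s" "I \<subseteq> {x. 0 < f x}" "{x. 0 < f x} \<subseteq> {x. r \<le> ereal x \<and> ereal x \<le> s}"
      and g: "\<And>g. g \<in> {g1, g2} \<Longrightarrow> infinitely_differentiable_on g I"
        "\<And>g k. g \<in> {g1, g2} \<Longrightarrow> integrable M (\<lambda>\<omega>. q (X \<omega>) ^ k * \<bar>nth_deriv_on I k g (X \<omega>)\<bar>)"
      by (auto simp: einterval_def)
    interpret pearson_law N t0 f r s \<delta> \<beta> \<gamma> "\<integral>x. x \<partial>N" I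
    proof (unfold_locales; (unfold I(1))?)
      show "f \<in> borel_measurable borel"
        using distributed_real_measurable[OF _ f(2)] f(1) by simp
      show "N = density lborel (\<lambda>x. ennreal (f x))"
      proof -
        have "N = distr M lborel X" unfolding N_def by (rule distr_cong) auto
        then show ?thesis using f(2) by (simp add: distributed_def)
      qed
      show "(LBINT t:{..x}. ((\<integral>x. x \<partial>N) - t) * f t) = poly [:\<gamma>, \<beta>, \<delta>:] x * f x" for x
        using f(3)[of x] by (simp only: mean_eq q)
    qed (use f(1) I in auto)
    note [measurable] = nth_deriv_on_measurable[OF g(1)]
    have "integrable N (\<lambda>x. poly [:\<gamma>, \<beta>, \<delta>:] x ^ k * \<bar>nth_deriv_on I k g x\<bar>)" if "g \<in> {g1, g2}" for g k
      unfolding N_def q[symmetric] using g(2)[OF that] that by (subst integrable_distr_eq) (auto simp: abs_less_iff)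
    from covariance_sums_density[OF sq g(1) this sq g(1) this, of g1 g2]
    show ?case by (simp add: Let_def E cov flip: q)
  next
    case (2 p)
    then have p: "AE \<omega> in M. X \<omega> \<in> \<nat>" "\<And>x. p x = measure M {\<omega> \<in> space M. X \<omega> = real x}"
      "\<And>x::nat. (\<Sum>j\<le>x. ((\<integral>\<omega>. X \<omega> \<partial>M) - real j) * p j) = q (real x) * p x"
      by auto
    interpret discrete_pearson_law N t0 p \<delta> \<beta> \<gamma> "\<integral>x. x \<partial>N" "[:\<gamma>, \<beta>, \<delta>:]"
      "rising_prod (poly [:\<gamma>, \<beta>, \<delta>:])"
    proof unfold_locales
      show "AE x in N. x \<in> \<nat>" unfolding N_def using p(1) by (subst AE_distr_iff) auto
      show "p n = measure N {real n}" for n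
        unfolding N_def p(2) by (subst measure_distr) (auto intro!: arg_cong[where f = "measure M"])
      show "(\<Sum>j\<le>x. ((\<integral>x. x \<partial>N) - real j) * p j) = poly [:\<gamma>, \<beta>, \<delta>:] (real x) * p x" for x
        using p(3)[of x] by (simp only: mean_eq q)
    qed auto
    have m: "rising_prod q k \<in> borel_measurable borel" for k
      unfolding rising_prod_def[abs_def] by measurable
    have 1: "(\<integral>x. rising_prod q k x * (fwd_diff ^^ k) g x \<partial>N)
        = (\<integral>\<omega>. rising_prod q k (X \<omega>) * (fwd_diff ^^ k) g (X \<omega>) \<partial>M)" if "g \<in> {g1, g2}" for g k
      using that by (intro E borel_measurable_times m borel_measurable_iterate_fwd_diff) auto
    note 1 = 1[of g1, simplified] 1[of g2, simplified]
    from covariance_sums_discrete[OF sq sq, of g1 g2]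
    have "(\<lambda>n. (\<integral>\<omega>. rising_prod q (Suc n) (X \<omega>) * (fwd_diff ^^ Suc n) g1 (X \<omega>) \<partial>M) *
        (\<integral>\<omega>. rising_prod q (Suc n) (X \<omega>) * (fwd_diff ^^ Suc n) g2 (X \<omega>) \<partial>M) /
        (fact (Suc n) * (\<integral>\<omega>. rising_prod q (Suc n) (X \<omega>) \<partial>M) * (\<Prod>j = n..2 * n. 1 - real j * \<delta>)))
      sums covariance M (\<lambda>\<omega>. g1 (X \<omega>)) (\<lambda>\<omega>. g2 (X \<omega>))"
      unfolding q[symmetric] 1 E[OF m] cov by simp
    then show ?case
      \<comment> \<open>If the weight has mean 0, so does the denominator vanish, and HOL's quotient
        is 0, which agrees with the \<open>if\<close> branch.\<close>
      unfolding Let_def by (rule back_subst[where P = "\<lambda>f. f sums _"]) (intro ext, simp)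
  qed
qed

end
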